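(* Let $X$ be a regular space, $F$ a subspace of $X$ which is paracompact in $X$, $\tau$ an infinite cardinal number, $k(F)\le\tau$, and suppose $k(Y)<\tau$ for any closed subset $Y\subseteq X\setminus F$ of $X$. Consider the following assertions. (K1) $k(X)\le\tau$. (K2) For every lower semi-continuous closed-valued mapping $\theta:X\to Y$ into a complete metrizable space $Y$ there exists a lower semi-continuous selection $\phi:X\to Y$ of $\theta$ such that $k(\mathrm{cl}_Y\,\phi(X))\le\tau$. (K3) For every lower semi-continuous closed-valued mapping $\theta:X\to Y$ into a complete metrizable space $Y$ there exists a set-valued selection $g:X\to Y$ of $\theta$ such that $k(\mathrm{cl}_Y\,g(X))\le\tau$. (K4) For every lower semi-continuous closed-valued mapping $\theta:X\to Y$ into a complete metrizable space $Y$ there exists a single-valued selection $g:X\to Y$ of $\theta$ such that $k(\mathrm{cl}_Y\,g(X))\le\tau$. (K5) For every lower semi-continuous mapping $\theta:X\to Y$ into a discrete space $Y$ there exists a lower semi-continuous selection $\phi:X\to Y$ of $\theta$ such that $|\phi(X)|<\tau$. (K6) For every lower semi-continuous mapping $\theta:X\to Y$ into a discrete space $Y$ there exists a set-valued selection $g:X\to Y$ of $\theta$ such that $|g(X)|<\tau$. (K7) For every lower semi-continuous mapping $\theta:X\to Y$ into a discrete space $Y$ there exists a single-valued selection $g:X\to Y$ of $\theta$ such that $|g(X)|<\tau$. (K8) Every open cover of $X$ has a subcover of cardinality $<\tau$. (K11) For every lower semi-continuous closed-valued mapping $\theta:X\to Y$ into a complete metrizable space $Y$ there exists a lower semi-continuous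 selection $\phi:X\to Y$ of $\theta$ such that $w(\phi(X))<\tau$. Then assertions (K1)--(K8) are equivalent. Moreover, if the cardinal number $\tau$ is not sequential, then assertions (K1)--(K8) and (K11) are equivalent.
   Context: All spaces are $T_1$; the domain and range of set-valued mappings are non-empty. A set-valued mapping $\theta:X\to Y$ assigns to every $x\in X$ a non-empty subset $\theta(x)$ of $Y$. For $A\subseteq X$, $B\subseteq Y$ put $\theta(A)=\bigcup\{\theta(x):x\in A\}$ and $\theta^{-1}(B)=\{x\in X:\theta(x)\cap B\ne\emptyset\}$. The mapping $\theta$ is lower (upper) semi-continuous if $\theta^{-1}(H)$ is open (closed) in $X$ for every open (closed) $H\subseteq Y$; it is closed-valued if every $\theta(x)$ is closed in $Y$. A set-valued mapping $\phi:X\to Y$ is a selection of $\theta$ if $\phi(x)\subseteq\theta(x)$ for all $x\in X$; a single-valued selection is a (not necessarily continuous) function $g:X\to Y$ with $g(x)\in\theta(x)$ for all $x$. The degree of compactness of a space $X$ is $k(X)=\min\{m:\text{every open cover of }X\text{ has an open refinement of cardinality }<m\}$. $w(\cdot)$ is the weight. A subspace $Z$ of a space $X$ is paracompact in $X$ if for every family $\gamma=\{W_\mu:\mu\in M\}$ of open subsets of $X$ with $Z\subseteq\bigcup\gamma$ there exists a family $\eta=\{W'_\mu:\mu\in M\}$ of open subsets of $X$, locally finite in $X$, such that $Z\subseteq\bigcup\eta$ and $W'_\mu\subseteq W_\mu$ for any $\mu\in M$. An infinite cardinal $\tau$ is sequential if it is the supremum of a countable sequence of strictly smaller cardinals, i.e.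 $cf(\tau)=\aleph_0$ (in particular $\aleph_0$ is sequential). *)

theory Defs
  imports "HOL-Analysis.Analysis"
begin

unbundle cardinal_syntax

text \<open>
  Cardinals are the cardinal orders of the HOL library, considered up to \<open>=o\<close>. A cardinal
  function takes its value on a type large enough to carry the minimum of the class in
  question; for the degree of compactness and the weight this is shown by
  \<open>degree_of_compactness_ordLeq_iff\<close> and \<open>weight_ordLeq_iff\<close> below, which compare the value
  with cardinals living on arbitrary types.
\<close>

definition least_cardinal :: "('c rel \<Rightarrow> bool) \<Rightarrow> 'c rel" where
  "least_cardinal P =
     (SOME m. Card_order m \<and> P m \<and> (\<forall>m'. Card_order m' \<and> P m' \<longrightarrow> m \<le>o m'))"

definition open_cover :: "'a topology \<Rightarrow> 'a set set \<Rightarrow> bool" where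
  "open_cover X \<U> \<longleftrightarrow> (\<forall>U\<in>\<U>. openin X U) \<and> \<Union>\<U> = topspace X"

definition refines :: "'a set set \<Rightarrow> 'a set set \<Rightarrow> bool" where
  "refines \<V> \<U> \<longleftrightarrow> (\<forall>V\<in>\<V>. \<exists>U\<in>\<U>. V \<subseteq> U)"

definition degree_of_compactness :: "'a topology \<Rightarrow> 'a set set rel" where
  "degree_of_compactness X =
     least_cardinal (\<lambda>m. \<forall>\<U>. open_cover X \<U> \<longrightarrow>
       (\<exists>\<V>. open_cover X \<V> \<and> refines \<V> \<U> \<and> |\<V>| <o m))"

definition topology_base :: "'a topology \<Rightarrow> 'a set set \<Rightarrow> bool" where
  "topology_base X \<B> \<longleftrightarrow>
     (\<forall>B\<in>\<B>. openin X B) \<and>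
     (\<forall>U x. openin X U \<and> x \<in> U \<longrightarrow> (\<exists>B\<in>\<B>. x \<in> B \<and> B \<subseteq> U))"

definition weight :: "'a topology \<Rightarrow> 'a set rel" where
  "weight X = least_cardinal (\<lambda>m. \<exists>\<B>. topology_base X \<B> \<and> m = |\<B>| )"

text \<open>
  The least upper bound is tested against cardinals on the same type only; this is no
  restriction, since every cardinal below \<open>\<tau>\<close> has a representative on that type.
\<close>

definition sequential_cardinal :: "'t rel \<Rightarrow> bool" where
  "sequential_cardinal \<tau> \<longleftrightarrow> Cinfinite \<tau> \<and>
     (\<exists>s :: nat \<Rightarrow> 't rel.
        (\<forall>n. Card_order (s n) \<and> s n <o \<tau>) \<and>
        (\<forall>c :: 't rel. Card_order c \<and> (\<forall>n. s n \<le>o c) \<longrightarrow> \<tau> \<le>o c))"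

text \<open>
  Families of open sets are indexed by sets of elements of \<open>'a set\<close>. Every family of
  subsets of the space can be indexed by its own members, and lemma
  \<open>paracompact_in_indexed\<close> recovers the property for arbitrary index types.
\<close>

definition locally_finite_family :: "'a topology \<Rightarrow> 'i set \<Rightarrow> ('i \<Rightarrow> 'a set) \<Rightarrow> bool" where
  "locally_finite_family X M W \<longleftrightarrow>
     (\<forall>x\<in>topspace X. \<exists>V. openin X V \<and> x \<in> V \<and> finite {\<mu>\<in>M. W \<mu> \<inter> V \<noteq> {}})"

definition paracompact_in :: "'a topology \<Rightarrow> 'a set \<Rightarrow> bool" where
  "paracompact_in X Z \<longleftrightarrow>
     (\<forall>(M :: 'a set set) W. (\<forall>\<mu>\<in>M. openin X (W \<mu>)) \<and> Z \<subseteq> (\<Union>\<mu>\<in>M. W \<mu>) \<longrightarrow>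
        (\<exists>W'. (\<forall>\<mu>\<in>M. openin X (W' \<mu>)) \<and> locally_finite_family X M W' \<and>
              Z \<subseteq> (\<Union>\<mu>\<in>M. W' \<mu>) \<and> (\<forall>\<mu>\<in>M. W' \<mu> \<subseteq> W \<mu>)))"

text \<open>
  HOL cannot quantify over types inside a formula, so target spaces \<open>Y\<close> range over the
  topologies on one type \<open>'b\<close>, which is left as a type variable and hence universally
  quantified in a theorem. An equivalence ``\<open>A\<close> iff (for all \<open>Y\<close> on \<open>'b\<close>, \<open>B Y\<close>)'' proved
  for every \<open>'b\<close> yields ``\<open>A\<close> iff (for all \<open>Y\<close> whatsoever, \<open>B Y\<close>)'': left to right holds at
  each \<open>'b\<close> separately, and right to left needs the right-hand side at a single \<open>'b\<close> only.

  The values of the mapping outside \<open>topspace X\<close> are irrelevant. Nonemptiness of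
  \<open>topspace Y\<close> follows from the other conditions.
\<close>

definition set_valued_map :: "'a topology \<Rightarrow> 'b topology \<Rightarrow> ('a \<Rightarrow> 'b set) \<Rightarrow> bool" where
  "set_valued_map X Y \<theta> \<longleftrightarrow>
     topspace X \<noteq> {} \<and> (\<forall>x\<in>topspace X. \<theta> x \<noteq> {} \<and> \<theta> x \<subseteq> topspace Y)"

definition sv_image :: "('a \<Rightarrow> 'b set) \<Rightarrow> 'a set \<Rightarrow> 'b set" where
  "sv_image \<theta> A = (\<Union>x\<in>A. \<theta> x)"

definition sv_vimage :: "'a topology \<Rightarrow> ('a \<Rightarrow> 'b set) \<Rightarrow> 'b set \<Rightarrow> 'a set" where
  "sv_vimage X \<theta> B = {x\<in>topspace X. \<theta> x \<inter> B \<noteq> {}}"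

definition lower_semicontinuous :: "'a topology \<Rightarrow> 'b topology \<Rightarrow> ('a \<Rightarrow> 'b set) \<Rightarrow> bool" where
  "lower_semicontinuous X Y \<theta> \<longleftrightarrow>
     set_valued_map X Y \<theta> \<and> (\<forall>H. openin Y H \<longrightarrow> openin X (sv_vimage X \<theta> H))"

definition closed_valued :: "'a topology \<Rightarrow> 'b topology \<Rightarrow> ('a \<Rightarrow> 'b set) \<Rightarrow> bool" where
  "closed_valued X Y \<theta> \<longleftrightarrow> (\<forall>x\<in>topspace X. closedin Y (\<theta> x))"

definition sv_selection ::
  "'a topology \<Rightarrow> 'b topology \<Rightarrow> ('a \<Rightarrow> 'b set) \<Rightarrow> ('a \<Rightarrow> 'b set) \<Rightarrow> bool" where
  "sv_selection X Y \<theta> \<phi> \<longleftrightarrow>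
     set_valued_map X Y \<phi> \<and> (\<forall>x\<in>topspace X. \<phi> x \<subseteq> \<theta> x)"

definition single_valued_selection :: "'a topology \<Rightarrow> ('a \<Rightarrow> 'b set) \<Rightarrow> ('a \<Rightarrow> 'b) \<Rightarrow> bool" where
  "single_valued_selection X \<theta> g \<longleftrightarrow> (\<forall>x\<in>topspace X. g x \<in> \<theta> x)"

lemma least_cardinal:
  assumes "Card_order m" "P m"
  shows "Card_order (least_cardinal P)" "P (least_cardinal P)"
    and "\<And>m'. Card_order m' \<Longrightarrow> P m' \<Longrightarrow> least_cardinal P \<le>o m'"
proof -
  have "\<exists>r\<in>{r. Card_order r \<and> P r}. \<forall>r'\<in>{r. Card_order r \<and> P r}. r \<le>o r'"
    by (rule exists_minim_Card_order) (use assms in auto)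
  then have "\<exists>m. Card_order m \<and> P m \<and> (\<forall>m'. Card_order m' \<and> P m' \<longrightarrow> m \<le>o m')"
    by blast
  from someI_ex [OF this]
  show "Card_order (least_cardinal P)" "P (least_cardinal P)"
    "\<And>m'. Card_order m' \<Longrightarrow> P m' \<Longrightarrow> least_cardinal P \<le>o m'"
    unfolding least_cardinal_def by blast+
qed

lemma Card_order_transfer:
  fixes r :: "'c rel" and \<tau> :: "'t rel"
  assumes "Card_order r" "Card_order \<tau>" "\<tau> \<le>o r"
  obtains p :: "'c rel" where "Card_order p" "(\<tau>, p) \<in> ordIso"
proof -
  obtain p :: "'c rel" where p: "(\<tau>, p) \<in> ordIso"
    using assms(3) internalize_ordLeq [of \<tau> r] by blast
  from Card_order_ordIso2 [OF assms(2) p] p show thesis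
    by (rule that)
qed

lemma degree_of_compactness:
  fixes X :: "'a topology"
  shows Card_order_degree_of_compactness: "Card_order (degree_of_compactness X)"
    and degree_of_compactness_ordLeq_iff:
      "Card_order (\<tau> :: 't rel) \<Longrightarrow> degree_of_compactness X \<le>o \<tau> \<longleftrightarrow>
         (\<forall>\<U>. open_cover X \<U> \<longrightarrow>
           (\<exists>\<V>. open_cover X \<V> \<and> refines \<V> \<U> \<and> |\<V>| <o \<tau>))"
proof -
  define P :: "'a set set rel \<Rightarrow> bool" where
    "P = (\<lambda>m. \<forall>\<U>. open_cover X \<U> \<longrightarrow>
           (\<exists>\<V>. open_cover X \<V> \<and> refines \<V> \<U> \<and> |\<V>| <o m))"
  have k: "degree_of_compactness X = least_cardinal P"
    by (simp add: degree_of_compactness_def P_def)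
  have "|\<U>| <o cardSuc |UNIV :: 'a set set|" for \<U> :: "'a set set"
    by (rule ordLeq_ordLess_trans [OF card_of_mono1 [OF subset_UNIV]
          cardSuc_greater [OF card_of_Card_order]])
  then have "P (cardSuc |UNIV :: 'a set set| )"
    unfolding P_def refines_def by blast
  note least = least_cardinal [where P = P, OF cardSuc_Card_order [OF card_of_Card_order] this]
  show co: "Card_order (degree_of_compactness X)"
    using least(1) k by simp
  assume \<tau>: "Card_order \<tau>"
  show "degree_of_compactness X \<le>o \<tau> \<longleftrightarrow>
     (\<forall>\<U>. open_cover X \<U> \<longrightarrow> (\<exists>\<V>. open_cover X \<V> \<and> refines \<V> \<U> \<and> |\<V>| <o \<tau>))"
    (is "?L \<longleftrightarrow> ?R")
  proof
    assume L: ?L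
    have "P (degree_of_compactness X)"
      using least(2) k by simp
    then show ?R
      unfolding P_def by (blast intro: ordLess_ordLeq_trans [OF _ L])
  next
    assume R: ?R
    show ?L
    proof (rule ccontr)
      assume n: "\<not> ?L"
      then have "\<tau> \<le>o degree_of_compactness X"
        using co \<tau> ordLeq_total [of "degree_of_compactness X" \<tau>]
        unfolding card_order_on_def by blast
      then obtain p :: "'a set set rel" where p: "Card_order p" "(\<tau>, p) \<in> ordIso"
        using Card_order_transfer [OF co \<tau>] by blast
      then have "P p"
        using R unfolding P_def by (blast intro: ordLess_ordIso_trans [OF _ p(2)])
      then have "degree_of_compactness X \<le>o p"
        using least(3) p k by simp
      from ordLeq_ordIso_trans [OF this ordIso_symmetric [OF p(2)]] n show False
        by simp
    qed
  qed
qed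

lemma weight:
  fixes X :: "'a topology"
  shows Card_order_weight: "Card_order (weight X)"
    and weight_ordLeq_iff:
      "weight X \<le>o (\<tau> :: 't rel) \<longleftrightarrow> (\<exists>\<B>. topology_base X \<B> \<and> |\<B>| \<le>o \<tau>)"
proof -
  define P :: "'a set rel \<Rightarrow> bool" where
    "P = (\<lambda>m. \<exists>\<B>. topology_base X \<B> \<and> m = |\<B>| )"
  have w: "weight X = least_cardinal P"
    by (simp add: weight_def P_def)
  have PB: "P |\<B>|" if "topology_base X \<B>" for \<B>
    unfolding P_def using that by blast
  have "topology_base X {U. openin X U}"
    by (auto simp: topology_base_def)
  note least = least_cardinal [where P = P, OF card_of_Card_order PB [OF this]]
  show "Card_order (weight X)"
    using least(1) w by simp
  show "weight X \<le>o \<tau> \<longleftrightarrow> (\<exists>\<B>. topology_base X \<B> \<and> |\<B>| \<le>o \<tau>)"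
  proof
    assume le: "weight X \<le>o \<tau>"
    have "P (weight X)"
      using least(2) w by simp
    then obtain \<B> where "topology_base X \<B>" "weight X = |\<B>|"
      unfolding P_def by blast
    with le show "\<exists>\<B>. topology_base X \<B> \<and> |\<B>| \<le>o \<tau>"
      by auto
  next
    assume "\<exists>\<B>. topology_base X \<B> \<and> |\<B>| \<le>o \<tau>"
    then obtain \<B> where \<B>: "topology_base X \<B>" "|\<B>| \<le>o \<tau>"
      by blast
    from ordLeq_transitive [OF least(3) [OF card_of_Card_order PB [OF \<B>(1)]] \<B>(2)]
    show "weight X \<le>o \<tau>"
      unfolding w .
  qed
qed

lemma paracompact_in_indexed:
  fixes W :: "'i \<Rightarrow> 'a set"
  assumes "paracompact_in X Z" "\<forall>\<mu>\<in>M. openin X (W \<mu>)" "Z \<subseteq> (\<Union>\<mu>\<in>M. W \<mu>)"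
  shows "\<exists>W'. (\<forall>\<mu>\<in>M. openin X (W' \<mu>)) \<and> locally_finite_family X M W' \<and>
              Z \<subseteq> (\<Union>\<mu>\<in>M. W' \<mu>) \<and> (\<forall>\<mu>\<in>M. W' \<mu> \<subseteq> W \<mu>)"
proof -
  obtain V where V: "\<And>U. U \<in> W ` M \<Longrightarrow> openin X (V U)"
      "locally_finite_family X (W ` M) V"
      "Z \<subseteq> (\<Union>U\<in>W ` M. V U)" "\<And>U. U \<in> W ` M \<Longrightarrow> V U \<subseteq> U"
  proof -
    have "(\<forall>U\<in>W ` M. openin X (id U)) \<and> Z \<subseteq> (\<Union>U\<in>W ` M. id U)"
      using assms(2,3) by auto
    from assms(1) [unfolded paracompact_in_def, rule_format, OF this]
    show thesis
      by (elim exE conjE) (rule that, auto)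
  qed
  define c where "c = inv_into M W"
  have c: "c U \<in> M" "W (c U) = U" if "U \<in> W ` M" for U
    using that by (simp_all add: c_def inv_into_into f_inv_into_f)
  define W' where "W' = (\<lambda>\<mu>. if \<mu> = c (W \<mu>) then V (W \<mu>) else {})"
  have W'c: "W' (c U) = V U" if "U \<in> W ` M" for U
    using c(2) [OF that] by (simp add: W'_def)
  have "locally_finite_family X M W'"
    unfolding locally_finite_family_def
  proof
    fix x assume "x \<in> topspace X"
    then obtain N where N: "openin X N" "x \<in> N" "finite {U\<in>W ` M. V U \<inter> N \<noteq> {}}"
      using V(2) unfolding locally_finite_family_def by blast
    have "{\<mu>\<in>M. W' \<mu> \<inter> N \<noteq> {}} \<subseteq> c ` {U\<in>W ` M. V U \<inter> N \<noteq> {}}"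
      by (auto simp: W'_def split: if_splits)
    then have "finite {\<mu>\<in>M. W' \<mu> \<inter> N \<noteq> {}}"
      using N(3) finite_surj by blast
    with N show "\<exists>N. openin X N \<and> x \<in> N \<and> finite {\<mu>\<in>M. W' \<mu> \<inter> N \<noteq> {}}" by blast
  qed
  moreover have "\<forall>\<mu>\<in>M. openin X (W' \<mu>) \<and> W' \<mu> \<subseteq> W \<mu>"
    using V(1,4) by (simp add: W'_def)
  moreover have "Z \<subseteq> (\<Union>\<mu>\<in>M. W' \<mu>)"
  proof
    fix z assume "z \<in> Z"
    then obtain U where "U \<in> W ` M" "z \<in> V U" using V(3) by blast
    then show "z \<in> (\<Union>\<mu>\<in>M. W' \<mu>)" using c(1) W'c by blast
  qed
  ultimately show ?thesis by blast
qed

end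

theory Submission
  imports Defs
begin

text \<open>
  Since \<open>F\<close> is covered by fewer than \<open>\<tau>\<close> members of any open cover and the closed remainder misses
  \<open>F\<close>, the hypotheses alone imply (K1); so every assertion has to be derived from them.

  A lower semi-continuous selection of \<open>\<theta>\<close> is obtained as the set of limits of sequences of nodes
  \<open>(V, y)\<close>, where \<open>V\<close> is open and \<open>\<theta> x\<close> comes close to \<open>y\<close> for all \<open>x\<close> in the closure of \<open>V\<close>. On each
  level, fewer than \<open>\<tau>\<close> nodes, locally finite in \<open>X\<close>, cover \<open>F\<close>. What they leave uncovered lies in a
  closed set \<open>E\<close> disjoint from \<open>F\<close>, and from there on one branches within \<open>E\<close>, where a single cardinal
  below \<open>\<tau>\<close> bounds all covers. If \<open>\<tau>\<close> is not sequential, the countably many levels together have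
  fewer than \<open>\<tau>\<close> nodes, so the image has a dense subset of that size. If \<open>\<tau>\<close> is sequential, \<open>F\<close> can
  be replaced by a compact core, so that the levels over it are finite; then up to any \<open>\<epsilon>\<close> the image
  consists of finitely many balls and a part with a dense subset of cardinality below \<open>\<tau>\<close>, and
  completeness gives the bound on its closure.
\<close>

subsection \<open>Cardinal bounds\<close>

text \<open>The obstacle is cofinality. Each cover of \<open>F\<close> costs fewer than
  \<open>\<tau>\<close> sets, but in general no smaller cardinal bounds the costs of all levels; if
  \<open>\<tau>\<close> is a supremum of countably many smaller cardinals, the levels together may
  reach \<open>\<tau>\<close>. On \<open>E\<close> one infinite \<open>|A| <o \<tau>\<close> bounds
  every cover, and countably many levels cost no more than one. Hence the two kinds of nodes are
  kept apart. \<open>E\<close> depends on the level where one branches off, and its bound may grow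
  with that level. But only finitely many branches start before level \<open>n\<close>, and all
  other later nodes lie close to level-\<open>n\<close> nodes over \<open>F\<close>; this is the
  origin of the balls. The core is compact for sequential \<open>\<tau>\<close> because infinitely
  many large members of a locally finite family would encode an open cover of \<open>X\<close>
  without a subcover of cardinality below \<open>\<tau>\<close>. Cardinals below
  \<open>\<tau>\<close> are represented by sets \<open>A :: 't set\<close>, so that bounds combine
  by unions.\<close>

lemma ordLess_imp_set:
  fixes \<tau> :: "'t rel"
  assumes "Card_order \<mu>" "\<mu> <o \<tau>"
  obtains A :: "'t set" where "( |A|, \<mu>) \<in> ordIso" "|A| <o \<tau>"
proof -
  obtain p :: "'t rel" where p: "(\<mu>, p) \<in> ordIso" "p <o \<tau>"
    using assms(2) internalize_ordLess[of \<mu> \<tau>] by blast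
  then have "Card_order p"
    using Card_order_ordIso2 assms(1) by blast
  then have "( |Field p|, p) \<in> ordIso"
    by (rule card_of_Field_ordIso)
  then have "( |Field p|, \<mu>) \<in> ordIso" "|Field p| <o \<tau>"
    by (rule ordIso_transitive[OF _ ordIso_symmetric[OF p(1)]],
        rule ordIso_ordLess_trans[OF _ p(2)])
  then show thesis
    by (rule that)
qed

lemma finite_card_of_ordLess: "Cinfinite \<tau> \<Longrightarrow> finite S \<Longrightarrow> |S| <o \<tau>"
  by (rule ordLess_ordLeq_trans[OF _ natLeq_ordLeq_cinfinite])
    (simp_all add: finite_iff_ordLess_natLeq)

lemma card_of_Un_ordLess:
  assumes "Cinfinite \<tau>" "|A| <o \<tau>" "|B| <o \<tau>"
  shows "|A \<union> B| <o \<tau>"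
  using assms card_of_Un_ordLess_infinite_Field[of \<tau> A B] by (auto simp: cinfinite_def)

lemma finite_UN_ordLess:
  assumes "Cinfinite \<tau>" "finite I" "\<And>i. i \<in> I \<Longrightarrow> |A i| <o \<tau>"
  shows "|\<Union>i\<in>I. A i| <o \<tau>"
  using assms(2,3)
proof (induction I)
  case empty
  then show ?case
    using finite_card_of_ordLess[OF assms(1), of "{}"] by simp
next
  case (insert i I)
  then show ?case
    using card_of_Un_ordLess[OF assms(1), of "A i" "\<Union>(A ` I)"] by simp
qed

text \<open>An infinite index set absorbs finite members, so even a singular \<open>\<tau>\<close>
  is not reached.\<close>

lemma UN_finite_ordLess:
  assumes "Cinfinite \<tau>" "|I| <o \<tau>" "\<And>i. i \<in> I \<Longrightarrow> finite (A i)"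
  shows "|\<Union>i\<in>I. A i| <o \<tau>"
proof (cases "finite I")
  case True
  then show ?thesis
    using finite_card_of_ordLess[OF assms(1), of "\<Union>(A ` I)"] assms(3) by simp
next
  case False
  then have "natLeq \<le>o |I|"
    using infinite_iff_natLeq_ordLeq[of I] by simp
  then have "|A i| \<le>o |I|" if "i \<in> I" for i
    using assms(3)[OF that] ordLess_imp_ordLeq[OF ordLess_ordLeq_trans[of _ natLeq]]
    by (simp add: finite_iff_ordLess_natLeq)
  then have "|\<Union>i\<in>I. A i| \<le>o |I|"
    using False by (intro card_of_UNION_ordLeq_infinite) (simp_all add: card_of_mono1)
  then show ?thesis
    using assms(2) by (rule ordLeq_ordLess_trans)
qed

lemma image_ordLess: "|A| <o \<tau> \<Longrightarrow> |f ` A| <o \<tau>"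
  by (rule ordLeq_ordLess_trans[OF card_of_image])

lemma not_ordLess_imp_ordLeq:
  "Card_order r \<Longrightarrow> Card_order r' \<Longrightarrow> \<not> r <o r' \<Longrightarrow> r' \<le>o r"
  by (meson card_order_on_well_order_on not_ordLess_iff_ordLeq)

lemma uncountable_infinite_set:
  fixes \<tau> :: "'t rel"
  assumes "natLeq <o \<tau>"
  obtains B :: "'t set" where "infinite B" "|B| <o \<tau>" "( |B|, natLeq) \<in> ordIso"
proof -
  obtain B :: "'t set" where B: "( |B|, natLeq) \<in> ordIso" "|B| <o \<tau>"
    using ordLess_imp_set[OF natLeq_Card_order assms] by blast
  then have "infinite B"
    using infinite_iff_natLeq_ordLeq[of B] unfolding ordIso_iff_ordLeq by simp
  then show thesis
    using B that by blast
qed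

text \<open>Otherwise the sequence \<open>|A n|\<close> itself would witness that
  \<open>\<tau>\<close> is sequential.\<close>

lemma not_sequential_bound:
  fixes A :: "nat \<Rightarrow> 't set" and \<tau> :: "'t rel"
  assumes "Cinfinite \<tau>" "\<not> sequential_cardinal \<tau>" "\<And>n. |A n| <o \<tau>"
  obtains C :: "'t set" where "|C| <o \<tau>" "\<And>n. |A n| \<le>o |C|"
proof -
  have "\<not> (\<forall>c :: 't rel. Card_order c \<and> (\<forall>n. |A n| \<le>o c) \<longrightarrow> \<tau> \<le>o c)"
  proof
    assume "\<forall>c :: 't rel. Card_order c \<and> (\<forall>n. |A n| \<le>o c) \<longrightarrow> \<tau> \<le>o c"
    then have "sequential_cardinal \<tau>"
      unfolding sequential_cardinal_def
      using assms(1,3) card_of_Card_order by (intro conjI exI[of _ "\<lambda>n. |A n|"]) auto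
    then show False
      using assms(2) by simp
  qed
  then obtain c :: "'t rel" where c: "Card_order c" "\<And>n. |A n| \<le>o c" "\<not> \<tau> \<le>o c"
    by blast
  then have "c <o \<tau>"
    using not_ordLess_imp_ordLeq[OF _ c(1), of \<tau>] not_ordLess_imp_ordLeq[OF c(1), of \<tau>] assms(1) by blast
  then obtain C :: "'t set" where C: "( |C|, c) \<in> ordIso" "|C| <o \<tau>"
    using ordLess_imp_set c(1) by metis
  then show thesis
    using that[OF C(2)] ordLeq_ordIso_trans[OF c(2) ordIso_symmetric[OF C(1)]] by simp
qed

lemma countable_UN_ordLess:
  fixes L :: "nat \<Rightarrow> 'c set" and \<tau> :: "'t rel"
  assumes "Cinfinite \<tau>" "\<not> sequential_cardinal \<tau>" "natLeq <o \<tau>" "\<And>n. |L n| <o \<tau>"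
  shows "|\<Union>n. L n| <o \<tau>"
proof -
  have "\<exists>A :: 't set. ( |A|, |L n| ) \<in> ordIso \<and> |A| <o \<tau>" for n
    using ordLess_imp_set[OF card_of_Card_order assms(4)] by metis
  then obtain A :: "nat \<Rightarrow> 't set" where A: "\<And>n. ( |A n|, |L n| ) \<in> ordIso" "\<And>n. |A n| <o \<tau>"
    by metis
  then obtain C :: "'t set" where C: "|C| <o \<tau>" "\<And>n. |A n| \<le>o |C|"
    using not_sequential_bound[OF assms(1,2)] by metis
  \<comment> \<open>Adding \<open>B\<close> makes the common bound infinite, so that it absorbs the
    countable index set.\<close>
  obtain B :: "'t set" where B: "infinite B" "|B| <o \<tau>"
    using uncountable_infinite_set assms(3) by metis
  have "|L n| \<le>o |C \<union> B|" for n
  proof -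
    have "|L n| \<le>o |C|"
      by (rule ordIso_ordLeq_trans[OF ordIso_symmetric[OF A(1)] C(2)])
    then show ?thesis
      by (rule ordLeq_transitive) (simp add: card_of_mono1)
  qed
  moreover have "infinite (C \<union> B)"
    using B by simp
  ultimately have "|\<Union>n. L n| \<le>o |C \<union> B|"
    by (intro card_of_UNION_ordLeq_infinite) (use infinite_iff_card_of_nat[of "C \<union> B"] in auto)
  then show ?thesis
    by (rule ordLeq_ordLess_trans) (rule card_of_Un_ordLess[OF assms(1) C(1) B(2)])
qed

text \<open>This is the sequentiality of \<open>\<aleph>_0\<close>: for countable
  \<open>\<tau>\<close> the sets \<open>{..<n}\<close> would have a common bound \<open>C\<close>
  below \<open>\<tau>\<close>, hence finite, and \<open>{..<Suc (card C)}\<close> does not inject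
  into it.\<close>

lemma not_sequential_imp_uncountable:
  fixes \<tau> :: "'t rel"
  assumes "Cinfinite \<tau>" "\<not> sequential_cardinal \<tau>"
  shows "natLeq <o \<tau>"
proof (rule ccontr)
  assume "\<not> natLeq <o \<tau>"
  then have le: "\<tau> \<le>o natLeq"
    using not_ordLess_imp_ordLeq[OF natLeq_Card_order] assms(1) by blast
  have "\<exists>A :: 't set. ( |A|, |{..<n}| ) \<in> ordIso \<and> |A| <o \<tau>" for n :: nat
    using ordLess_imp_set[OF card_of_Card_order finite_card_of_ordLess[OF assms(1)]]
    by (metis finite_lessThan)
  then obtain A :: "nat \<Rightarrow> 't set" where A: "\<And>n. ( |A n|, |{..<n}| ) \<in> ordIso" "\<And>n. |A n| <o \<tau>"
    by metis
  then obtain C :: "'t set" where C: "|C| <o \<tau>" "\<And>n. |A n| \<le>o |C|"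
    using not_sequential_bound[OF assms] by metis
  have fin: "finite C"
    using ordLess_ordLeq_trans[OF C(1) le] by (simp add: finite_iff_ordLess_natLeq)
  have "|{..<Suc (card C)}| \<le>o |C|"
    by (rule ordIso_ordLeq_trans[OF ordIso_symmetric[OF A(1)] C(2)])
  then obtain f where "inj_on f {..<Suc (card C)}" "f ` {..<Suc (card C)} \<subseteq> C"
    by (metis card_of_ordLeq)
  then show False
    using card_inj_on_le[OF _ _ fin] by fastforce
qed

subsection \<open>Covers by open sets of the ambient space\<close>

text \<open>For \<open>C\<close> inside the space and a cardinal \<open>\<tau>\<close> this is
  \<open>k(C) \<le> \<tau>\<close>, phrased with open sets of the ambient space to avoid subspace
  topologies. At \<open>natLeq\<close> it is compactness.\<close>

definition compact_lt :: "'a topology \<Rightarrow> 't rel \<Rightarrow> 'a set \<Rightarrow> bool" where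
  "compact_lt X \<tau> C \<longleftrightarrow>
     (\<forall>\<U>. (\<forall>U\<in>\<U>. openin X U) \<and> C \<subseteq> \<Union>\<U> \<longrightarrow> (\<exists>\<V>\<subseteq>\<U>. C \<subseteq> \<Union>\<V> \<and> |\<V>| <o \<tau>))"

text \<open>One index is chosen per member of the subcover, so passing to indices does not increase
  the cardinality.\<close>

lemma compact_lt_indexed:
  assumes "compact_lt X \<tau> C" "\<And>i. i \<in> I \<Longrightarrow> openin X (G i)" "C \<subseteq> (\<Union>i\<in>I. G i)"
  obtains M where "M \<subseteq> I" "|M| <o \<tau>" "C \<subseteq> (\<Union>i\<in>M. G i)"
proof -
  obtain \<V> where \<V>: "\<V> \<subseteq> G ` I" "C \<subseteq> \<Union>\<V>" "|\<V>| <o \<tau>"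
    using assms unfolding compact_lt_def by (metis (no_types, lifting) imageE)
  show thesis
  proof (rule that[of "inv_into I G ` \<V>"])
    show "inv_into I G ` \<V> \<subseteq> I"
      using \<V>(1) by (auto intro: inv_into_into)
    show "|inv_into I G ` \<V>| <o \<tau>"
      using \<V>(3) by (rule image_ordLess)
    show "C \<subseteq> (\<Union>i\<in>inv_into I G ` \<V>. G i)"
    proof
      fix x assume "x \<in> C"
      then obtain U where U: "U \<in> \<V>" "x \<in> U"
        using \<V>(2) by blast
      then have "G (inv_into I G U) = U"
        using \<V>(1) f_inv_into_f[of U G I] by blast
      then show "x \<in> (\<Union>i\<in>inv_into I G ` \<V>. G i)"
        using U by blast
    qed
  qed
qed

lemma compact_lt_mono: "compact_lt X \<sigma> C \<Longrightarrow> \<sigma> \<le>o \<tau> \<Longrightarrow> compact_lt X \<tau> C"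
  unfolding compact_lt_def by (meson ordLess_ordLeq_trans[of _ \<sigma> \<tau>])

lemma compact_lt_closed_subset:
  assumes "compact_lt X \<tau> C" "C \<subseteq> topspace X" "closedin X D" "D \<subseteq> C"
  shows "compact_lt X \<tau> D"
  unfolding compact_lt_def
proof (intro allI impI, elim conjE)
  fix \<U> assume \<U>: "\<forall>U\<in>\<U>. openin X U" "D \<subseteq> \<Union>\<U>"
  have "\<forall>U\<in>insert (topspace X - D) \<U>. openin X U"
    using \<U>(1) assms(3) by blast
  moreover have "C \<subseteq> \<Union>(insert (topspace X - D) \<U>)"
    using \<U>(2) assms(2) by auto
  ultimately obtain \<V> where \<V>: "\<V> \<subseteq> insert (topspace X - D) \<U>" "C \<subseteq> \<Union>\<V>" "|\<V>| <o \<tau>"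
    using assms(1)[unfolded compact_lt_def, rule_format, of "insert (topspace X - D) \<U>"] by auto
  show "\<exists>\<V>\<subseteq>\<U>. D \<subseteq> \<Union>\<V> \<and> |\<V>| <o \<tau>"
  proof (intro exI conjI)
    show "\<V> - {topspace X - D} \<subseteq> \<U>"
      using \<V>(1) by blast
    show "D \<subseteq> \<Union>(\<V> - {topspace X - D})"
      using \<V>(2) assms(4) by fast
    show "|\<V> - {topspace X - D}| <o \<tau>"
      by (rule ordLeq_ordLess_trans[OF card_of_mono1 \<V>(3)]) blast
  qed
qed

text \<open>A small refinement yields a small subcover by choosing for each of its members a set of
  the cover that contains it; conversely relatively open sets are extended to open sets of
  \<open>X\<close>.\<close>

lemma degree_of_compactness_le_iff:
  assumes "Card_order \<tau>" "C \<subseteq> topspace X"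
  shows "degree_of_compactness (subtopology X C) \<le>o \<tau> \<longleftrightarrow> compact_lt X \<tau> C"
proof
  assume L: "degree_of_compactness (subtopology X C) \<le>o \<tau>"
  have sub: "\<exists>\<V>. open_cover (subtopology X C) \<V> \<and> refines \<V> \<U> \<and> |\<V>| <o \<tau>"
    if "open_cover (subtopology X C) \<U>" for \<U>
    using iffD1[OF degree_of_compactness_ordLeq_iff[OF assms(1)] L] that by simp
  show "compact_lt X \<tau> C"
    unfolding compact_lt_def
  proof (intro allI impI, elim conjE)
    fix \<U> assume \<U>: "\<forall>U\<in>\<U>. openin X U" "C \<subseteq> \<Union>\<U>"
    have "\<Union>((\<inter>) C ` \<U>) = C"
      using \<U>(2) by blast
    moreover have "topspace (subtopology X C) = C"
      using assms(2) by auto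
    ultimately have cover: "open_cover (subtopology X C) ((\<inter>) C ` \<U>)"
      using \<U>(1) by (simp add: open_cover_def openin_subtopology_Int2)
    obtain \<V> where \<V>: "open_cover (subtopology X C) \<V>" "refines \<V> ((\<inter>) C ` \<U>)" "|\<V>| <o \<tau>"
      using sub[OF cover] by (elim exE conjE)
    have "\<exists>U\<in>\<U>. V \<subseteq> U" if V: "V \<in> \<V>" for V
    proof -
      obtain W where "W \<in> (\<inter>) C ` \<U>" "V \<subseteq> W"
        using bspec[OF \<V>(2)[unfolded refines_def] V] by (rule bexE)
      then obtain U where "U \<in> \<U>" "V \<subseteq> C \<inter> U"
        by blast
      then have "V \<subseteq> U"
        by (simp only: Int_subset_iff)
      then show ?thesis
        using \<open>U \<in> \<U>\<close> by (rule bexI)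
    qed
    then obtain f where f: "\<And>V. V \<in> \<V> \<Longrightarrow> f V \<in> \<U> \<and> V \<subseteq> f V"
      by metis
    have "\<Union>\<V> = C"
      using \<V>(1) assms(2) by (auto simp: open_cover_def)
    moreover have "\<Union>\<V> \<subseteq> \<Union>(f ` \<V>)"
      using f by (intro Union_least) blast
    ultimately have "C \<subseteq> \<Union>(f ` \<V>)"
      by simp
    moreover have "f ` \<V> \<subseteq> \<U>"
      using f by blast
    ultimately show "\<exists>\<V>\<subseteq>\<U>. C \<subseteq> \<Union>\<V> \<and> |\<V>| <o \<tau>"
      using image_ordLess[OF \<V>(3)] by blast
  qed
next
  assume R: "compact_lt X \<tau> C"
  have "\<exists>\<V>. open_cover (subtopology X C) \<V> \<and> refines \<V> \<U> \<and> |\<V>| <o \<tau>"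
    if \<U>: "open_cover (subtopology X C) \<U>" for \<U>
  proof -
    have "\<exists>G. openin X G \<and> U \<subseteq> G \<and> G \<inter> C \<subseteq> U" if "U \<in> \<U>" for U
    proof -
      have "openin (subtopology X C) U"
        using \<U> that by (simp add: open_cover_def)
      then show ?thesis
        by (auto simp: openin_subtopology)
    qed
    then obtain G where G: "\<And>U. U \<in> \<U> \<Longrightarrow> openin X (G U)"
        "\<And>U. U \<in> \<U> \<Longrightarrow> U \<subseteq> G U" "\<And>U. U \<in> \<U> \<Longrightarrow> G U \<inter> C \<subseteq> U"
      by metis
    have U: "\<Union>\<U> = C"
      using \<U> assms(2) by (auto simp: open_cover_def)
    then have C: "C \<subseteq> (\<Union>U\<in>\<U>. G U)"
      using G(2) by blast
    obtain \<V> where \<V>: "\<V> \<subseteq> \<U>" "|\<V>| <o \<tau>" "C \<subseteq> (\<Union>U\<in>\<V>. G U)"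
      by (rule compact_lt_indexed[OF R G(1) C])
    have "C \<subseteq> \<Union>\<V>"
      using \<V>(1,3) G(3) by blast
    then have "\<Union>\<V> = C"
      using \<V>(1) U by blast
    then have "open_cover (subtopology X C) \<V>"
      using \<U> \<V>(1) assms(2) by (auto simp: open_cover_def)
    moreover have "refines \<V> \<U>"
      using \<V>(1) unfolding refines_def by blast
    ultimately show ?thesis
      using \<V>(2) by blast
  qed
  then show "degree_of_compactness (subtopology X C) \<le>o \<tau>"
    by (simp add: degree_of_compactness_ordLeq_iff[OF assms(1)])
qed

lemma degree_of_compactness_less_imp:
  fixes \<tau> :: "'t rel"
  assumes "degree_of_compactness (subtopology X C) <o \<tau>" "C \<subseteq> topspace X"
  obtains A :: "'t set" where "|A| <o \<tau>" "compact_lt X ( |A| ) C"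
proof -
  let ?k = "degree_of_compactness (subtopology X C)"
  obtain A :: "'t set" where A: "( |A|, ?k) \<in> ordIso" "|A| <o \<tau>"
    using ordLess_imp_set[OF Card_order_degree_of_compactness assms(1)] by blast
  have "compact_lt X ( |A| ) C"
    unfolding degree_of_compactness_le_iff[OF card_of_Card_order assms(2), symmetric]
    using A(1) by (simp add: ordIso_iff_ordLeq)
  then show thesis
    using that A(2) by blast
qed

text \<open>At a successor cardinal the bound becomes non-strict. Non-strict bounds by an infinite
  \<open>|A|\<close> survive unions of \<open>|A|\<close> many sets, which strict bounds at a
  singular cardinal do not.\<close>

lemma compact_lt_cardSuc:
  "compact_lt X (cardSuc |A| ) C \<longleftrightarrow>
     (\<forall>\<U>. (\<forall>U\<in>\<U>. openin X U) \<and> C \<subseteq> \<Union>\<U> \<longrightarrow> (\<exists>\<V>\<subseteq>\<U>. C \<subseteq> \<Union>\<V> \<and> |\<V>| \<le>o |A| ))"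
  unfolding compact_lt_def
  by (simp add: cardSuc_ordLeq_ordLess[OF card_of_Card_order card_of_Card_order])

lemma compact_lt_cardSuc_mono:
  assumes "compact_lt X (cardSuc |A| ) C" "|A| \<le>o |B|"
  shows "compact_lt X (cardSuc |B| ) C"
  using assms(2) cardSuc_mono_ordLeq[OF card_of_Card_order card_of_Card_order, of A B]
  by (auto intro: compact_lt_mono[OF assms(1)])

lemma compact_lt_UN:
  assumes A: "infinite A" "|I| \<le>o |A|" and C: "\<And>i. i \<in> I \<Longrightarrow> compact_lt X (cardSuc |A| ) (C i)"
  shows "compact_lt X (cardSuc |A| ) (\<Union>i\<in>I. C i)"
  unfolding compact_lt_cardSuc
proof (intro allI impI, elim conjE)
  fix \<U> assume \<U>: "\<forall>U\<in>\<U>. openin X U" "(\<Union>i\<in>I. C i) \<subseteq> \<Union>\<U>"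
  have "\<exists>\<V>\<subseteq>\<U>. C i \<subseteq> \<Union>\<V> \<and> |\<V>| \<le>o |A|" if i: "i \<in> I" for i
  proof -
    have "C i \<subseteq> \<Union>\<U>"
      using \<U>(2) i by blast
    with \<U>(1) C[OF i, unfolded compact_lt_cardSuc, rule_format, of \<U>] show ?thesis
      by simp
  qed
  then obtain \<V> where \<V>: "\<And>i. i \<in> I \<Longrightarrow> \<V> i \<subseteq> \<U>"
      "\<And>i. i \<in> I \<Longrightarrow> C i \<subseteq> \<Union>(\<V> i)" "\<And>i. i \<in> I \<Longrightarrow> |\<V> i| \<le>o |A|"
    by metis
  have "|\<Union>i\<in>I. \<V> i| \<le>o |A|"
    using \<V>(3) A by (intro card_of_UNION_ordLeq_infinite) simp_all
  moreover have "(\<Union>i\<in>I. C i) \<subseteq> \<Union>(\<Union>i\<in>I. \<V> i)"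
    using \<V>(2) by (intro UN_least) blast
  moreover have "(\<Union>i\<in>I. \<V> i) \<subseteq> \<U>"
    using \<V>(1) by blast
  ultimately show "\<exists>\<V>\<subseteq>\<U>. (\<Union>i\<in>I. C i) \<subseteq> \<Union>\<V> \<and> |\<V>| \<le>o |A|"
    by blast
qed

subsection \<open>Locally finite covers\<close>

lemma regular_space_nbhd:
  assumes "regular_space X" "openin X W" "x \<in> W"
  obtains U where "openin X U" "x \<in> U" "X closure_of U \<subseteq> W"
proof -
  have "closedin X (topspace X - W)" "x \<in> topspace X - (topspace X - W)"
    using assms(2,3) openin_subset by blast+
  then obtain U where "openin X U" "x \<in> U" "disjnt (topspace X - W) (X closure_of U)"
    using assms(1) unfolding regular_space by blast
  then show thesis
    using that closure_of_subset_topspace[of X U] by (auto simp: disjnt_iff)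
qed

lemma closure_of_locally_finite_family:
  assumes "locally_finite_family X M V"
  shows "X closure_of (\<Union>i\<in>M. V i) \<subseteq> (\<Union>i\<in>M. X closure_of V i)"
proof
  fix x assume x: "x \<in> X closure_of (\<Union>i\<in>M. V i)"
  then have "x \<in> topspace X"
    by (meson in_closure_of)
  then obtain N where N: "openin X N" "x \<in> N" "finite {i \<in> M. V i \<inter> N \<noteq> {}}"
    using assms unfolding locally_finite_family_def by blast
  have "x \<in> X closure_of (N \<inter> (\<Union>i\<in>M. V i))"
    using openin_Int_closure_of_subset[OF N(1)] x N(2) by fast
  moreover have "N \<inter> (\<Union>i\<in>M. V i) \<subseteq> \<Union>(V ` {i \<in> M. V i \<inter> N \<noteq> {}})"
    by blast
  ultimately have "x \<in> X closure_of \<Union>(V ` {i \<in> M. V i \<inter> N \<noteq> {}})"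
    using closure_of_mono by blast
  then show "x \<in> (\<Union>i\<in>M. X closure_of V i)"
    using closure_of_Union[of "V ` {i \<in> M. V i \<inter> N \<noteq> {}}" X] N(3) by auto
qed

lemma locally_finite_family_closure_of:
  assumes "locally_finite_family X M V"
  shows "locally_finite_family X M (\<lambda>i. X closure_of V i)"
proof -
  have "\<exists>N. openin X N \<and> x \<in> N \<and> finite {i \<in> M. X closure_of V i \<inter> N \<noteq> {}}"
    if x: "x \<in> topspace X" for x
  proof -
    obtain N where N: "openin X N" "x \<in> N" "finite {i \<in> M. V i \<inter> N \<noteq> {}}"
      using assms x unfolding locally_finite_family_def by blast
    have "X closure_of V i \<inter> N \<noteq> {} \<longleftrightarrow> V i \<inter> N \<noteq> {}" for i
      using openin_Int_closure_of_eq_empty[OF N(1), of "V i"] by (simp add: Int_commute)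
    then have "finite {i \<in> M. X closure_of V i \<inter> N \<noteq> {}}"
      using N(3) by simp
    with N(1,2) show ?thesis
      by blast
  qed
  then show ?thesis
    by (simp add: locally_finite_family_def)
qed

lemma locally_finite_family_subset:
  assumes "locally_finite_family X M V" "I \<subseteq> M"
  shows "locally_finite_family X I V"
proof -
  have "\<exists>N. openin X N \<and> x \<in> N \<and> finite {i \<in> I. V i \<inter> N \<noteq> {}}"
    if x: "x \<in> topspace X" for x
  proof -
    obtain N where N: "openin X N" "x \<in> N" "finite {i \<in> M. V i \<inter> N \<noteq> {}}"
      using assms x unfolding locally_finite_family_def by blast
    have "finite {i \<in> I. V i \<inter> N \<noteq> {}}"
      by (rule finite_subset[OF _ N(3)]) (use assms(2) in blast)
    with N(1,2) show ?thesis
      by blast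
  qed
  then show ?thesis
    by (simp add: locally_finite_family_def)
qed

text \<open>Covers are indexed by the points of \<open>F\<close>, which makes the choice of neighbourhoods explicit.\<close>

definition locally_finitely_coverable :: "'a topology \<Rightarrow> 'r rel \<Rightarrow> 'a set \<Rightarrow> bool" where
  "locally_finitely_coverable X \<sigma> F \<longleftrightarrow>
     (\<forall>G. (\<forall>x\<in>F. openin X (G x) \<and> x \<in> G x) \<longrightarrow>
        (\<exists>M V. M \<subseteq> F \<and> |M| <o \<sigma> \<and> locally_finite_family X M V \<and>
           (\<forall>x\<in>M. openin X (V x) \<and> V x \<subseteq> G x) \<and> F \<subseteq> (\<Union>x\<in>M. V x)))"

lemma locally_finitely_coverableE:
  assumes "locally_finitely_coverable X \<sigma> F" "\<And>x. x \<in> F \<Longrightarrow> openin X (G x) \<and> x \<in> G x"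
  obtains M V where "M \<subseteq> F" "|M| <o \<sigma>" "locally_finite_family X M V"
    "\<forall>x\<in>M. openin X (V x)" "\<forall>x\<in>M. V x \<subseteq> G x" "F \<subseteq> (\<Union>x\<in>M. V x)"
proof -
  have "\<forall>x\<in>F. openin X (G x) \<and> x \<in> G x"
    using assms(2) by simp
  with assms(1)[unfolded locally_finitely_coverable_def, rule_format, of G]
  obtain M V where "M \<subseteq> F" "|M| <o \<sigma>" "locally_finite_family X M V"
      "\<forall>x\<in>M. openin X (V x) \<and> V x \<subseteq> G x" "F \<subseteq> (\<Union>x\<in>M. V x)"
    by auto
  then show thesis
    by (intro that[of M V]) simp_all
qed

text \<open>The subcover has to come first: shrinking in \<open>paracompact_in_indexed\<close> keeps
  the index set, so the locally finite family still has fewer than \<open>\<tau>\<close>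
  indices.\<close>

lemma paracompact_in_imp_locally_finitely_coverable:
  assumes "paracompact_in X F" "compact_lt X \<tau> F"
  shows "locally_finitely_coverable X \<tau> F"
  unfolding locally_finitely_coverable_def
proof (intro allI impI)
  fix G assume G: "\<forall>x\<in>F. openin X (G x) \<and> x \<in> G x"
  then have *: "\<And>x. x \<in> F \<Longrightarrow> openin X (G x)" "F \<subseteq> (\<Union>x\<in>F. G x)"
    by auto
  obtain M where M: "M \<subseteq> F" "|M| <o \<tau>" "F \<subseteq> (\<Union>x\<in>M. G x)"
    by (rule compact_lt_indexed[OF assms(2) *])
  have "\<forall>x\<in>M. openin X (G x)"
    using M(1) *(1) by blast
  from paracompact_in_indexed[OF assms(1) this M(3)]
  obtain V where V: "\<forall>x\<in>M. openin X (V x)" "locally_finite_family X M V" "F \<subseteq> (\<Union>x\<in>M. V x)"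
      "\<forall>x\<in>M. V x \<subseteq> G x"
    by (elim exE conjE)
  from M(1,2) V show "\<exists>M V. M \<subseteq> F \<and> |M| <o \<tau> \<and> locally_finite_family X M V \<and>
      (\<forall>x\<in>M. openin X (V x) \<and> V x \<subseteq> G x) \<and> F \<subseteq> (\<Union>x\<in>M. V x)"
    by (intro exI[of _ M] exI[of _ V]) simp
qed

text \<open>Finite families are locally finite, so no shrinking is involved. This serves the case of
  countable \<open>\<tau>\<close>, where the whole space is its own core.\<close>

lemma compact_imp_locally_finitely_coverable:
  assumes "compact_lt X natLeq F"
  shows "locally_finitely_coverable X natLeq F"
  unfolding locally_finitely_coverable_def
proof (intro allI impI)
  fix G assume G: "\<forall>x\<in>F. openin X (G x) \<and> x \<in> G x"
  then have *: "\<And>x. x \<in> F \<Longrightarrow> openin X (G x)" "F \<subseteq> (\<Union>x\<in>F. G x)"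
    by auto
  obtain M where M: "M \<subseteq> F" "|M| <o natLeq" "F \<subseteq> (\<Union>x\<in>M. G x)"
    by (rule compact_lt_indexed[OF assms *])
  have "locally_finite_family X M G"
  proof -
    have "finite M"
      using M(2) by (simp add: finite_iff_ordLess_natLeq)
    then show ?thesis
      unfolding locally_finite_family_def using openin_topspace[of X] by auto
  qed
  moreover have "\<forall>x\<in>M. openin X (G x) \<and> G x \<subseteq> G x"
    using M(1) *(1) by blast
  ultimately show "\<exists>M V. M \<subseteq> F \<and> |M| <o natLeq \<and> locally_finite_family X M V \<and>
      (\<forall>x\<in>M. openin X (V x) \<and> V x \<subseteq> G x) \<and> F \<subseteq> (\<Union>x\<in>M. V x)"
    using M by (intro exI[of _ M] exI[of _ G]) simp
qed

text \<open>Regularity gives the claim at each point, and local finiteness carries it to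
  \<open>F\<close> because closures commute with locally finite unions. It later leaves room between
  the nodes over \<open>F\<close> and the closed set on which one branches.\<close>

lemma locally_finitely_coverable_nbhd:
  assumes "regular_space X" "locally_finitely_coverable X \<sigma> F" "openin X H" "F \<subseteq> H"
  obtains W where "openin X W" "F \<subseteq> W" "X closure_of W \<subseteq> H"
proof -
  have "\<exists>U. openin X U \<and> x \<in> U \<and> X closure_of U \<subseteq> H" if x: "x \<in> F" for x
    by (rule regular_space_nbhd[OF assms(1,3) subsetD[OF assms(4) x]]) blast
  then obtain G where G: "\<And>x. x \<in> F \<Longrightarrow> openin X (G x) \<and> x \<in> G x"
      "\<And>x. x \<in> F \<Longrightarrow> X closure_of G x \<subseteq> H"
    by metis
  obtain M V where V: "M \<subseteq> F" "|M| <o \<sigma>" "locally_finite_family X M V" "\<forall>x\<in>M. openin X (V x)"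
    "\<forall>x\<in>M. V x \<subseteq> G x" "F \<subseteq> (\<Union>x\<in>M. V x)"
    by (rule locally_finitely_coverableE[OF assms(2) G(1)])
  have "X closure_of V x \<subseteq> H" if x: "x \<in> M" for x
    using closure_of_mono[OF bspec[OF V(5) x], of X] G(2)[of x] V(1) x by blast
  then have "X closure_of (\<Union>x\<in>M. V x) \<subseteq> H"
    using closure_of_locally_finite_family[OF V(3)] by blast
  then show thesis
    using that[of "\<Union>x\<in>M. V x"] V(4,6) by blast
qed

text \<open>The preceding separation is applied to the complement of a point outside
  \<open>F\<close>, which is open in a \<open>T_1\<close> space.\<close>

lemma locally_finitely_coverable_closedin:
  assumes "regular_space X" "t1_space X" "F \<subseteq> topspace X" "locally_finitely_coverable X \<sigma> F"
  shows "closedin X F"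
proof -
  have "X closure_of F \<subseteq> F"
  proof
    fix x assume x: "x \<in> X closure_of F"
    show "x \<in> F"
    proof (rule ccontr)
      assume "x \<notin> F"
      then have F: "F \<subseteq> topspace X - {x}"
        using assms(3) by blast
      have op: "openin X (topspace X - {x})"
        using assms(2) by (simp add: t1_space_openin_delete_alt)
      obtain W where W: "openin X W" "F \<subseteq> W" "X closure_of W \<subseteq> topspace X - {x}"
        by (rule locally_finitely_coverable_nbhd[OF assms(1,4) op F])
      then show False
        using x closure_of_mono[OF W(2), of X] by blast
    qed
  qed
  then show ?thesis
    using assms(3) closure_of_subset_eq by blast
qed

subsection \<open>The core of a space\<close>

text \<open>One open cover of the whole space encodes covers of all members of a locally finite family
  simultaneously, so a single small subcover bounds all of them at once.\<close>

lemma locally_finite_simultaneous_subcovers: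
  fixes X :: "'a topology"
  assumes X: "compact_lt X \<tau> (topspace X)"
    and closed: "\<And>i. i \<in> I \<Longrightarrow> closedin X (G i)" and lf: "locally_finite_family X I G"
    and \<gamma>: "\<And>i U. i \<in> I \<Longrightarrow> U \<in> \<gamma> i \<Longrightarrow> openin X U" "\<And>i. i \<in> I \<Longrightarrow> G i \<subseteq> \<Union>(\<gamma> i)"
  obtains N :: "'a set" where "|N| <o \<tau>" "\<forall>i\<in>I. \<exists>\<V>\<subseteq>\<gamma> i. G i \<subseteq> \<Union>\<V> \<and> |\<V>| \<le>o |N|"
proof -
  have "\<exists>U. U \<in> \<gamma> i \<and> x \<in> U" if i: "i \<in> I" and x: "x \<in> G i" for i x
    using \<gamma>(2)[OF i] x by blast
  then obtain U where U: "\<And>i x. i \<in> I \<Longrightarrow> x \<in> G i \<Longrightarrow> U i x \<in> \<gamma> i"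
      "\<And>i x. i \<in> I \<Longrightarrow> x \<in> G i \<Longrightarrow> x \<in> U i x"
    by metis
  have "\<exists>W. openin X W \<and> x \<in> W \<and> (\<forall>i\<in>I. G i \<inter> W \<noteq> {} \<longrightarrow> x \<in> G i \<and> W \<subseteq> U i x)"
    if x: "x \<in> topspace X" for x
  proof -
    obtain N where N: "openin X N" "x \<in> N" "finite {i \<in> I. G i \<inter> N \<noteq> {}}"
      using lf x unfolding locally_finite_family_def by blast
    define J where "J = {i \<in> I. G i \<inter> N \<noteq> {}}"
    \<comment> \<open>The complement of \<open>G i\<close> is used for the finitely many nearby
      members that miss \<open>x\<close>. Thus \<open>W\<close> meets only members containing
      \<open>x\<close>, and lies in the set chosen for each of them.\<close>
    define H where "H i = (if x \<in> G i then U i x else topspace X - G i)" for i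
    define W where "W = N \<inter> (\<Inter>i\<in>J. H i)"
    have J: "i \<in> I" if "i \<in> J" for i
      using that by (simp add: J_def)
    have openH: "openin X (H i)" if i: "i \<in> J" for i
      using \<gamma>(1)[OF J[OF i] U(1)[OF J[OF i]]] closed[OF J[OF i]] by (auto simp: H_def)
    have finJ: "finite J"
      using N(3) by (simp add: J_def)
    have "openin X W"
    proof (cases "J = {}")
      case False
      have "openin X (\<Inter>i\<in>J. H i)"
        by (rule openin_INT2[OF finJ False openH])
      then show ?thesis
        unfolding W_def using N(1) by (simp add: openin_Int)
    qed (simp add: W_def N(1))
    moreover have "x \<in> H i" if i: "i \<in> J" for i
      using U(2)[OF J[OF i]] x by (simp add: H_def)
    then have "x \<in> W"
      unfolding W_def using N(2) by blast
    moreover have "x \<in> G i \<and> W \<subseteq> U i x" if i: "i \<in> I" "G i \<inter> W \<noteq> {}" for i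
    proof -
      have iJ: "i \<in> J"
        using i by (auto simp: J_def W_def)
      then have W: "W \<subseteq> H i"
        unfolding W_def by blast
      then have "x \<in> G i"
        using i(2) by (auto simp: H_def split: if_splits)
      with W show ?thesis
        by (simp add: H_def)
    qed
    ultimately show ?thesis
      by blast
  qed
  then obtain W where *: "\<And>x. x \<in> topspace X \<Longrightarrow> openin X (W x) \<and> x \<in> W x \<and>
      (\<forall>i\<in>I. G i \<inter> W x \<noteq> {} \<longrightarrow> x \<in> G i \<and> W x \<subseteq> U i x)"
    by metis
  then have W: "\<And>x. x \<in> topspace X \<Longrightarrow> openin X (W x)"
      "\<And>x. x \<in> topspace X \<Longrightarrow> x \<in> W x"
      "\<And>x i. x \<in> topspace X \<Longrightarrow> i \<in> I \<Longrightarrow> G i \<inter> W x \<noteq> {} \<Longrightarrow> x \<in> G i"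
      "\<And>x i. x \<in> topspace X \<Longrightarrow> i \<in> I \<Longrightarrow> G i \<inter> W x \<noteq> {} \<Longrightarrow> W x \<subseteq> U i x"
    by simp_all
  have sub: "topspace X \<subseteq> (\<Union>x\<in>topspace X. W x)"
    using W(2) by blast
  obtain N where N: "N \<subseteq> topspace X" "|N| <o \<tau>" "topspace X \<subseteq> (\<Union>x\<in>N. W x)"
    by (rule compact_lt_indexed[OF X W(1) sub])
  have "\<exists>\<V>\<subseteq>\<gamma> i. G i \<subseteq> \<Union>\<V> \<and> |\<V>| \<le>o |N|" if i: "i \<in> I" for i
  proof (intro exI conjI)
    \<comment> \<open>The same \<open>N\<close> serves every \<open>i\<close>: if \<open>W x\<close>
      contains a point of \<open>G i\<close>, then \<open>x\<close> is in \<open>G i\<close> and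
      \<open>W x\<close> lies in \<open>U i x\<close>.\<close>
    show "U i ` (N \<inter> G i) \<subseteq> \<gamma> i"
      using U(1)[OF i] by blast
    show "|U i ` (N \<inter> G i)| \<le>o |N|"
      by (rule ordLeq_transitive[OF card_of_image card_of_mono1]) simp
    show "G i \<subseteq> \<Union>(U i ` (N \<inter> G i))"
    proof
      fix p assume p: "p \<in> G i"
      then have "p \<in> topspace X"
        using closedin_subset[OF closed[OF i]] by blast
      then obtain x where x: "x \<in> N" "p \<in> W x"
        using N(3) by blast
      then have xt: "x \<in> topspace X" and ne: "G i \<inter> W x \<noteq> {}"
        using N(1) p by blast+
      have "x \<in> G i" "p \<in> U i x"
        using W(3)[OF xt i ne] W(4)[OF xt i ne] x(2) by auto
      with x(1) show "p \<in> \<Union>(U i ` (N \<inter> G i))"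
        by blast
    qed
  qed
  then show thesis
    using that[OF N(2)] by simp
qed

lemma inj_choice_infinite:
  fixes B :: "nat \<Rightarrow> 'i set"
  assumes "\<And>n. infinite (B n)"
  obtains f where "inj f" "\<forall>n. f n \<in> B n"
proof -
  have ex: "\<exists>x. x \<in> B n \<and> x \<notin> S" if "finite S" for n S
    using assms[of n] that by (metis finite_subset subsetI)
  \<comment> \<open>The state pairs the current point with the finite set of points chosen before
    it, which the current point has to avoid.\<close>
  have "\<exists>f. \<forall>n. (case f n of (x, S) \<Rightarrow> x \<in> B n \<and> x \<notin> S \<and> finite S) \<and>
      (case f n of (x, S) \<Rightarrow> snd (f (Suc n)) = insert x S)"
  proof (rule dependent_nat_choice)
    show "\<exists>p. case p of (x, S) \<Rightarrow> x \<in> B 0 \<and> x \<notin> S \<and> finite S"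
      using ex[of "{}" 0] by auto
  next
    fix p n assume "case p of (x, S) \<Rightarrow> x \<in> B n \<and> x \<notin> S \<and> finite S"
    then show "\<exists>q. (case q of (x, S) \<Rightarrow> x \<in> B (Suc n) \<and> x \<notin> S \<and> finite S) \<and>
        (case p of (x, S) \<Rightarrow> snd q = insert x S)"
      using ex[of "insert (fst p) (snd p)" "Suc n"] by (auto split: prod.splits)
  qed
  then obtain f where f: "\<And>n. fst (f n) \<in> B n" "\<And>n. fst (f n) \<notin> snd (f n)"
      "\<And>n. snd (f (Suc n)) = insert (fst (f n)) (snd (f n))"
    by (auto simp: split_beta)
  have "fst (f m) \<in> snd (f n)" if "m < n" for m n
    using that by (induction n) (auto simp: f(3) less_Suc_eq)
  then have "fst (f m) \<noteq> fst (f n)" if "m < n" for m n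
    using that f(2)[of n] by metis
  then have "inj (fst \<circ> f)"
    by (intro linorder_injI) auto
  then show thesis
    using that[of "fst \<circ> f"] f(1) by simp
qed

text \<open>Suppose every bound below \<open>\<tau>\<close> fails for infinitely many members. Along
  a sequence \<open>s\<close> with supremum \<open>\<tau>\<close> one picks distinct members, the
  \<open>n\<close>-th with a cover that has no subcover of cardinality at most \<open>s n\<close>.
  Simultaneous subcovers bounded by one \<open>|N| <o \<tau>\<close> then force
  \<open>s n \<le>o |N|\<close> for all \<open>n\<close>, so
  \<open>\<tau> \<le>o |N|\<close>.\<close>

lemma finitely_many_large_members:
  fixes X :: "'a topology" and \<tau> :: "'t rel"
  assumes \<tau>: "Cinfinite \<tau>" "sequential_cardinal \<tau>"
    and X: "compact_lt X \<tau> (topspace X)"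
    and closed: "\<And>i. i \<in> I \<Longrightarrow> closedin X (G i)" and lf: "locally_finite_family X I G"
  obtains A :: "'t set" where "|A| <o \<tau>" "finite {i \<in> I. \<not> compact_lt X (cardSuc |A| ) (G i)}"
proof (rule ccontr)
  assume neg: "\<not> thesis"
  note goal = that
  define B where "B A = {i \<in> I. \<not> compact_lt X (cardSuc |A :: 't set| ) (G i)}" for A
  have inf: "infinite (B A)" if A: "|A| <o \<tau>" for A :: "'t set"
    using goal[OF A] neg unfolding B_def by blast
  from \<tau>(2)[unfolded sequential_cardinal_def]
  obtain s :: "nat \<Rightarrow> 't rel" where "\<forall>n. Card_order (s n) \<and> s n <o \<tau>"
      "\<forall>c :: 't rel. Card_order c \<and> (\<forall>n. s n \<le>o c) \<longrightarrow> \<tau> \<le>o c"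
    by (elim exE conjE)
  then have s: "\<And>n. Card_order (s n)" "\<And>n. s n <o \<tau>"
      "\<And>c :: 't rel. Card_order c \<Longrightarrow> (\<And>n. s n \<le>o c) \<Longrightarrow> \<tau> \<le>o c"
    by simp_all
  have "\<exists>A :: 't set. ( |A|, s n) \<in> ordIso \<and> |A| <o \<tau>" for n
    by (rule ordLess_imp_set[OF s(1,2)]) (rule exI, rule conjI)
  then obtain A :: "nat \<Rightarrow> 't set" where A: "\<And>n. ( |A n|, s n) \<in> ordIso" "\<And>n. |A n| <o \<tau>"
    by metis
  have "infinite (B (A n))" for n
    by (rule inf[OF A(2)])
  then obtain f where "inj f" "\<forall>n. f n \<in> B (A n)"
    by (rule inj_choice_infinite[where B = "\<lambda>n. B (A n)"])
  then have f: "inj f" "\<And>n. f n \<in> B (A n)"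
    by simp_all
  define P where "P n \<gamma> \<longleftrightarrow> (\<forall>U\<in>\<gamma>. openin X U) \<and> G (f n) \<subseteq> \<Union>\<gamma> \<and>
      (\<forall>\<V>. \<V> \<subseteq> \<gamma> \<longrightarrow> G (f n) \<subseteq> \<Union>\<V> \<longrightarrow> \<not> |\<V>| \<le>o |A n| )" for n \<gamma>
  have "\<exists>\<gamma>. P n \<gamma>" for n
    using f(2)[of n] unfolding B_def compact_lt_cardSuc P_def by auto
  then obtain \<gamma> where "\<And>n. P n (\<gamma> n)"
    by metis
  then have \<gamma>: "\<And>n U. U \<in> \<gamma> n \<Longrightarrow> openin X U" "\<And>n. G (f n) \<subseteq> \<Union>(\<gamma> n)"
      "\<And>n \<V>. \<V> \<subseteq> \<gamma> n \<Longrightarrow> G (f n) \<subseteq> \<Union>\<V> \<Longrightarrow> \<not> |\<V>| \<le>o |A n|"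
    unfolding P_def by simp_all
  have fI: "f n \<in> I" for n
    using f(2)[of n] by (simp add: B_def)
  have lf': "locally_finite_family X UNIV (\<lambda>n. G (f n))"
    unfolding locally_finite_family_def
  proof
    fix x assume "x \<in> topspace X"
    then obtain N where N: "openin X N" "x \<in> N" "finite {i \<in> I. G i \<inter> N \<noteq> {}}"
      using lf unfolding locally_finite_family_def by blast
    \<comment> \<open>Injectivity of \<open>f\<close> is what preserves local finiteness under
      reindexing.\<close>
    have "finite (f -` {i \<in> I. G i \<inter> N \<noteq> {}})"
      using N(3) f(1) by (rule finite_vimageI)
    moreover have "{n \<in> UNIV. G (f n) \<inter> N \<noteq> {}} = f -` {i \<in> I. G i \<inter> N \<noteq> {}}"
      using fI by auto
    ultimately show "\<exists>V. openin X V \<and> x \<in> V \<and> finite {n \<in> UNIV. G (f n) \<inter> V \<noteq> {}}"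
      using N(1,2) by (intro exI[of _ N]) simp
  qed
  obtain N :: "'a set" where N: "|N| <o \<tau>" "\<forall>n\<in>UNIV. \<exists>\<V>\<subseteq>\<gamma> n. G (f n) \<subseteq> \<Union>\<V> \<and> |\<V>| \<le>o |N|"
    by (rule locally_finite_simultaneous_subcovers[OF X closed[OF fI] lf' \<gamma>(1,2)])
  \<comment> \<open>\<open>N\<close> is moved to the type of \<open>\<tau>\<close> because
    \<open>sequential_cardinal\<close> tests upper bounds on that type only.\<close>
  obtain N' :: "'t set" where N': "( |N'|, |N| ) \<in> ordIso" "|N'| <o \<tau>"
    by (rule ordLess_imp_set[OF card_of_Card_order N(1)])
  have le: "s n \<le>o |N'|" for n
  proof -
    obtain \<V> where \<V>: "\<V> \<subseteq> \<gamma> n" "G (f n) \<subseteq> \<Union>\<V>" "|\<V>| \<le>o |N|"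
      using bspec[OF N(2) UNIV_I[of n]] by (elim exE conjE)
    have "\<not> |\<V>| \<le>o |A n|"
      by (rule \<gamma>(3)[OF \<V>(1,2)])
    then have "|A n| <o |\<V>|"
      by (simp add: card_of_Well_order not_ordLeq_iff_ordLess)
    then have "|A n| \<le>o |N|"
      using \<V>(3) by (rule ordLess_imp_ordLeq[OF ordLess_ordLeq_trans])
    then have "|A n| \<le>o |N'|"
      by (rule ordLeq_ordIso_trans[OF _ ordIso_symmetric[OF N'(1)]])
    then show ?thesis
      by (rule ordIso_ordLeq_trans[OF ordIso_symmetric[OF A(1)]])
  qed
  have "\<tau> \<le>o |N'|"
    by (rule s(3)[OF card_of_Card_order le])
  from not_ordLeq_ordLess[OF this] N'(2) show False
    by simp
qed

text \<open>For an uncountable sequential cardinal, \<open>F\<close> may be replaced by the set \<open>K\<close> of points without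
  small closed neighbourhoods: all members of a locally finite family of open sets that meet \<open>K\<close>
  are large, so there are only finitely many of them.\<close>

lemma sequential_core:
  fixes X :: "'a topology" and \<tau> :: "'t rel"
  assumes X: "regular_space X" "t1_space X" "compact_lt X \<tau> (topspace X)"
    and \<tau>: "Cinfinite \<tau>" "sequential_cardinal \<tau>" "natLeq <o \<tau>"
    and F: "F \<subseteq> topspace X" "locally_finitely_coverable X \<tau> F"
    and small: "\<And>C. closedin X C \<Longrightarrow> C \<subseteq> topspace X - F \<Longrightarrow>
      \<exists>A :: 't set. |A| <o \<tau> \<and> compact_lt X (cardSuc |A| ) C"
  obtains K where "K \<subseteq> topspace X" "locally_finitely_coverable X natLeq K"
    "\<forall>C. closedin X C \<longrightarrow> C \<subseteq> topspace X - K \<longrightarrow>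
      (\<exists>A :: 't set. |A| <o \<tau> \<and> compact_lt X (cardSuc |A| ) C)"
proof -
  define sm where "sm C \<longleftrightarrow> (\<exists>A :: 't set. |A| <o \<tau> \<and> compact_lt X (cardSuc |A| ) C)" for C
  have smI: "sm C" if "|A| <o \<tau>" "compact_lt X (cardSuc |A| ) C" for A :: "'t set" and C
    using that by (auto simp: sm_def)
  define K where "K = {x \<in> topspace X. \<forall>U. openin X U \<and> x \<in> U \<longrightarrow> \<not> sm (X closure_of U)}"
  have notK: "\<exists>U. openin X U \<and> x \<in> U \<and> sm (X closure_of U)" if "x \<in> topspace X" "x \<notin> K" for x
    using that by (auto simp: K_def)
  have large: "\<not> sm (X closure_of U)" if U: "openin X U" "U \<inter> K \<noteq> {}" for U
    using that by (auto simp: K_def)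
  have clF: "closedin X F"
    by (rule locally_finitely_coverable_closedin[OF X(1,2) F])
  \<comment> \<open>By regularity a point off \<open>F\<close> has a closed neighbourhood missing
    \<open>F\<close>, and such sets are small by hypothesis.\<close>
  have KF: "K \<subseteq> F"
  proof
    fix x assume x: "x \<in> K"
    show "x \<in> F"
    proof (rule ccontr)
      assume "x \<notin> F"
      then have xo: "x \<in> topspace X - F"
        using x by (simp add: K_def)
      have op: "openin X (topspace X - F)"
        using clF by blast
      obtain U where U: "openin X U" "x \<in> U" "X closure_of U \<subseteq> topspace X - F"
        by (rule regular_space_nbhd[OF X(1) op xo])
      have "sm (X closure_of U)"
        unfolding sm_def by (rule small[OF closedin_closure_of U(3)])
      with large[OF U(1)] U(2) x show False
        by blast
    qed
  qed
  have Ktop: "K \<subseteq> topspace X"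
    by (auto simp: K_def)
  have opK: "openin X (topspace X - K)"
  proof (subst openin_subopen, intro ballI)
    fix x assume "x \<in> topspace X - K"
    then obtain U where U: "openin X U" "x \<in> U" "sm (X closure_of U)"
      using notK[of x] by blast
    have "U \<inter> K = {}"
      using large[OF U(1)] U(3) by blast
    then have "U \<subseteq> topspace X - K"
      using openin_subset[OF U(1)] by blast
    with U(1,2) show "\<exists>T. openin X T \<and> x \<in> T \<and> T \<subseteq> topspace X - K"
      by blast
  qed
  show thesis
  proof (rule that[OF Ktop])
    show "locally_finitely_coverable X natLeq K"
      unfolding locally_finitely_coverable_def
    proof (intro allI impI)
      fix G assume G: "\<forall>x\<in>K. openin X (G x) \<and> x \<in> G x"
      \<comment> \<open>Indices outside \<open>K\<close> receive a set missing \<open>K\<close>.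
        Hence every member of the family that meets \<open>K\<close> is indexed by a point of
        \<open>K\<close>, where \<open>G'\<close> agrees with \<open>G\<close>.\<close>
      define G' where "G' x = (if x \<in> K then G x else topspace X - K)" for x
      have G': "openin X (G' x) \<and> x \<in> G' x" if "x \<in> F" for x
        using that G opK F(1) by (auto simp: G'_def)
      obtain M V where V: "M \<subseteq> F" "|M| <o \<tau>" "locally_finite_family X M V"
          "\<forall>x\<in>M. openin X (V x)" "\<forall>x\<in>M. V x \<subseteq> G' x" "F \<subseteq> (\<Union>x\<in>M. V x)"
        by (rule locally_finitely_coverableE[OF F(2) G'])
      define I where "I = {x \<in> M. V x \<inter> K \<noteq> {}}"
      obtain A :: "'t set" where A: "|A| <o \<tau>"
          "finite {x \<in> M. \<not> compact_lt X (cardSuc |A| ) (X closure_of V x)}"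
        by (rule finitely_many_large_members[OF \<tau>(1,2) X(3) closedin_closure_of
              locally_finite_family_closure_of[OF V(3)]])
      \<comment> \<open>An open set meeting \<open>K\<close> has a closure that violates every bound
        below \<open>\<tau>\<close>, in particular \<open>A\<close>.\<close>
      have "I \<subseteq> {x \<in> M. \<not> compact_lt X (cardSuc |A| ) (X closure_of V x)}"
      proof
        fix x assume x: "x \<in> I"
        then have "\<not> sm (X closure_of V x)"
          using large[of "V x"] V(4) by (auto simp: I_def)
        then show "x \<in> {x \<in> M. \<not> compact_lt X (cardSuc |A| ) (X closure_of V x)}"
          using smI[OF A(1)] x by (auto simp: I_def)
      qed
      then have fin: "finite I"
        using A(2) by (rule finite_subset)
      have IK: "x \<in> K" if x: "x \<in> I" for x
      proof (rule ccontr)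
        assume "x \<notin> K"
        moreover have "V x \<subseteq> G' x"
          using bspec[OF V(5), of x] x by (simp add: I_def)
        ultimately have "V x \<inter> K = {}"
          by (auto simp: G'_def)
        with x show False
          by (simp add: I_def)
      qed
      show "\<exists>M V. M \<subseteq> K \<and> |M| <o natLeq \<and> locally_finite_family X M V \<and>
          (\<forall>x\<in>M. openin X (V x) \<and> V x \<subseteq> G x) \<and> K \<subseteq> (\<Union>x\<in>M. V x)"
      proof (intro exI conjI)
        show "I \<subseteq> K"
          using IK by blast
        show "|I| <o natLeq"
          using fin by (simp add: finite_iff_ordLess_natLeq)
        show "locally_finite_family X I V"
          by (rule locally_finite_family_subset[OF V(3)]) (simp add: I_def)
        show "\<forall>x\<in>I. openin X (V x) \<and> V x \<subseteq> G x"
        proof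
          fix x assume x: "x \<in> I"
          then show "openin X (V x) \<and> V x \<subseteq> G x"
            using bspec[OF V(4), of x] bspec[OF V(5), of x] IK[OF x] by (simp add: I_def G'_def)
        qed
        show "K \<subseteq> (\<Union>x\<in>I. V x)"
        proof
          fix p assume p: "p \<in> K"
          then obtain x where "x \<in> M" "p \<in> V x"
            using V(6) KF by blast
          then show "p \<in> (\<Union>x\<in>I. V x)"
            using p by (auto simp: I_def)
        qed
      qed
    qed
    show "\<forall>C. closedin X C \<longrightarrow> C \<subseteq> topspace X - K \<longrightarrow>
      (\<exists>A :: 't set. |A| <o \<tau> \<and> compact_lt X (cardSuc |A| ) C)"
    proof (intro allI impI)
      fix C assume C: "closedin X C" "C \<subseteq> topspace X - K"
      \<comment> \<open>Points of \<open>C\<close> are not in \<open>K\<close>, so they have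
        neighbourhoods with small closure; points off \<open>C\<close> get one missing
        \<open>C\<close>. Only indices in \<open>C\<close> then contribute to covering
        \<open>C\<close>.\<close>
      have "\<exists>U. openin X U \<and> x \<in> U \<and> (if x \<in> C then sm (X closure_of U) else U \<inter> C = {})"
        if x: "x \<in> F" for x
      proof (cases "x \<in> C")
        case True
        then show ?thesis
          using notK[of x] C(2) by auto
      next
        case False
        moreover have "openin X (topspace X - C)"
          using C(1) by blast
        ultimately show ?thesis
          using x F(1) by (intro exI[of _ "topspace X - C"]) auto
      qed
      then obtain G where *: "\<And>x. x \<in> F \<Longrightarrow> openin X (G x) \<and> x \<in> G x \<and>
          (if x \<in> C then sm (X closure_of G x) else G x \<inter> C = {})"
        by metis
      then have G: "\<And>x. x \<in> F \<Longrightarrow> openin X (G x) \<and> x \<in> G x"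
          "\<And>x. x \<in> F \<Longrightarrow> x \<in> C \<Longrightarrow> sm (X closure_of G x)"
          "\<And>x. x \<in> F \<Longrightarrow> x \<notin> C \<Longrightarrow> G x \<inter> C = {}"
        by (simp, force, force)
      obtain M V where V: "M \<subseteq> F" "|M| <o \<tau>" "locally_finite_family X M V"
          "\<forall>x\<in>M. openin X (V x)" "\<forall>x\<in>M. V x \<subseteq> G x" "F \<subseteq> (\<Union>x\<in>M. V x)"
        by (rule locally_finitely_coverableE[OF F(2) G(1)])
      obtain A :: "'t set" where A: "|A| <o \<tau>"
          "finite {x \<in> M. \<not> compact_lt X (cardSuc |A| ) (X closure_of V x)}"
        by (rule finitely_many_large_members[OF \<tau>(1,2) X(3) closedin_closure_of
              locally_finite_family_closure_of[OF V(3)]])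
      \<comment> \<open>\<open>A\<close> bounds all but finitely many closures at once. The
        exceptions have bounds of their own because \<open>G x\<close> has small closure, and
        finitely many further bounds do not reach \<open>\<tau>\<close>.\<close>
      define J where "J = {x \<in> M \<inter> C. \<not> compact_lt X (cardSuc |A| ) (X closure_of V x)}"
      have finJ: "finite J"
        by (rule finite_subset[OF _ A(2)]) (auto simp: J_def)
      have "\<exists>B :: 't set. |B| <o \<tau> \<and> compact_lt X (cardSuc |B| ) (X closure_of V x)"
        if x: "x \<in> J" for x
      proof -
        have xM: "x \<in> M" "x \<in> C" "x \<in> F"
          using x V(1) by (auto simp: J_def)
        obtain B :: "'t set" where B: "|B| <o \<tau>" "compact_lt X (cardSuc |B| ) (X closure_of G x)"
          using G(2)[OF xM(3,2)] unfolding sm_def by (elim exE conjE)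
        have "X closure_of V x \<subseteq> X closure_of G x"
          using V(5) xM(1) by (intro closure_of_mono) simp
        from compact_lt_closed_subset[OF B(2) closure_of_subset_topspace closedin_closure_of this] B(1)
        show ?thesis
          by (intro exI[of _ B]) simp
      qed
      then obtain B :: "'a \<Rightarrow> 't set" where "\<And>x. x \<in> J \<Longrightarrow>
          |B x| <o \<tau> \<and> compact_lt X (cardSuc |B x| ) (X closure_of V x)"
        by metis
      then have B: "\<And>x. x \<in> J \<Longrightarrow> |B x| <o \<tau>"
          "\<And>x. x \<in> J \<Longrightarrow> compact_lt X (cardSuc |B x| ) (X closure_of V x)"
        by simp_all
      \<comment> \<open>The part of \<open>C\<close> left uncovered is closed and misses
        \<open>F\<close>, so the hypothesis \<open>small\<close> applies to it.\<close>
      define D where "D = C - (\<Union>x\<in>M. V x)"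
      have "openin X (\<Union>x\<in>M. V x)"
        using V(4) by blast
      then have clD: "closedin X D"
        unfolding D_def by (rule closedin_diff[OF C(1)])
      have "D \<subseteq> topspace X - F"
        using V(6) C(2) by (auto simp: D_def)
      from small[OF clD this] obtain A' :: "'t set" where
        A': "|A'| <o \<tau>" "compact_lt X (cardSuc |A'| ) D"
        by (elim exE conjE)
      obtain N :: "'t set" where N: "infinite N" "|N| <o \<tau>" "( |N|, natLeq) \<in> ordIso"
        by (rule uncountable_infinite_set[OF \<tau>(3)])
      obtain M' :: "'t set" where M': "( |M'|, |M| ) \<in> ordIso" "|M'| <o \<tau>"
        by (rule ordLess_imp_set[OF card_of_Card_order V(2)])
      \<comment> \<open>The common bound: \<open>A\<close> and the \<open>B x\<close> for the
        pieces, \<open>A'\<close> for the remainder \<open>D\<close>, \<open>M'\<close> for the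
        number of pieces, and \<open>N\<close> to make it infinite.\<close>
      define T where "T = (A \<union> A') \<union> (N \<union> M') \<union> (\<Union>x\<in>J. B x)"
      have "|T| <o \<tau>"
        unfolding T_def
        by (intro card_of_Un_ordLess[OF \<tau>(1)] finite_UN_ordLess[OF \<tau>(1) finJ] A(1) A'(1) N(2) M'(2) B(1))
      moreover have "compact_lt X (cardSuc |T| ) C"
      proof -
        have infT: "infinite T"
          using N(1) by (simp add: T_def)
        have cl: "compact_lt X (cardSuc |T| ) (C \<inter> X closure_of V x)" if x: "x \<in> M \<inter> C" for x
        proof -
          have "compact_lt X (cardSuc |T| ) (X closure_of V x)"
          proof (cases "x \<in> J")
            case True
            then have "B x \<subseteq> T"
              by (auto simp: T_def)
            from compact_lt_cardSuc_mono[OF B(2)[OF True] card_of_mono1[OF this]] show ?thesis .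
          next
            case False
            then have "compact_lt X (cardSuc |A| ) (X closure_of V x)"
              using x by (simp add: J_def)
            moreover have "A \<subseteq> T"
              by (auto simp: T_def)
            ultimately show ?thesis
              using compact_lt_cardSuc_mono card_of_mono1 by metis
          qed
          then show ?thesis
            by (rule compact_lt_closed_subset[OF _ closure_of_subset_topspace closedin_Int[OF C(1) closedin_closure_of]])
              simp
        qed
        have MT: "|M \<inter> C| \<le>o |T|"
        proof -
          have "|M \<inter> C| \<le>o |M|"
            by (rule card_of_mono1) simp
          also have "|M| \<le>o |M'|"
            using M'(1) by (simp add: ordIso_iff_ordLeq)
          also have "|M'| \<le>o |T|"
            by (rule card_of_mono1) (auto simp: T_def)
          finally show ?thesis .
        qed
        have T1: "compact_lt X (cardSuc |T| ) (\<Union>x\<in>M \<inter> C. C \<inter> X closure_of V x)"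
          by (rule compact_lt_UN[OF infT MT cl])
        have "A' \<subseteq> T"
          by (auto simp: T_def)
        from compact_lt_cardSuc_mono[OF A'(2) card_of_mono1[OF this]]
        have T2: "compact_lt X (cardSuc |T| ) D" .
        \<comment> \<open>A union of two sets is written over \<open>bool\<close> so that
          \<open>compact_lt_UN\<close> covers it.\<close>
        define H where "H b = (if b then D else (\<Union>x\<in>M \<inter> C. C \<inter> X closure_of V x))" for b
        have "compact_lt X (cardSuc |T| ) (\<Union>b\<in>UNIV. H b)"
        proof (rule compact_lt_UN[OF infT])
          show "|UNIV :: bool set| \<le>o |T|"
            using infT ordLess_imp_ordLeq[OF ordLess_ordLeq_trans[of "|UNIV :: bool set|" natLeq "|T|"]]
              finite_iff_ordLess_natLeq[of "UNIV :: bool set"] infinite_iff_natLeq_ordLeq[of T]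
            by simp
          show "compact_lt X (cardSuc |T| ) (H b)" for b
            using T1 T2 by (simp add: H_def)
        qed
        moreover have "(\<Union>b\<in>UNIV. H b) = C"
        proof
          show "(\<Union>b\<in>UNIV. H b) \<subseteq> C"
            by (auto simp: H_def D_def split: if_splits)
          show "C \<subseteq> (\<Union>b\<in>UNIV. H b)"
          proof
            fix p assume p: "p \<in> C"
            show "p \<in> (\<Union>b\<in>UNIV. H b)"
            proof (cases "p \<in> D")
              case True
              then show ?thesis
                by (auto simp: H_def)
            next
              case False
              then obtain x where x: "x \<in> M" "p \<in> V x"
                using p by (auto simp: D_def)
              have "x \<in> C"
                using V(1,5) G(3)[of x] x p by blast
              moreover have "p \<in> X closure_of V x"
                using closure_of_subset[of "V x" X] V(4) x openin_subset by blast
              ultimately have "p \<in> H False"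
                using x(1) p by (auto simp: H_def)
              then show ?thesis
                by blast
            qed
          qed
        qed
        ultimately show ?thesis
          by simp
      qed
      ultimately show "\<exists>A :: 't set. |A| <o \<tau> \<and> compact_lt X (cardSuc |A| ) C"
        by (intro exI[of _ T]) simp
    qed
  qed
qed

subsection \<open>Generalized total boundedness\<close>

text \<open>An infinite \<open>L\<close> absorbs the factor \<open>nat\<close>; for a nonempty
  finite \<open>L\<close> the product is countably infinite, which is below \<open>\<tau>\<close>
  only if \<open>\<tau>\<close> is uncountable.\<close>

lemma Times_nat_ordLess:
  fixes L :: "'c set"
  assumes "Cinfinite \<tau>" "|L| <o \<tau>" "infinite L \<or> natLeq <o \<tau>"
  shows "|L \<times> (UNIV :: nat set)| <o \<tau>"
proof (cases "finite L")
  case True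
  then have "countable (L \<times> (UNIV :: nat set))"
    by (simp add: countable_finite)
  then have "|L \<times> (UNIV :: nat set)| \<le>o |UNIV :: nat set|"
    unfolding countable_def card_of_ordLeq[symmetric] by auto
  also have "|UNIV :: nat set| \<le>o natLeq"
    using card_of_nat by (simp add: ordIso_iff_ordLeq)
  finally show ?thesis
    using assms(3) True ordLeq_ordLess_trans[of _ natLeq \<tau>] by simp
next
  case False
  then have "|UNIV :: nat set| \<le>o |L|"
    using infinite_iff_card_of_nat[of L] by simp
  from card_of_Times_infinite_simps(1)[OF False UNIV_not_empty this]
  have "|L \<times> (UNIV :: nat set)| \<le>o |L|"
    unfolding ordIso_iff_ordLeq by (rule conjunct1)
  then show ?thesis
    using assms(2) by (rule ordLeq_ordLess_trans)
qed

lemma compact_lt_finite: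
  assumes "Cinfinite \<tau>" "finite C"
  shows "compact_lt X \<tau> C"
  unfolding compact_lt_def
proof (intro allI impI, elim conjE)
  fix \<U> assume \<U>: "\<forall>U\<in>\<U>. openin X U" "C \<subseteq> \<Union>\<U>"
  have "\<exists>U. U \<in> \<U> \<and> x \<in> U" if x: "x \<in> C" for x
    using \<U>(2) x by blast
  then obtain f where f: "\<And>x. x \<in> C \<Longrightarrow> f x \<in> \<U> \<and> x \<in> f x"
    by metis
  then have "f ` C \<subseteq> \<U>" "C \<subseteq> \<Union>(f ` C)"
    by auto
  moreover have "|f ` C| <o \<tau>"
    using assms by (simp add: finite_card_of_ordLess)
  ultimately show "\<exists>\<V>\<subseteq>\<U>. C \<subseteq> \<Union>\<V> \<and> |\<V>| <o \<tau>"
    by (intro exI[of _ "f ` C"]) simp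
qed

section \<open>Dense sets, total boundedness and completeness in metric spaces\<close>

context Metric_space
begin

text \<open>Balls of radius \<open>1 / Suc n\<close> about points of \<open>L\<close> form an outer
  base at the closure of \<open>L\<close>. Both the covering bound and the weight bound below come
  from counting these balls.\<close>

lemma mball_between:
  assumes "x \<in> mtopology closure_of L" "0 < \<epsilon>"
  obtains y n where "y \<in> L" "x \<in> mball y (1 / Suc n)" "mball y (1 / Suc n) \<subseteq> mball x \<epsilon>"
proof -
  obtain n where n: "1 / real (Suc n) < \<epsilon> / 2"
    using assms(2) nat_approx_posE[of "\<epsilon> / 2"] by auto
  have "x \<in> M" "\<forall>r>0. \<exists>y\<in>L. y \<in> mball x r"
    using assms(1) by (auto simp: metric_closure_of)
  moreover have "0 < 1 / real (Suc n)"
    by simp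
  ultimately obtain y where y: "y \<in> L" "y \<in> mball x (1 / Suc n)"
    by blast
  show thesis
  proof (rule that[OF y(1)])
    show "x \<in> mball y (1 / Suc n)"
      using y(2) by (simp add: commute)
    have "d x y + 1 / real (Suc n) \<le> \<epsilon>"
      using y(2) n by (simp add: in_mball)
    then show "mball y (1 / Suc n) \<subseteq> mball x \<epsilon>"
      using y(2) by (intro mball_subset) (simp_all add: commute)
  qed
qed

text \<open>For infinite \<open>L\<close> there are only \<open>|L|\<close> balls with centre in
  \<open>L\<close> and radius \<open>1 / Suc n\<close>, and one member of the cover is chosen for
  each ball inside some member. Finite \<open>L\<close> is treated apart since \<open>\<tau>\<close>
  may be countable; its points in \<open>M\<close> form a closed set.\<close>

lemma compact_lt_closure_of:
  assumes \<tau>: "Cinfinite \<tau>" and L: "|L| <o \<tau>"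
  shows "compact_lt mtopology \<tau> (mtopology closure_of L)"
proof (cases "finite L")
  case True
  have "mtopology closure_of L = mtopology closure_of (M \<inter> L)"
    using closure_of_restrict[of mtopology L] by simp
  also have "\<dots> = M \<inter> L"
    using True closedin_Hausdorff_finite[OF Hausdorff_space_mtopology, of "M \<inter> L"]
    by (intro closure_of_closedin) simp
  finally show ?thesis
    using compact_lt_finite[OF \<tau>, of "M \<inter> L"] True by simp
next
  case False
  show ?thesis
    unfolding compact_lt_def
  proof (intro allI impI, elim conjE)
    fix \<U> assume \<U>: "\<forall>U\<in>\<U>. openin mtopology U" "mtopology closure_of L \<subseteq> \<Union>\<U>"
    define P where "P = {(y, n :: nat). y \<in> L \<and> (\<exists>U\<in>\<U>. mball y (1 / Suc n) \<subseteq> U)}"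
    have "\<exists>U. U \<in> \<U> \<and> mball (fst p) (1 / Suc (snd p)) \<subseteq> U" if "p \<in> P" for p
      using that by (auto simp: P_def)
    then obtain f where f: "\<And>p. p \<in> P \<Longrightarrow> f p \<in> \<U>"
        "\<And>p. p \<in> P \<Longrightarrow> mball (fst p) (1 / Suc (snd p)) \<subseteq> f p"
      by metis
    have "P \<subseteq> L \<times> UNIV"
      by (auto simp: P_def)
    from card_of_mono1[OF this] have "|P| <o \<tau>"
      by (rule ordLeq_ordLess_trans) (rule Times_nat_ordLess[OF \<tau> L disjI1[OF False]])
    then have card: "|f ` P| <o \<tau>"
      by (rule image_ordLess)
    have cover: "mtopology closure_of L \<subseteq> \<Union>(f ` P)"
    proof
      fix x assume x: "x \<in> mtopology closure_of L"
      then obtain U where U: "U \<in> \<U>" "x \<in> U"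
        using \<U>(2) by blast
      then obtain \<epsilon> where \<epsilon>: "0 < \<epsilon>" "mball x \<epsilon> \<subseteq> U"
        using bspec[OF \<U>(1) U(1)] U(2) unfolding openin_mtopology by blast
      obtain y n where y: "y \<in> L" "x \<in> mball y (1 / Suc n)" "mball y (1 / Suc n) \<subseteq> mball x \<epsilon>"
        by (rule mball_between[OF x \<epsilon>(1)])
      have "(y, n) \<in> P"
        using y(1,3) \<epsilon>(2) U(1) by (auto simp: P_def)
      with f(2)[of "(y, n)"] y(2) show "x \<in> \<Union>(f ` P)"
        by auto
    qed
    have "f ` P \<subseteq> \<U>"
      using f(1) by blast
    with card cover show "\<exists>\<V>\<subseteq>\<U>. mtopology closure_of L \<subseteq> \<Union>\<V> \<and> |\<V>| <o \<tau>"
      by (intro exI[of _ "f ` P"]) simp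
  qed
qed

text \<open>This follows the proof that complete totally bounded spaces are compact. If
  \<open>Z\<close> has no small subcover, then neither has its intersection with some small closed
  ball, since the part near \<open>L\<close> is covered by \<open>compact_lt_closure_of\<close> and
  only finitely many balls remain. Iteration gives nested closed sets of vanishing size; a member of
  the cover around their common point swallows one of them.\<close>

lemma compact_lt_if_totally_bounded:
  assumes complete: mcomplete and Z: "closedin mtopology Z" and \<tau>: "Cinfinite \<tau>"
    and tb: "\<And>\<epsilon>. 0 < \<epsilon> \<Longrightarrow> \<exists>S L. finite S \<and> |L :: 'a set| <o \<tau> \<and>
      Z \<subseteq> mtopology closure_of (L \<union> (\<Union>y\<in>S. mball y \<epsilon>))"
  shows "compact_lt mtopology \<tau> Z"
  unfolding compact_lt_def
proof (intro allI impI, elim conjE)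
  fix \<U> assume \<U>: "\<forall>U\<in>\<U>. openin mtopology U" "Z \<subseteq> \<Union>\<U>"
  define ok where "ok C \<longleftrightarrow> (\<exists>\<V>. \<V> \<subseteq> \<U> \<and> C \<subseteq> \<Union>\<V> \<and> |\<V>| <o \<tau>)" for C
  have okI: "ok C" if "\<V> \<subseteq> \<U>" "C \<subseteq> \<Union>\<V>" "|\<V>| <o \<tau>" for C \<V>
    unfolding ok_def using that by (intro exI[of _ \<V>]) simp
  have ok_empty: "ok {}"
    using okI[of "{}"] finite_card_of_ordLess[OF \<tau>, of "{}"] by simp
  have ok_subset: "ok D" if "ok C" "D \<subseteq> C" for C D
  proof -
    obtain \<V> where "\<V> \<subseteq> \<U>" "C \<subseteq> \<Union>\<V>" "|\<V>| <o \<tau>"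
      using \<open>ok C\<close> unfolding ok_def by (elim exE conjE)
    then show ?thesis
      using \<open>D \<subseteq> C\<close> by (intro okI[of \<V>]) auto
  qed
  have ok_Un: "ok (C \<union> D)" if "ok C" "ok D" for C D
  proof -
    obtain \<V> where V: "\<V> \<subseteq> \<U>" "C \<subseteq> \<Union>\<V>" "|\<V>| <o \<tau>"
      using \<open>ok C\<close> unfolding ok_def by (elim exE conjE)
    obtain \<W> where W: "\<W> \<subseteq> \<U>" "D \<subseteq> \<Union>\<W>" "|\<W>| <o \<tau>"
      using \<open>ok D\<close> unfolding ok_def by (elim exE conjE)
    show ?thesis
    proof (rule okI[of "\<V> \<union> \<W>"])
      show "|\<V> \<union> \<W>| <o \<tau>"
        by (rule card_of_Un_ordLess[OF \<tau> V(3) W(3)])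
      show "\<V> \<union> \<W> \<subseteq> \<U>" "C \<union> D \<subseteq> \<Union>(\<V> \<union> \<W>)"
        using V(1,2) W(1,2) by auto
    qed
  qed
  have ok_UN: "ok (\<Union>i\<in>S. C i)" if S: "finite S" and ok: "\<And>i. i \<in> S \<Longrightarrow> ok (C i)" for S and C :: "'a \<Rightarrow> 'a set"
    using S ok by (induction S) (simp_all add: ok_empty ok_Un)
  have step: "\<exists>y. \<not> ok (C \<inter> mcball y \<epsilon>)"
    if C: "closedin mtopology C" "C \<subseteq> Z" "\<not> ok C" and \<epsilon>: "0 < \<epsilon>" for C \<epsilon>
  proof (rule ccontr)
    assume "\<nexists>y. \<not> ok (C \<inter> mcball y \<epsilon>)"
    then have all: "ok (C \<inter> mcball y \<epsilon>)" for y
      by simp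
    obtain S and L :: "'a set" where SL: "finite S" "|L| <o \<tau>"
        "Z \<subseteq> mtopology closure_of (L \<union> (\<Union>y\<in>S. mball y \<epsilon>))"
      using tb[OF \<epsilon>] by (elim exE conjE)
    have "compact_lt mtopology \<tau> (C \<inter> mtopology closure_of L)"
      by (rule compact_lt_closed_subset[OF compact_lt_closure_of[OF \<tau> SL(2)]
            closure_of_subset_topspace closedin_Int[OF C(1) closedin_closure_of]]) simp
    moreover have "C \<inter> mtopology closure_of L \<subseteq> \<Union>\<U>"
      using C(2) \<U>(2) by blast
    ultimately have ok1: "ok (C \<inter> mtopology closure_of L)"
      using \<U>(1) unfolding compact_lt_def ok_def by simp
    have ok2: "ok (\<Union>y\<in>S. C \<inter> mcball y \<epsilon>)"
      by (rule ok_UN[OF SL(1) all])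
    have "mtopology closure_of (\<Union>y\<in>S. mball y \<epsilon>) \<subseteq> (\<Union>y\<in>S. mcball y \<epsilon>)"
    proof (rule closure_of_minimal)
      show "closedin mtopology (\<Union>y\<in>S. mcball y \<epsilon>)"
        using SL(1) by (intro closedin_Union) auto
    qed (use mball_subset_mcball in blast)
    then have "C \<subseteq> (C \<inter> mtopology closure_of L) \<union> (\<Union>y\<in>S. C \<inter> mcball y \<epsilon>)"
      using SL(3) C(2) by (auto simp: closure_of_Un)
    then have "ok C"
      by (rule ok_subset[OF ok_Un[OF ok1 ok2]])
    with C(3) show False ..
  qed
  show "\<exists>\<V>\<subseteq>\<U>. Z \<subseteq> \<Union>\<V> \<and> |\<V>| <o \<tau>"
  proof (rule ccontr)
    assume "\<not> ?thesis"
    then have "\<not> ok Z"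
      by (simp add: ok_def)
    then have "\<exists>C. \<forall>n. (closedin mtopology (C n) \<and> C n \<subseteq> Z \<and> \<not> ok (C n)) \<and>
        (C (Suc n) \<subseteq> C n \<and> (\<exists>y. C (Suc n) \<subseteq> mcball y (1 / Suc n)))"
    proof (intro dependent_nat_choice)
      fix C n assume C: "closedin mtopology C \<and> C \<subseteq> Z \<and> \<not> ok C"
      then obtain y where "\<not> ok (C \<inter> mcball y (1 / Suc n))"
        using step[of C "1 / Suc n"] by auto
      with C show "\<exists>D. (closedin mtopology D \<and> D \<subseteq> Z \<and> \<not> ok D) \<and>
          (D \<subseteq> C \<and> (\<exists>y. D \<subseteq> mcball y (1 / Suc n)))"
        by (intro exI[of _ "C \<inter> mcball y (1 / Suc n)"]) (auto intro: closedin_Int)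
    qed (use Z in blast)
    then obtain C where "\<forall>n. (closedin mtopology (C n) \<and> C n \<subseteq> Z \<and> \<not> ok (C n)) \<and>
        (C (Suc n) \<subseteq> C n \<and> (\<exists>y. C (Suc n) \<subseteq> mcball y (1 / Suc n)))"
      by (elim exE)
    then have C: "\<And>n. closedin mtopology (C n)" "\<And>n. C n \<subseteq> Z" "\<And>n. \<not> ok (C n)"
        "\<And>n. C (Suc n) \<subseteq> C n" "\<And>n. \<exists>y. C (Suc n) \<subseteq> mcball y (1 / Suc n)"
      by simp_all
    have small: "\<exists>n y. C n \<subseteq> mcball y \<epsilon>" if \<epsilon>: "0 < \<epsilon>" for \<epsilon>
    proof -
      obtain n where n: "1 / real (Suc n) < \<epsilon>"
        by (rule nat_approx_posE[OF \<epsilon>])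
      obtain y where "C (Suc n) \<subseteq> mcball y (1 / Suc n)"
        using C(5)[of n] by (elim exE)
      then have "C (Suc n) \<subseteq> mcball y \<epsilon>"
        using mcball_subset_concentric[OF less_imp_le[OF n], of y] by (rule subset_trans)
      then show ?thesis
        by blast
    qed
    have "C n \<noteq> {}" for n
      using C(3)[of n] ok_empty by auto
    then have "\<Inter>(range C) \<noteq> {}"
      using complete[unfolded mcomplete_nest, rule_format, of C] C(1) small decseq_SucI[of C, OF C(4)]
      by simp
    then obtain z where z: "\<And>n. z \<in> C n"
      by auto
    then obtain U where U: "U \<in> \<U>" "z \<in> U"
      using C(2) \<U>(2) by blast
    then obtain \<epsilon> where \<epsilon>: "0 < \<epsilon>" "mball z \<epsilon> \<subseteq> U"
      using bspec[OF \<U>(1) U(1)] U(2) unfolding openin_mtopology by blast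
    \<comment> \<open>Two points of \<open>C n\<close> are at distance at most
      \<open>2 * \<epsilon> / 3\<close>, which is less than \<open>\<epsilon>\<close>.\<close>
    obtain n y where n: "C n \<subseteq> mcball y (\<epsilon> / 3)"
      using small[of "\<epsilon> / 3"] \<epsilon>(1) by auto
    have "C n \<subseteq> U"
    proof
      fix x assume "x \<in> C n"
      then have "x \<in> mcball y (\<epsilon> / 3)" "z \<in> mcball y (\<epsilon> / 3)"
        using n z[of n] by blast+
      then have "x \<in> mball z \<epsilon>"
        using triangle[of z y x] \<epsilon>(1) by (auto simp: commute)
      then show "x \<in> U"
        using \<epsilon>(2) by blast
    qed
    moreover have "|{U}| <o \<tau>"
      by (rule finite_card_of_ordLess[OF \<tau>]) simp
    ultimately have "ok (C n)"
      using U(1) by (intro okI[of "{U}"]) auto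
    then show False
      using C(3) by blast
  qed
qed

text \<open>The traces on \<open>Z\<close> of the balls about \<open>L\<close> form a base;
  uncountability of \<open>\<tau>\<close> keeps \<open>L \<times> nat\<close> below
  \<open>\<tau>\<close> also for finite \<open>L\<close>.\<close>

lemma weight_subtopology_ordLess:
  assumes \<tau>: "Cinfinite \<tau>" "natLeq <o \<tau>" and L: "|L| <o \<tau>"
    and Z: "Z \<subseteq> mtopology closure_of L"
  shows "weight (subtopology mtopology Z) <o \<tau>"
proof -
  define \<B> where "\<B> = (\<lambda>(y, n). Z \<inter> mball y (1 / Suc n)) ` (L \<times> (UNIV :: nat set))"
  have "topology_base (subtopology mtopology Z) \<B>"
    unfolding topology_base_def
  proof (intro conjI ballI allI impI, unfold conj_imp_eq_imp_imp)
    show "openin (subtopology mtopology Z) B" if "B \<in> \<B>" for B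
      using that by (auto simp: \<B>_def intro: openin_subtopology_Int2)
    fix U x assume U: "openin (subtopology mtopology Z) U" "x \<in> U"
    then obtain T where T: "openin mtopology T" "U = T \<inter> Z"
      by (auto simp: openin_subtopology)
    then obtain \<epsilon> where \<epsilon>: "0 < \<epsilon>" "mball x \<epsilon> \<subseteq> T"
      using T U(2) unfolding openin_mtopology by blast
    have x: "x \<in> mtopology closure_of L"
      using U(2) T(2) Z by blast
    obtain y n where y: "y \<in> L" "x \<in> mball y (1 / Suc n)" "mball y (1 / Suc n) \<subseteq> mball x \<epsilon>"
      by (rule mball_between[OF x \<epsilon>(1)])
    show "\<exists>B\<in>\<B>. x \<in> B \<and> B \<subseteq> U"
    proof
      show "Z \<inter> mball y (1 / Suc n) \<in> \<B>"
        using y(1) by (auto simp: \<B>_def)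
      show "x \<in> Z \<inter> mball y (1 / Suc n) \<and> Z \<inter> mball y (1 / Suc n) \<subseteq> U"
        using y(2,3) \<epsilon>(2) U(2) T(2) by auto
    qed
  qed
  then have "weight (subtopology mtopology Z) \<le>o |\<B>|"
    using weight_ordLeq_iff[of "subtopology mtopology Z" "|\<B>|"] card_of_mono1[of \<B> \<B>] by auto
  also have "|\<B>| <o \<tau>"
    unfolding \<B>_def using Times_nat_ordLess[OF \<tau>(1) L] \<tau>(2) by (intro image_ordLess) simp
  finally show ?thesis .
qed

lemma geometric_limit:
  assumes complete: mcomplete and \<sigma>: "\<And>i. \<sigma> i \<in> M" "\<And>i. d (\<sigma> i) (\<sigma> (Suc i)) < c / 2 ^ i"
  obtains y where "limitin mtopology \<sigma> y sequentially" "d (\<sigma> 0) y \<le> 2 * c"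
proof -
  have c: "0 < c"
    using le_less_trans[OF nonneg \<sigma>(2)[of 0]] by simp
  \<comment> \<open>The bound is the exact partial sum of the geometric series, so the induction
    closes without loss; \<open>2 * c\<close> is its total from index \<open>0\<close>.\<close>
  have *: "d (\<sigma> i) (\<sigma> (i + k)) \<le> 2 * c / 2 ^ i - 2 * c / 2 ^ (i + k)" for i k
  proof (induction k)
    case (Suc k)
    have "d (\<sigma> i) (\<sigma> (i + Suc k)) \<le> d (\<sigma> i) (\<sigma> (i + k)) + d (\<sigma> (i + k)) (\<sigma> (i + Suc k))"
      using \<sigma>(1) by (intro triangle)
    also have "\<dots> \<le> 2 * c / 2 ^ i - 2 * c / 2 ^ (i + k) + c / 2 ^ (i + k)"
      using Suc.IH \<sigma>(2)[of "i + k"] by simp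
    also have "\<dots> = 2 * c / 2 ^ i - 2 * c / 2 ^ (i + Suc k)"
      by (simp add: field_simps)
    finally show ?case .
  qed (use \<sigma>(1) in simp)
  have lt: "d (\<sigma> i) (\<sigma> j) < 2 * c / 2 ^ i" if "i \<le> j" for i j
  proof -
    have "d (\<sigma> i) (\<sigma> j) \<le> 2 * c / 2 ^ i - 2 * c / 2 ^ j"
      using *[of i "j - i"] that by simp
    moreover have "0 < 2 * c / 2 ^ j"
      using c by simp
    ultimately show ?thesis
      by linarith
  qed
  have "MCauchy \<sigma>"
    unfolding MCauchy_def
  proof (intro conjI allI impI)
    show "range \<sigma> \<subseteq> M"
      using \<sigma>(1) by blast
    fix \<epsilon> :: real assume "0 < \<epsilon>"
    \<comment> \<open>The factor \<open>4 * c\<close> accounts for two tails after \<open>N\<close>,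
      each below \<open>2 * c / 2 ^ N\<close>.\<close>
    then obtain N where N: "(1 / 2) ^ N < \<epsilon> / (4 * c)"
      using real_arch_pow_inv[of "\<epsilon> / (4 * c)" "1 / 2"] c by auto
    have N': "2 * (2 * c / 2 ^ N) < \<epsilon>"
      using N c by (simp add: field_simps power_divide)
    have "\<forall>n n'. N \<le> n \<longrightarrow> N \<le> n' \<longrightarrow> d (\<sigma> n) (\<sigma> n') < \<epsilon>"
    proof (intro allI impI)
      fix n n' assume "N \<le> n" "N \<le> n'"
      then have "d (\<sigma> N) (\<sigma> n) < 2 * c / 2 ^ N" "d (\<sigma> N) (\<sigma> n') < 2 * c / 2 ^ N"
        by (auto intro: lt)
      moreover have "d (\<sigma> n) (\<sigma> n') \<le> d (\<sigma> n) (\<sigma> N) + d (\<sigma> N) (\<sigma> n')"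
        using \<sigma>(1) by (intro triangle)
      ultimately show "d (\<sigma> n) (\<sigma> n') < \<epsilon>"
        using N' commute[of "\<sigma> n" "\<sigma> N"] by linarith
    qed
    then show "\<exists>N. \<forall>n n'. N \<le> n \<longrightarrow> N \<le> n' \<longrightarrow> d (\<sigma> n) (\<sigma> n') < \<epsilon>" ..
  qed
  then obtain y where y: "limitin mtopology \<sigma> y sequentially"
    using complete unfolding mcomplete_def by blast
  have "y \<in> mtopology closure_of (range \<sigma>)"
    using y limitin_sequentially[of mtopology \<sigma> y] by (auto simp: in_closure_of)
  moreover have "range \<sigma> \<subseteq> mcball (\<sigma> 0) (2 * c)"
    using less_imp_le[OF lt[of 0]] \<sigma>(1) by auto
  then have "mtopology closure_of (range \<sigma>) \<subseteq> mcball (\<sigma> 0) (2 * c)"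
    by (rule closure_of_minimal) simp
  ultimately have "d (\<sigma> 0) y \<le> 2 * c"
    by auto
  with y show thesis
    by (rule that)
qed

end

subsection \<open>Lower semi-continuous selections from countably many levels of nodes\<close>

text \<open>A node \<open>(V, y)\<close> of level \<open>n\<close> records that \<open>\<theta> x\<close> comes within \<open>1 / 2 ^ n\<close> of \<open>y\<close> for all \<open>x\<close> in
  the closure of \<open>V\<close>. Level \<open>0\<close> carries no metric condition, so that a single node covers \<open>X\<close>.\<close>

locale lsc_closed_valued_map = Metric_space M d
  for M :: "'b set" and d +
  fixes X :: "'a topology" and \<theta> :: "'a \<Rightarrow> 'b set"
  assumes complete: mcomplete
    and regular: "regular_space X"
    and lsc: "lower_semicontinuous X mtopology \<theta>"
    and closed_values: "closed_valued X mtopology \<theta>"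
begin

lemma value_nonempty: "x \<in> topspace X \<Longrightarrow> \<theta> x \<noteq> {}"
  and value_subset: "x \<in> topspace X \<Longrightarrow> \<theta> x \<subseteq> M"
  using lsc by (auto simp: lower_semicontinuous_def set_valued_map_def)

definition near :: "nat \<Rightarrow> 'b \<Rightarrow> 'b set" where
  "near n y = (if n = 0 then M else mball y (1 / 2 ^ n))"

definition good :: "nat \<Rightarrow> 'a set \<times> 'b \<Rightarrow> bool" where
  "good n p \<longleftrightarrow> openin X (fst p) \<and> snd p \<in> M \<and>
     (\<forall>x\<in>X closure_of fst p. \<theta> x \<inter> near n (snd p) \<noteq> {})"

text \<open>This is what lets a sequence of nodes through a point be continued. The set
  \<open>D\<close> is a parameter because core nodes and branch nodes share the continuation of a
  core node.\<close>

definition linked :: "nat \<Rightarrow> ('a set \<times> 'b) set \<Rightarrow> 'a set \<Rightarrow> ('a set \<times> 'b) set \<Rightarrow> bool" where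
  "linked n P D Q \<longleftrightarrow>
     (\<forall>p\<in>P. \<forall>x\<in>fst p \<inter> D. \<exists>q\<in>Q. x \<in> fst q \<and> snd q \<in> near n (snd p))"

text \<open>In contrast to \<open>linked\<close> this looks backwards and records distances only: it
  bounds how far later centres can drift, whatever points their open sets contain.\<close>

definition descends :: "nat \<Rightarrow> ('a set \<times> 'b) set \<Rightarrow> ('a set \<times> 'b) set \<Rightarrow> bool" where
  "descends n P Q \<longleftrightarrow> (\<forall>q\<in>Q. \<exists>p\<in>P. snd q \<in> near n (snd p))"

section \<open>One step of the node construction\<close>

lemma near_subset: "near n y \<subseteq> M"
  by (auto simp: near_def)

lemma good_open: "good n p \<Longrightarrow> openin X (fst p)"
  and good_snd: "good n p \<Longrightarrow> snd p \<in> M"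
  by (simp_all add: good_def)

lemma good_near: "good n p \<Longrightarrow> x \<in> X closure_of fst p \<Longrightarrow> \<theta> x \<inter> near n (snd p) \<noteq> {}"
  by (simp add: good_def)

lemma good_subset:
  assumes "good n p" "openin X V" "V \<subseteq> fst p"
  shows "good n (V, snd p)"
  using assms closure_of_mono[OF assms(3), of X] by (auto simp: good_def)

lemma linkedE:
  assumes "linked n P D Q" "p \<in> P" "x \<in> fst p" "x \<in> D"
  obtains q where "q \<in> Q" "x \<in> fst q" "snd q \<in> near n (snd p)"
  using assms unfolding linked_def by blast

lemma refine_node:
  assumes p: "good n p" and x: "x \<in> X closure_of fst p" and W: "openin X W" "x \<in> W"
  obtains z V where "z \<in> near n (snd p)" "x \<in> V" "X closure_of V \<subseteq> W" "good (Suc n) (V, z)"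
proof -
  have xX: "x \<in> topspace X"
    using x by (simp add: in_closure_of)
  obtain z where z: "z \<in> \<theta> x" "z \<in> near n (snd p)"
    using good_near[OF p x] by blast
  have zM: "z \<in> M"
    using z(2) near_subset by blast
  have "openin mtopology (near (Suc n) z)"
    by (simp add: near_def)
  then have op: "openin X (sv_vimage X \<theta> (near (Suc n) z) \<inter> W)"
    using lsc W(1) by (simp add: lower_semicontinuous_def openin_Int)
  have "z \<in> near (Suc n) z"
    using zM by (simp add: near_def)
  then have xin: "x \<in> sv_vimage X \<theta> (near (Suc n) z) \<inter> W"
    using z(1) xX W(2) by (auto simp: sv_vimage_def)
  obtain V where V: "openin X V" "x \<in> V" "X closure_of V \<subseteq> sv_vimage X \<theta> (near (Suc n) z) \<inter> W"
    by (rule regular_space_nbhd[OF regular op xin])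
  show thesis
  proof (rule that[OF z(2) V(2)])
    show "X closure_of V \<subseteq> W"
      using V(3) by blast
    show "good (Suc n) (V, z)"
      using V(1,3) zM by (auto simp: good_def sv_vimage_def)
  qed
qed

text \<open>The closure of \<open>fst p\<close> intersected with \<open>E\<close> is closed in
  \<open>E\<close>, so at most \<open>|A|\<close> refinements of \<open>p\<close> cover it. With at
  most \<open>|A|\<close> nodes \<open>p\<close> this stays within \<open>|A|\<close>, and the same
  bound serves the next step.\<close>

lemma node_step:
  fixes A :: "'t set"
  assumes P: "\<And>p. p \<in> P \<Longrightarrow> good n p" and A: "infinite A" "|P| \<le>o |A|"
    and E: "closedin X E" "compact_lt X (cardSuc |A| ) E" and U: "openin X U"
  obtains Q where "\<forall>q\<in>Q. good (Suc n) q" "\<forall>q\<in>Q. \<exists>p\<in>P. fst q \<subseteq> fst p \<inter> U"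
    "descends n P Q" "|Q| \<le>o |A|" "linked n P (U \<inter> E) Q"
proof -
  have "\<exists>zV. fst zV \<in> near n (snd p) \<and> x \<in> snd zV \<and> good (Suc n) (snd zV, fst zV)"
    if px: "p \<in> P" "x \<in> X closure_of fst p" for p x
  proof -
    have xX: "x \<in> topspace X"
      using px(2) by (simp add: in_closure_of)
    obtain z V where "z \<in> near n (snd p)" "x \<in> V" "good (Suc n) (V, z)"
      by (rule refine_node[OF P[OF px(1)] px(2) openin_topspace xX])
    then show ?thesis
      by (intro exI[of _ "(z, V)"]) simp
  qed
  then obtain h where h: "\<And>p x. p \<in> P \<Longrightarrow> x \<in> X closure_of fst p \<Longrightarrow> fst (h p x) \<in> near n (snd p) \<and>
      x \<in> snd (h p x) \<and> good (Suc n) (snd (h p x), fst (h p x))"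
    by metis
  define z where "z p x = fst (h p x)" for p x
  define V where "V p x = snd (h p x)" for p x
  have zV: "z p x \<in> near n (snd p)" "x \<in> V p x" "good (Suc n) (V p x, z p x)"
    if "p \<in> P" "x \<in> X closure_of fst p" for p x
    using h[OF that] by (simp_all add: z_def V_def)
  have "\<exists>S. S \<subseteq> X closure_of fst p \<and> |S| \<le>o |A| \<and> X closure_of fst p \<inter> E \<subseteq> (\<Union>x\<in>S. V p x)"
    if p: "p \<in> P" for p
  proof -
    have c: "compact_lt X (cardSuc |A| ) (X closure_of fst p \<inter> E)"
      by (rule compact_lt_closed_subset[OF E(2) closedin_subset[OF E(1)]
            closedin_Int[OF closedin_closure_of E(1)]]) simp
    have o: "openin X (V p x)" if "x \<in> X closure_of fst p" for x
      using good_open[OF zV(3)[OF p that]] by simp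
    have s: "X closure_of fst p \<inter> E \<subseteq> (\<Union>x\<in>X closure_of fst p. V p x)"
      using zV(2)[OF p] by blast
    obtain S where S: "S \<subseteq> X closure_of fst p" "|S| <o cardSuc |A|"
        "X closure_of fst p \<inter> E \<subseteq> (\<Union>x\<in>S. V p x)"
      by (rule compact_lt_indexed[OF c o s])
    have "|S| \<le>o |A|"
      using S(2) by (simp add: cardSuc_ordLeq_ordLess[OF card_of_Card_order card_of_Card_order])
    with S(1,3) show ?thesis
      by (intro exI[of _ S]) simp
  qed
  then obtain S where S0: "\<And>p. p \<in> P \<Longrightarrow> S p \<subseteq> X closure_of fst p \<and> |S p| \<le>o |A| \<and>
      X closure_of fst p \<inter> E \<subseteq> (\<Union>x\<in>S p. V p x)"
    by metis
  then have S: "\<And>p. p \<in> P \<Longrightarrow> S p \<subseteq> X closure_of fst p" "\<And>p. p \<in> P \<Longrightarrow> |S p| \<le>o |A|"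
      "\<And>p. p \<in> P \<Longrightarrow> X closure_of fst p \<inter> E \<subseteq> (\<Union>x\<in>S p. V p x)"
    by simp_all
  \<comment> \<open>Intersecting with \<open>fst p\<close> and \<open>U\<close> keeps descendants
    inside \<open>E\<close>, where the bound \<open>A\<close> is available.\<close>
  define node where "node p x = (fst p \<inter> V p x \<inter> U, z p x)" for p x
  define Q where "Q = (\<Union>p\<in>P. node p ` S p)"
  have Qcases: "\<exists>p x. p \<in> P \<and> x \<in> X closure_of fst p \<and> q = node p x" if q: "q \<in> Q" for q
    using q S(1) unfolding Q_def by blast
  show thesis
  proof (rule that[of Q])
    show "\<forall>q\<in>Q. good (Suc n) q"
    proof
      fix q assume qQ: "q \<in> Q"
      obtain p x where px: "p \<in> P" "x \<in> X closure_of fst p" "q = node p x"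
        using Qcases[OF qQ] by (elim exE conjE)
      have g: "good (Suc n) (V p x, z p x)"
        by (rule zV(3)[OF px(1,2)])
      have "openin X (fst p \<inter> V p x \<inter> U)"
        using good_open[OF P[OF px(1)]] good_open[OF g] U by (simp add: openin_Int)
      from good_subset[OF g this] show "good (Suc n) q"
        using px(3) by (auto simp: node_def)
    qed
    show "\<forall>q\<in>Q. \<exists>p\<in>P. fst q \<subseteq> fst p \<inter> U"
      unfolding Q_def node_def by auto
    show "descends n P Q"
      unfolding descends_def
    proof
      fix q assume qQ: "q \<in> Q"
      obtain p x where px: "p \<in> P" "x \<in> X closure_of fst p" "q = node p x"
        using Qcases[OF qQ] by (elim exE conjE)
      from zV(1)[OF px(1,2)] px(1,3) show "\<exists>p\<in>P. snd q \<in> near n (snd p)"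
        by (intro bexI[of _ p]) (simp_all add: node_def)
    qed
    have "|node p ` S p| \<le>o |A|" if "p \<in> P" for p
      by (rule ordLeq_transitive[OF card_of_image S(2)[OF that]])
    then show "|Q| \<le>o |A|"
      unfolding Q_def using A by (intro card_of_UNION_ordLeq_infinite) simp_all
    show "linked n P (U \<inter> E) Q"
      unfolding linked_def
    proof (intro ballI)
      fix p x assume p: "p \<in> P" and x: "x \<in> fst p \<inter> (U \<inter> E)"
      have "x \<in> X closure_of fst p"
        using x closure_of_subset[OF openin_subset[OF good_open[OF P[OF p]]]] by blast
      then obtain u where u: "u \<in> S p" "x \<in> V p u"
        using S(3)[OF p] x by blast
      show "\<exists>q\<in>Q. x \<in> fst q \<and> snd q \<in> near n (snd p)"
      proof (intro bexI conjI)
        show "node p u \<in> Q"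
          using p u(1) by (auto simp: Q_def)
        show "x \<in> fst (node p u)"
          using x u(2) by (simp add: node_def)
        show "snd (node p u) \<in> near n (snd p)"
          using zV(1)[OF p subsetD[OF S(1)[OF p] u(1)]] by (simp add: node_def)
      qed
    qed
  qed
qed

text \<open>By local finiteness only finitely many nodes, those in \<open>T x\<close>, have
  \<open>x\<close> in their closure. One neighbourhood \<open>G x\<close> therefore refines all of
  them at once and meets no other node. Each \<open>V x\<close> carries finitely many new nodes,
  which preserves local finiteness and the bound \<open>\<sigma>\<close>.\<close>

lemma core_step:
  fixes \<sigma> :: "'r rel"
  assumes F: "F \<subseteq> topspace X" "locally_finitely_coverable X \<sigma> F" and \<sigma>: "Cinfinite \<sigma>"
    and P: "\<And>p. p \<in> P \<Longrightarrow> good n p" "locally_finite_family X P fst" "F \<subseteq> (\<Union>p\<in>P. fst p)"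
  obtains Q where "\<forall>q\<in>Q. good (Suc n) q" "locally_finite_family X Q fst" "F \<subseteq> (\<Union>q\<in>Q. fst q)"
    "|Q| <o \<sigma>" "descends n P Q" "linked n P (\<Union>q\<in>Q. fst q) Q"
proof -
  define T where "T x = {p \<in> P. x \<in> X closure_of fst p}" for x
  have lfc: "locally_finite_family X P (\<lambda>p. X closure_of fst p)"
    by (rule locally_finite_family_closure_of[OF P(2)])
  have PX: "fst p \<subseteq> X closure_of fst p" if "p \<in> P" for p
    by (rule closure_of_subset[OF openin_subset[OF good_open[OF P(1)[OF that]]]])
  have "\<exists>z G. openin X G \<and> x \<in> G \<and> finite (T x) \<and>
      (\<forall>p\<in>P. fst p \<inter> G \<noteq> {} \<longrightarrow> p \<in> T x) \<and>
      (\<forall>p\<in>T x. z p \<in> near n (snd p) \<and> good (Suc n) (G, z p))"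
    if x: "x \<in> F" for x
  proof -
    have xX: "x \<in> topspace X"
      using x F(1) by blast
    obtain N where N: "openin X N" "x \<in> N" "finite {p \<in> P. X closure_of fst p \<inter> N \<noteq> {}}"
      using lfc xX unfolding locally_finite_family_def by blast
    define J where "J = {p \<in> P. X closure_of fst p \<inter> N \<noteq> {}}"
    have TJ: "T x \<subseteq> J"
      using N(2) by (auto simp: T_def J_def)
    have finJ: "finite J"
      using N(3) by (simp add: J_def)
    have "\<exists>zV. fst zV \<in> near n (snd p) \<and> x \<in> snd zV \<and> good (Suc n) (snd zV, fst zV)"
      if p: "p \<in> T x" for p
    proof -
      have p': "p \<in> P" "x \<in> X closure_of fst p"
        using p by (simp_all add: T_def)
      obtain z V where "z \<in> near n (snd p)" "x \<in> V" "good (Suc n) (V, z)"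
        by (rule refine_node[OF P(1)[OF p'(1)] p'(2) openin_topspace xX])
      then show ?thesis
        by (intro exI[of _ "(z, V)"]) simp
    qed
    then obtain h where h: "\<And>p. p \<in> T x \<Longrightarrow> fst (h p) \<in> near n (snd p) \<and> x \<in> snd (h p) \<and>
        good (Suc n) (snd (h p), fst (h p))"
      by metis
    \<comment> \<open>Nearby nodes whose closure misses \<open>x\<close> are cut away, so that
      \<open>G\<close> meets only nodes in \<open>T x\<close>.\<close>
    define H where "H p = (if p \<in> T x then snd (h p) else topspace X - X closure_of fst p)" for p
    define G where "G = N \<inter> (topspace X \<inter> (\<Inter>p\<in>J. H p))"
    have "openin X (H p)" for p
      using h[of p] good_open[of "Suc n" "(snd (h p), fst (h p))"] by (auto simp: H_def)
    then have "openin X ((\<Inter>p\<in>J. H p) \<inter> topspace X)"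
      by (intro openin_INT finJ)
    then have oG: "openin X G"
      unfolding G_def using N(1) by (simp add: openin_Int Int_commute)
    have "x \<in> H p" if "p \<in> J" for p
      using h[of p] that xX by (auto simp: H_def T_def J_def)
    then have xG: "x \<in> G"
      using N(2) xX by (simp add: G_def)
    have GT: "p \<in> T x" if p: "p \<in> P" "fst p \<inter> G \<noteq> {}" for p
    proof (rule ccontr)
      assume np: "p \<notin> T x"
      have "p \<in> J"
        using p PX[OF p(1)] by (auto simp: J_def G_def)
      then have "G \<subseteq> topspace X - X closure_of fst p"
        using np by (auto simp: G_def H_def)
      with p(2) PX[OF p(1)] show False
        by blast
    qed
    have gG: "good (Suc n) (G, fst (h p))" if p: "p \<in> T x" for p
    proof -
      have "G \<subseteq> snd (h p)"
        using p TJ by (auto simp: G_def H_def)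
      from good_subset[of "Suc n" "(snd (h p), fst (h p))", OF _ oG] this h[OF p] show ?thesis
        by simp
    qed
    show ?thesis
      by (intro exI[of _ "\<lambda>p. fst (h p)"] exI[of _ G])
        (use oG xG GT gG h finite_subset[OF TJ finJ] in auto)
  qed
  then obtain z G where *: "\<And>x. x \<in> F \<Longrightarrow> openin X (G x) \<and> x \<in> G x \<and> finite (T x) \<and>
      (\<forall>p\<in>P. fst p \<inter> G x \<noteq> {} \<longrightarrow> p \<in> T x) \<and>
      (\<forall>p\<in>T x. z x p \<in> near n (snd p) \<and> good (Suc n) (G x, z x p))"
    by metis
  then have G: "\<And>x. x \<in> F \<Longrightarrow> openin X (G x) \<and> x \<in> G x" and finT: "\<And>x. x \<in> F \<Longrightarrow> finite (T x)"
      and GT: "\<And>x p. x \<in> F \<Longrightarrow> p \<in> P \<Longrightarrow> fst p \<inter> G x \<noteq> {} \<Longrightarrow> p \<in> T x"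
      and zG: "\<And>x p. x \<in> F \<Longrightarrow> p \<in> T x \<Longrightarrow> z x p \<in> near n (snd p)"
        "\<And>x p. x \<in> F \<Longrightarrow> p \<in> T x \<Longrightarrow> good (Suc n) (G x, z x p)"
    by simp_all
  obtain K V where V: "K \<subseteq> F" "|K| <o \<sigma>" "locally_finite_family X K V"
      "\<forall>x\<in>K. openin X (V x)" "\<forall>x\<in>K. V x \<subseteq> G x" "F \<subseteq> (\<Union>x\<in>K. V x)"
    by (rule locally_finitely_coverableE[OF F(2) G])
  define Q where "Q = (\<Union>x\<in>K. (\<lambda>p. (V x, z x p)) ` T x)"
  have Qcases: "\<exists>x p. x \<in> K \<and> x \<in> F \<and> p \<in> T x \<and> q = (V x, z x p)" if q: "q \<in> Q" for q
    using q V(1) unfolding Q_def by blast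
  have QI: "(V x, z x p) \<in> Q" if "x \<in> K" "p \<in> T x" for x p
    using that unfolding Q_def by blast
  show thesis
  proof (rule that[of Q])
    show "\<forall>q\<in>Q. good (Suc n) q"
    proof
      fix q assume qQ: "q \<in> Q"
      obtain x p where xp: "x \<in> K" "x \<in> F" "p \<in> T x" "q = (V x, z x p)"
        using Qcases[OF qQ] by (elim exE conjE)
      from good_subset[OF zG(2)[OF xp(2,3)] bspec[OF V(4) xp(1)]] bspec[OF V(5) xp(1)]
      show "good (Suc n) q"
        using xp(4) by simp
    qed
    show "locally_finite_family X Q fst"
      unfolding locally_finite_family_def
    proof
      fix x assume "x \<in> topspace X"
      then obtain N where N: "openin X N" "x \<in> N" "finite {y \<in> K. V y \<inter> N \<noteq> {}}"
        using V(3) unfolding locally_finite_family_def by blast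
      have "finite (\<Union>y\<in>{y \<in> K. V y \<inter> N \<noteq> {}}. (\<lambda>p. (V y, z y p)) ` T y)"
        using N(3) finT V(1) by auto
      moreover have "{q \<in> Q. fst q \<inter> N \<noteq> {}} \<subseteq> (\<Union>y\<in>{y \<in> K. V y \<inter> N \<noteq> {}}. (\<lambda>p. (V y, z y p)) ` T y)"
      proof
        fix q assume q: "q \<in> {q \<in> Q. fst q \<inter> N \<noteq> {}}"
        then have qQ: "q \<in> Q"
          by simp
        obtain y p where yp: "y \<in> K" "y \<in> F" "p \<in> T y" "q = (V y, z y p)"
          using Qcases[OF qQ] by (elim exE conjE)
        have "V y \<inter> N \<noteq> {}"
          using q yp(4) by simp
        then have y: "y \<in> {y \<in> K. V y \<inter> N \<noteq> {}}"
          using yp(1) by simp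
        show "q \<in> (\<Union>y\<in>{y \<in> K. V y \<inter> N \<noteq> {}}. (\<lambda>p. (V y, z y p)) ` T y)"
          by (rule UN_I[OF y], rule image_eqI[OF _ yp(3)], rule yp(4))
      qed
      ultimately have "finite {q \<in> Q. fst q \<inter> N \<noteq> {}}"
        by (rule finite_subset[rotated])
      with N(1,2) show "\<exists>N. openin X N \<and> x \<in> N \<and> finite {q \<in> Q. fst q \<inter> N \<noteq> {}}"
        by (intro exI[of _ N]) simp
    qed
    have cover: "V x \<subseteq> (\<Union>q\<in>Q. fst q)" if x: "x \<in> K" for x
    proof -
      have xF: "x \<in> F"
        using x V(1) by blast
      then obtain p where p: "p \<in> P" "x \<in> fst p"
        using P(3) by blast
      then have "p \<in> T x"
        using subsetD[OF PX[OF p(1)] p(2)] by (simp add: T_def)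
      from UN_upper[OF QI[OF x this], of fst] show ?thesis
        by simp
    qed
    then show "F \<subseteq> (\<Union>q\<in>Q. fst q)"
      using V(6) by blast
    show "|Q| <o \<sigma>"
      unfolding Q_def using finT V(1) by (intro UN_finite_ordLess[OF \<sigma> V(2)]) auto
    show "descends n P Q"
      unfolding descends_def
    proof
      fix q assume qQ: "q \<in> Q"
      obtain x p where xp: "x \<in> K" "x \<in> F" "p \<in> T x" "q = (V x, z x p)"
        using Qcases[OF qQ] by (elim exE conjE)
      show "\<exists>p\<in>P. snd q \<in> near n (snd p)"
        using zG(1)[OF xp(2,3)] xp(3,4) by (intro bexI[of _ p]) (simp_all add: T_def)
    qed
    show "linked n P (\<Union>q\<in>Q. fst q) Q"
      unfolding linked_def
    proof (intro ballI)
      fix p u assume p: "p \<in> P" and u: "u \<in> fst p \<inter> (\<Union>q\<in>Q. fst q)"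
      obtain q where q: "q \<in> Q" "u \<in> fst q"
        using IntD2[OF u] by (elim UN_E)
      obtain x p' where x: "x \<in> K" "x \<in> F" "p' \<in> T x" "q = (V x, z x p')"
        using Qcases[OF q(1)] by (elim exE conjE)
      \<comment> \<open>The node that covers \<open>u\<close> may refine some other
        \<open>p'\<close>. But \<open>u\<close> lies in \<open>G x\<close> and in
        \<open>fst p\<close>, so \<open>p\<close> belongs to \<open>T x\<close> and has its own
        refinement on the same \<open>V x\<close>.\<close>
      have "u \<in> V x"
        using q(2) x(4) by simp
      then have "u \<in> G x"
        using bspec[OF V(5) x(1)] by blast
      then have pT: "p \<in> T x"
        using GT[OF x(2) p] u by blast
      show "\<exists>q\<in>Q. u \<in> fst q \<and> snd q \<in> near n (snd p)"
        using QI[OF x(1) pT] zG(1)[OF x(2) pT] q(2) x(4) by (intro bexI[of _ "(V x, z x p)"]) simp_all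
    qed
  qed
qed


section \<open>Branches, limits of nodes and the assembled selection\<close>

lemma linked_mono:
  assumes "linked n P D Q" "\<And>p. p \<in> P \<Longrightarrow> fst p \<inter> D' \<subseteq> D"
  shows "linked n P D' Q"
  unfolding linked_def
proof (intro ballI)
  fix p x assume p: "p \<in> P" and x: "x \<in> fst p \<inter> D'"
  then have "x \<in> fst p \<inter> D"
    using assms(2)[OF p] by blast
  with assms(1) p show "\<exists>q\<in>Q. x \<in> fst q \<and> snd q \<in> near n (snd p)"
    unfolding linked_def by simp
qed

text \<open>All levels of a branch obey one infinite bound \<open>|T|\<close>, so their countable
  union does too, whatever the cofinality of \<open>\<tau>\<close>. The case \<open>E = {}\<close>
  is separate because a countable \<open>\<tau>\<close> has no infinite set below it.\<close>

lemma branch: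
  fixes \<tau> :: "'t rel"
  assumes P: "\<And>p. p \<in> P \<Longrightarrow> good n p" "|P| <o \<tau>" and \<tau>: "Cinfinite \<tau>"
    and E: "closedin X E"
      "E = {} \<or> (\<exists>A :: 't set. infinite A \<and> |A| <o \<tau> \<and> compact_lt X (cardSuc |A| ) E)"
    and U: "openin X U" "U \<subseteq> E"
  obtains Q where "\<forall>m>n. \<forall>q\<in>Q m. good m q" "descends n P (Q (Suc n))" "linked n P U (Q (Suc n))"
    "\<forall>m>n. descends m (Q m) (Q (Suc m))" "\<forall>m>n. linked m (Q m) UNIV (Q (Suc m))"
    "|\<Union>m. Q m| <o \<tau>"
proof (cases "E = {}")
  case True
  show thesis
  proof (rule that[of "\<lambda>_. {}"])
    show "|\<Union>m::nat. {} :: ('a set \<times> 'b) set| <o \<tau>"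
      by (rule finite_card_of_ordLess[OF \<tau>]) simp
  qed (use True U(2) in \<open>auto simp: linked_def descends_def\<close>)
next
  case False
  then obtain A :: "'t set" where A: "infinite A" "|A| <o \<tau>" "compact_lt X (cardSuc |A| ) E"
    using E(2) by (elim disjE exE conjE) simp
  obtain B :: "'t set" where B: "( |B|, |P| ) \<in> ordIso" "|B| <o \<tau>"
    by (rule ordLess_imp_set[OF card_of_Card_order P(2)])
  define T where "T = A \<union> B"
  have T: "infinite T"
    using A(1) by (simp add: T_def)
  have T\<tau>: "|T| <o \<tau>"
    unfolding T_def by (rule card_of_Un_ordLess[OF \<tau> A(2) B(2)])
  have BT: "|B| \<le>o |T|"
    by (rule card_of_mono1) (simp add: T_def)
  have PT: "|P| \<le>o |T|"
    by (rule ordIso_ordLeq_trans[OF ordIso_symmetric[OF B(1)] BT])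
  have "|A| \<le>o |T|"
    by (rule card_of_mono1) (simp add: T_def)
  from compact_lt_cardSuc_mono[OF A(3) this] have ET: "compact_lt X (cardSuc |T| ) E" .
  obtain Q0 where Q0: "\<forall>q\<in>Q0. good (Suc n) q" "\<forall>q\<in>Q0. \<exists>p\<in>P. fst q \<subseteq> fst p \<inter> U"
      "descends n P Q0" "|Q0| \<le>o |T|" "linked n P (U \<inter> E) Q0"
    by (rule node_step[OF P(1) T PT E(1) ET U(1)])
  \<comment> \<open>Stage \<open>k\<close> is level \<open>Suc n + k\<close>. Keeping the nodes
    inside \<open>E\<close> upgrades the continuation over \<open>E\<close> from
    \<open>node_step\<close> to one over all points; the clause for \<open>k = 0\<close> ties the
    branch to \<open>P\<close>.\<close>
  define inv where "inv k R \<longleftrightarrow> (\<forall>q\<in>R. good (Suc n + k) q) \<and> (\<forall>q\<in>R. fst q \<subseteq> E) \<and> |R| \<le>o |T| \<and>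
      (k = 0 \<longrightarrow> R = Q0)" for k R
  define rel where "rel k R R' \<longleftrightarrow> descends (Suc n + k) R R' \<and> linked (Suc n + k) R UNIV R'" for k R R'
  have "\<exists>R. \<forall>k. inv k (R k) \<and> rel k (R k) (R (Suc k))"
  proof (rule dependent_nat_choice)
    have "\<forall>q\<in>Q0. fst q \<subseteq> E"
      using Q0(2) U(2) by blast
    then show "\<exists>R. inv 0 R"
      unfolding inv_def using Q0(1,4) by (intro exI[of _ Q0]) simp
  next
    fix R k assume R: "inv k R"
    then have g: "\<And>q. q \<in> R \<Longrightarrow> good (Suc n + k) q" and c: "|R| \<le>o |T|"
      and RE: "\<And>q. q \<in> R \<Longrightarrow> fst q \<subseteq> E"
      by (simp_all add: inv_def)
    obtain Q where Q: "\<forall>q\<in>Q. good (Suc (Suc n + k)) q" "\<forall>q\<in>Q. \<exists>p\<in>R. fst q \<subseteq> fst p \<inter> topspace X"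
        "descends (Suc n + k) R Q" "|Q| \<le>o |T|" "linked (Suc n + k) R (topspace X \<inter> E) Q"
      by (rule node_step[OF g T c E(1) ET openin_topspace])
    have "\<forall>q\<in>Q. fst q \<subseteq> E"
      using Q(2) RE by blast
    then have "inv (Suc k) Q"
      using Q(1,4) by (simp add: inv_def)
    moreover have "linked (Suc n + k) R UNIV Q"
    proof (rule linked_mono[OF Q(5)])
      show "fst p \<inter> UNIV \<subseteq> topspace X \<inter> E" if "p \<in> R" for p
        using RE[OF that] closedin_subset[OF E(1)] by auto
    qed
    then have "rel k R Q"
      using Q(3) by (simp add: rel_def)
    ultimately show "\<exists>R'. inv (Suc k) R' \<and> rel k R R'"
      by blast
  qed
  then obtain R where "\<forall>k. inv k (R k) \<and> rel k (R k) (R (Suc k))"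
    by (elim exE)
  then have R: "\<And>k q. q \<in> R k \<Longrightarrow> good (Suc n + k) q" "\<And>k. |R k| \<le>o |T|" "R 0 = Q0"
      "\<And>k. descends (Suc n + k) (R k) (R (Suc k))" "\<And>k. linked (Suc n + k) (R k) UNIV (R (Suc k))"
    by (simp_all add: inv_def rel_def)
  \<comment> \<open>The branch leaves level \<open>n\<close>, so its first nodes have level
    \<open>Suc n\<close>.\<close>
  define Q where "Q m = (if n < m then R (m - Suc n) else {})" for m
  have Qm: "Q m = R (m - Suc n)" "Q (Suc m) = R (Suc (m - Suc n))" "Suc n + (m - Suc n) = m"
    if "n < m" for m
    using that by (simp_all add: Q_def Suc_diff_Suc)
  show thesis
  proof (rule that[of Q])
    show "\<forall>m>n. \<forall>q\<in>Q m. good m q"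
    proof (intro allI impI ballI)
      fix m q assume m: "n < m" and q: "q \<in> Q m"
      show "good m q"
        using R(1)[of q "m - Suc n"] q Qm[OF m] by simp
    qed
    have Q1: "Q (Suc n) = Q0"
      by (simp add: Q_def R(3))
    show "descends n P (Q (Suc n))"
      using Q0(3) by (simp add: Q1)
    have "U \<inter> E = U"
      using U(2) by blast
    then show "linked n P U (Q (Suc n))"
      using Q0(5) by (simp add: Q1)
    show "\<forall>m>n. descends m (Q m) (Q (Suc m))"
    proof (intro allI impI)
      fix m assume m: "n < m"
      show "descends m (Q m) (Q (Suc m))"
        using R(4)[of "m - Suc n"] unfolding Qm[OF m] .
    qed
    show "\<forall>m>n. linked m (Q m) UNIV (Q (Suc m))"
    proof (intro allI impI)
      fix m assume m: "n < m"
      show "linked m (Q m) UNIV (Q (Suc m))"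
        using R(5)[of "m - Suc n"] unfolding Qm[OF m] .
    qed
    have "|Q m| \<le>o |T|" for m
      using R(2) by (simp add: Q_def card_of_empty)
    then have "|\<Union>m. Q m| \<le>o |T|"
      using T infinite_iff_card_of_nat[of T] by (intro card_of_UNION_ordLeq_infinite) simp_all
    then show "|\<Union>m. Q m| <o \<tau>"
      using T\<tau> by (rule ordLeq_ordLess_trans)
  qed
qed

text \<open>A value of \<open>\<phi>\<close> at \<open>x\<close> is a limit of centres of nodes that
  eventually all contain \<open>x\<close>. Goodness and closed values put it into
  \<open>\<theta> x\<close>. Since a sequence may start at any level, every point of a node of level
  \<open>m > 0\<close> has a limit close to that node's centre, which gives lower
  semi-continuity.\<close>

lemma selection_of_nodes:
  assumes N: "\<And>n p. p \<in> N n \<Longrightarrow> good n p" "\<And>n. linked n (N n) UNIV (N (Suc n))"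
    "topspace X \<subseteq> (\<Union>p\<in>N 0. fst p)"
  obtains \<phi> where "sv_selection X mtopology \<theta> \<phi>" "lower_semicontinuous X mtopology \<phi>"
    "\<forall>y\<in>sv_image \<phi> (topspace X). \<exists>m s. (\<forall>i\<ge>m. s i \<in> snd ` N i) \<and> limitin mtopology s y sequentially"
proof -
  define \<phi> where "\<phi> x = {y. \<exists>m s. (\<forall>i\<ge>m. s i \<in> N i \<and> x \<in> fst (s i)) \<and>
      limitin mtopology (\<lambda>i. snd (s i)) y sequentially}" for x
  have nonempty: "topspace X \<noteq> {}"
    using lsc by (simp add: lower_semicontinuous_def set_valued_map_def)
  \<comment> \<open>The distance is the sum of the steps from level \<open>m\<close> on. Level
    \<open>0\<close> is exempt since \<open>near 0\<close> imposes no distance.\<close>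
  have continue: "\<exists>y\<in>\<phi> x. 0 < m \<longrightarrow> d (snd p) y \<le> 2 * (1 / 2 ^ m)" if p: "p \<in> N m" "x \<in> fst p" for p m x
  proof -
    have "\<exists>f. \<forall>k. (f k \<in> N (m + k) \<and> x \<in> fst (f k) \<and> (k = 0 \<longrightarrow> f k = p)) \<and>
        snd (f (Suc k)) \<in> near (m + k) (snd (f k))"
    proof (rule dependent_nat_choice)
      show "\<exists>q. q \<in> N (m + 0) \<and> x \<in> fst q \<and> ((0::nat) = 0 \<longrightarrow> q = p)"
        using p by (intro exI[of _ p]) simp
    next
      fix q k assume q: "q \<in> N (m + k) \<and> x \<in> fst q \<and> (k = 0 \<longrightarrow> q = p)"
      obtain r where "r \<in> N (Suc (m + k))" "x \<in> fst r" "snd r \<in> near (m + k) (snd q)"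
        by (rule linkedE[OF N(2)[of "m + k"] conjunct1[OF q] conjunct1[OF conjunct2[OF q]] UNIV_I])
      then show "\<exists>r. (r \<in> N (m + Suc k) \<and> x \<in> fst r \<and> (Suc k = 0 \<longrightarrow> r = p)) \<and>
          snd r \<in> near (m + k) (snd q)"
        by (intro exI[of _ r]) simp
    qed
    then obtain f where "\<forall>k. (f k \<in> N (m + k) \<and> x \<in> fst (f k) \<and> (k = 0 \<longrightarrow> f k = p)) \<and>
        snd (f (Suc k)) \<in> near (m + k) (snd (f k))"
      by (elim exE)
    then have f: "\<And>k. f k \<in> N (m + k)" "\<And>k. x \<in> fst (f k)" "f 0 = p"
        "\<And>k. snd (f (Suc k)) \<in> near (m + k) (snd (f k))"
      by simp_all
    have M: "snd (f k) \<in> M" for k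
      by (rule good_snd[OF N(1)[OF f(1)]])
    have dist: "d (snd (f k)) (snd (f (Suc k))) < 1 / 2 ^ m / 2 ^ k" if "0 < m + k" for k
      using f(4)[of k] that by (auto simp: near_def power_add split: if_splits)
    have lim: "\<exists>y. limitin mtopology (\<lambda>k. snd (f k)) y sequentially \<and> (0 < m \<longrightarrow> d (snd p) y \<le> 2 * (1 / 2 ^ m))"
    proof (cases "m = 0")
      case True
      \<comment> \<open>The first step out of level \<open>0\<close> can be arbitrarily long, so the
        geometric estimate starts one level later; the limit is unaffected.\<close>
      have *: "d (snd (f (Suc k))) (snd (f (Suc (Suc k)))) < 1 / 2 / 2 ^ k" for k
        using dist[of "Suc k"] True by (simp add: power_add)
      obtain y where "limitin mtopology (\<lambda>k. snd (f (Suc k))) y sequentially"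
          "d (snd (f (Suc 0))) y \<le> 2 * (1 / 2)"
        by (rule geometric_limit[OF complete M *])
      then have "limitin mtopology (\<lambda>k. snd (f k)) y sequentially"
        using limitin_sequentially_offset_rev[of mtopology "\<lambda>k. snd (f k)" 1 y] by simp
      with True show ?thesis
        by blast
    next
      case False
      then have *: "d (snd (f k)) (snd (f (Suc k))) < 1 / 2 ^ m / 2 ^ k" for k
        using dist by simp
      obtain y where "limitin mtopology (\<lambda>k. snd (f k)) y sequentially" "d (snd (f 0)) y \<le> 2 * (1 / 2 ^ m)"
        by (rule geometric_limit[OF complete M *])
      then show ?thesis
        using f(3) by auto
    qed
    then obtain y where y: "limitin mtopology (\<lambda>k. snd (f k)) y sequentially"
        "0 < m \<longrightarrow> d (snd p) y \<le> 2 * (1 / 2 ^ m)"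
      by blast
    have "limitin mtopology (\<lambda>i. snd (f (i - m))) y sequentially"
      using limitin_sequentially_offset_rev[of mtopology "\<lambda>i. snd (f (i - m))" m y] y(1) by simp
    moreover have "\<forall>i\<ge>m. f (i - m) \<in> N i \<and> x \<in> fst (f (i - m))"
    proof (intro allI impI)
      fix i assume "m \<le> i"
      then show "f (i - m) \<in> N i \<and> x \<in> fst (f (i - m))"
        using f(1,2)[of "i - m"] by simp
    qed
    ultimately have "y \<in> \<phi> x"
      unfolding \<phi>_def by (intro CollectI exI[of _ m] exI[of _ "\<lambda>i. f (i - m)"]) simp
    with y(2) show ?thesis
      by blast
  qed
  have \<phi>E: "\<exists>m s. (\<forall>i\<ge>m. s i \<in> N i \<and> x \<in> fst (s i)) \<and> limitin mtopology (\<lambda>i. snd (s i)) y sequentially"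
    if "y \<in> \<phi> x" for x y
    using that by (simp add: \<phi>_def)
  have sub: "\<phi> x \<subseteq> \<theta> x" if x: "x \<in> topspace X" for x
  proof
    fix y assume y: "y \<in> \<phi> x"
    obtain m s where s: "\<forall>i\<ge>m. s i \<in> N i \<and> x \<in> fst (s i)" "limitin mtopology (\<lambda>i. snd (s i)) y sequentially"
      using \<phi>E[OF y] by (elim exE conjE)
    have yM: "y \<in> M"
      by (rule limitin_mspace[OF s(2)])
    have "\<forall>r>0. \<exists>z\<in>\<theta> x. z \<in> mball y r"
    proof (intro allI impI)
      fix r :: real assume r: "0 < r"
      obtain n1 where n1: "\<forall>n\<ge>n1. snd (s n) \<in> M \<and> d (snd (s n)) y < r / 2"
        using conjunct2[OF s(2)[unfolded limit_metric_sequentially], rule_format, OF half_gt_zero[OF r]]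
        by (elim exE)
      obtain n2 where n2: "(1 / 2) ^ n2 < r / 2"
        using real_arch_pow_inv[of "r / 2" "1 / 2"] r by auto
      define i where "i = Suc (m + n1 + n2)"
      have "(1 / 2 :: real) ^ i \<le> (1 / 2) ^ n2"
        by (rule power_decreasing) (simp_all add: i_def)
      then have i2: "1 / 2 ^ i < r / 2"
        using n2 by (simp add: power_divide)
      have si: "s i \<in> N i" "x \<in> fst (s i)"
        using s(1) by (simp_all add: i_def)
      have "x \<in> X closure_of fst (s i)"
        using si closure_of_subset[OF openin_subset[OF good_open[OF N(1)[OF si(1)]]]] by blast
      then obtain z where z: "z \<in> \<theta> x" "z \<in> near i (snd (s i))"
        using good_near[OF N(1)[OF si(1)]] by blast
      then have z': "z \<in> M" "snd (s i) \<in> M" "d (snd (s i)) z < 1 / 2 ^ i"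
        by (simp_all add: near_def i_def)
      have "d (snd (s i)) y < r / 2"
        using n1 by (simp add: i_def)
      then have "d y z < r"
        using triangle[OF yM z'(2,1)] z'(3) i2 commute[of y "snd (s i)"] by linarith
      with z(1) z'(1) yM show "\<exists>z\<in>\<theta> x. z \<in> mball y r"
        by (intro bexI[of _ z]) simp_all
    qed
    then have "y \<in> mtopology closure_of (\<theta> x)"
      using yM by (simp add: metric_closure_of)
    moreover have "closedin mtopology (\<theta> x)"
      using closed_values x by (simp add: closed_valued_def)
    ultimately show "y \<in> \<theta> x"
      by (simp add: closure_of_closedin)
  qed
  have ne: "\<phi> x \<noteq> {}" if x: "x \<in> topspace X" for x
  proof -
    obtain p where "p \<in> N 0" "x \<in> fst p"
      using subsetD[OF N(3) x] by (elim UN_E)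
    from continue[OF this] show ?thesis
      by blast
  qed
  have sv: "set_valued_map X mtopology \<phi>"
    unfolding set_valued_map_def using nonempty ne sub value_subset by fastforce
  show thesis
  proof (rule that[of \<phi>])
    show "sv_selection X mtopology \<theta> \<phi>"
      using sv sub by (simp add: sv_selection_def)
    show "lower_semicontinuous X mtopology \<phi>"
      unfolding lower_semicontinuous_def
    proof (intro conjI allI impI sv)
      fix H assume H: "openin mtopology H"
      show "openin X (sv_vimage X \<phi> H)"
      proof (subst openin_subopen, intro ballI)
        fix x assume "x \<in> sv_vimage X \<phi> H"
        then obtain y where y: "x \<in> topspace X" "y \<in> \<phi> x" "y \<in> H"
          by (auto simp: sv_vimage_def)
        obtain m s where s: "\<forall>i\<ge>m. s i \<in> N i \<and> x \<in> fst (s i)" "limitin mtopology (\<lambda>i. snd (s i)) y sequentially"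
          using \<phi>E[OF y(2)] by (elim exE conjE)
        have yM: "y \<in> M"
          by (rule limitin_mspace[OF s(2)])
        obtain r where r: "0 < r" "mball y r \<subseteq> H"
          using H y(3) unfolding openin_mtopology by blast
        obtain n1 where n1: "\<forall>n\<ge>n1. snd (s n) \<in> M \<and> d (snd (s n)) y < r / 2"
          using conjunct2[OF s(2)[unfolded limit_metric_sequentially], rule_format, OF half_gt_zero[OF r(1)]]
          by (elim exE)
        \<comment> \<open>The limit obtained at a neighbouring point may be \<open>2 / 2 ^ i\<close>
          away from the centre of \<open>s i\<close>; with \<open>r / 4\<close> this is below
          \<open>r / 2\<close>.\<close>
        obtain n2 where n2: "(1 / 2) ^ n2 < r / 4"
          using real_arch_pow_inv[of "r / 4" "1 / 2"] r(1) by auto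
        define i where "i = Suc (m + n1 + n2)"
        have "(1 / 2 :: real) ^ i \<le> (1 / 2) ^ n2"
          by (rule power_decreasing) (simp_all add: i_def)
        then have i2: "1 / 2 ^ i < r / 4"
          using n2 by (simp add: power_divide)
        have si: "s i \<in> N i" "x \<in> fst (s i)"
          using s(1) by (simp_all add: i_def)
        have op: "openin X (fst (s i))"
          by (rule good_open[OF N(1)[OF si(1)]])
        have "fst (s i) \<subseteq> sv_vimage X \<phi> H"
        proof
          fix u assume u: "u \<in> fst (s i)"
          have uX: "u \<in> topspace X"
            using openin_subset[OF op] u by blast
          obtain z where z: "z \<in> \<phi> u" "0 < i \<longrightarrow> d (snd (s i)) z \<le> 2 * (1 / 2 ^ i)"
            using continue[OF si(1) u] by blast
          have zM: "z \<in> M"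
            using z(1) sub[OF uX] value_subset[OF uX] by blast
          have a: "snd (s i) \<in> M" "d (snd (s i)) y < r / 2"
            using n1 by (simp_all add: i_def)
          have "d (snd (s i)) z < r / 2"
            using z(2) i2 by (simp add: i_def)
          then have "d y z < r"
            using triangle[OF yM a(1) zM] a(2) commute[of y "snd (s i)"] by linarith
          then have "z \<in> H"
            using r(2) yM zM by auto
          with z(1) uX show "u \<in> sv_vimage X \<phi> H"
            by (auto simp: sv_vimage_def)
        qed
        with op si(2) show "\<exists>T. openin X T \<and> x \<in> T \<and> T \<subseteq> sv_vimage X \<phi> H"
          by blast
      qed
    qed
    show "\<forall>y\<in>sv_image \<phi> (topspace X). \<exists>m s. (\<forall>i\<ge>m. s i \<in> snd ` N i) \<and> limitin mtopology s y sequentially"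
    proof
      fix y assume "y \<in> sv_image \<phi> (topspace X)"
      then obtain x where x: "y \<in> \<phi> x"
        by (auto simp: sv_image_def)
      obtain m s where s: "\<forall>i\<ge>m. s i \<in> N i \<and> x \<in> fst (s i)" "limitin mtopology (\<lambda>i. snd (s i)) y sequentially"
        using \<phi>E[OF x] by (elim exE conjE)
      then show "\<exists>m s. (\<forall>i\<ge>m. s i \<in> snd ` N i) \<and> limitin mtopology s y sequentially"
        by (intro exI[of _ m] exI[of _ "\<lambda>i. snd (s i)"]) simp
    qed
  qed
qed


text \<open>\<open>P n\<close> are the levels over \<open>F\<close> and \<open>Q n\<close> is the
  branch that takes up the points of \<open>P n\<close> missed by \<open>P (Suc n)\<close>. Branches
  leaving before level \<open>n\<close> are collected in \<open>L n\<close>. Every other node of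
  level at least \<open>n\<close> descends from \<open>P n\<close>, and the steps
  \<open>1 / 2 ^ i\<close> from \<open>n\<close> on sum to \<open>2 / 2 ^ n\<close>.\<close>

lemma selection_near_nodes:
  fixes \<sigma> :: "'r rel" and \<tau> :: "'t rel"
  assumes F: "F \<subseteq> topspace X" "locally_finitely_coverable X \<sigma> F"
    and \<sigma>: "Cinfinite \<sigma>" "\<sigma> \<le>o \<tau>" and \<tau>: "Cinfinite \<tau>"
    and small: "\<And>C. closedin X C \<Longrightarrow> C \<subseteq> topspace X - F \<Longrightarrow>
      C = {} \<or> (\<exists>A :: 't set. infinite A \<and> |A| <o \<tau> \<and> compact_lt X (cardSuc |A| ) C)"
  obtains \<phi> S L where "sv_selection X mtopology \<theta> \<phi>" "lower_semicontinuous X mtopology \<phi>"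
    "\<forall>n::nat. |S n :: 'b set| <o \<sigma>" "\<forall>n. |L n :: 'b set| <o \<tau>"
    "\<forall>n>0. sv_image \<phi> (topspace X) \<subseteq> mtopology closure_of (L n \<union> (\<Union>y\<in>S n. mball y (2 / 2 ^ n)))"
proof -
  have "topspace X \<noteq> {}"
    using lsc by (simp add: lower_semicontinuous_def set_valued_map_def)
  then obtain y0 where y0: "y0 \<in> M"
    using value_nonempty value_subset by blast
  define P0 where "P0 = {(topspace X, y0)}"
  \<comment> \<open>Only level \<open>0\<close> has to cover all of \<open>X\<close>, since
    \<open>linked\<close> continues every node at each of its points; hence \<open>P 0\<close> is
    fixed to be \<open>P0\<close>.\<close>
  define inv where "inv n P \<longleftrightarrow> (\<forall>p\<in>P. good n p) \<and> locally_finite_family X P fst \<and>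
      F \<subseteq> (\<Union>p\<in>P. fst p) \<and> |P| <o \<sigma> \<and> (n = 0 \<longrightarrow> P = P0)" for n P
  define rel where "rel n P Q \<longleftrightarrow> descends n P Q \<and> linked n P (\<Union>q\<in>Q. fst q) Q" for n P Q
  have "\<exists>P. \<forall>n. inv n (P n) \<and> rel n (P n) (P (Suc n))"
  proof (rule dependent_nat_choice)
    have "good 0 (topspace X, y0)"
      using y0 value_nonempty value_subset by (fastforce simp: good_def near_def)
    moreover have "locally_finite_family X P0 fst"
      unfolding locally_finite_family_def P0_def using openin_topspace[of X] by auto
    moreover have "|P0| <o \<sigma>"
      unfolding P0_def by (rule finite_card_of_ordLess[OF \<sigma>(1)]) simp
    ultimately show "\<exists>P. inv 0 P"
      unfolding inv_def using F(1) by (intro exI[of _ P0]) (simp add: P0_def)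
  next
    fix P n assume P: "inv n P"
    then have "\<And>p. p \<in> P \<Longrightarrow> good n p" "locally_finite_family X P fst" "F \<subseteq> (\<Union>p\<in>P. fst p)"
      by (simp_all add: inv_def)
    from core_step[OF F \<sigma>(1) this]
    obtain Q where Q: "\<forall>q\<in>Q. good (Suc n) q" "locally_finite_family X Q fst" "F \<subseteq> (\<Union>q\<in>Q. fst q)"
        "|Q| <o \<sigma>" "descends n P Q" "linked n P (\<Union>q\<in>Q. fst q) Q"
      by metis
    then show "\<exists>Q. inv (Suc n) Q \<and> rel n P Q"
      by (intro exI[of _ Q]) (simp add: inv_def rel_def)
  qed
  then obtain P where "\<forall>n. inv n (P n) \<and> rel n (P n) (P (Suc n))"
    by (elim exE)
  then have P: "\<And>n p. p \<in> P n \<Longrightarrow> good n p" "\<And>n. F \<subseteq> (\<Union>p\<in>P n. fst p)" "\<And>n. |P n| <o \<sigma>"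
      "P 0 = P0" "\<And>n. descends n (P n) (P (Suc n))"
      "\<And>n. linked n (P n) (\<Union>q\<in>P (Suc n). fst q) (P (Suc n))"
    by (simp_all add: inv_def rel_def)
  define H where "H n = (\<Union>q\<in>P n. fst q)" for n
  define B where "B n Q \<longleftrightarrow> (\<forall>m>n. \<forall>q\<in>Q m. good m q) \<and> descends n (P n) (Q (Suc n)) \<and>
      linked n (P n) (topspace X - H (Suc n)) (Q (Suc n)) \<and>
      (\<forall>m>n. descends m (Q m) (Q (Suc m))) \<and> (\<forall>m>n. linked m (Q m) UNIV (Q (Suc m))) \<and>
      |\<Union>m. Q m| <o \<tau>" for n Q
  have "\<exists>Q. B n Q" for n
  proof -
    have Hop: "openin X (H (Suc n))"
      unfolding H_def using good_open[OF P(1)] by blast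
    have FH: "F \<subseteq> H (Suc n)"
      unfolding H_def by (rule P(2))
    \<comment> \<open>Two sets come from \<open>W\<close>: its complement is closed and misses
      \<open>F\<close>, so it has a small bound, while the complement of its closure is open and
      contains every point missed by level \<open>Suc n\<close>.\<close>
    obtain W where W: "openin X W" "F \<subseteq> W" "X closure_of W \<subseteq> H (Suc n)"
      by (rule locally_finitely_coverable_nbhd[OF regular F(2) Hop FH])
    have E: "closedin X (topspace X - W)"
      using W(1) by blast
    have "topspace X - W \<subseteq> topspace X - F"
      using W(2) by blast
    note E' = small[OF E this]
    have U: "openin X (topspace X - X closure_of W)"
      using closedin_closure_of[of X W] by blast
    have UE: "topspace X - X closure_of W \<subseteq> topspace X - W"
      using closure_of_subset[OF openin_subset[OF W(1)]] by blast
    have Pn: "|P n| <o \<tau>"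
      by (rule ordLess_ordLeq_trans[OF P(3) \<sigma>(2)])
    obtain Q where Q: "\<forall>m>n. \<forall>q\<in>Q m. good m q" "descends n (P n) (Q (Suc n))"
        "linked n (P n) (topspace X - X closure_of W) (Q (Suc n))"
        "\<forall>m>n. descends m (Q m) (Q (Suc m))" "\<forall>m>n. linked m (Q m) UNIV (Q (Suc m))"
        "|\<Union>m. Q m| <o \<tau>"
      by (rule branch[OF P(1) Pn \<tau> E E' U UE])
    have "linked n (P n) (topspace X - H (Suc n)) (Q (Suc n))"
      by (rule linked_mono[OF Q(3)]) (use W(3) in blast)
    with Q show ?thesis
      unfolding B_def by (intro exI[of _ Q]) simp
  qed
  then obtain Q where "\<And>n. B n (Q n)"
    by metis
  then have Q: "\<And>n m q. n < m \<Longrightarrow> q \<in> Q n m \<Longrightarrow> good m q" "\<And>n. descends n (P n) (Q n (Suc n))"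
      "\<And>n. linked n (P n) (topspace X - H (Suc n)) (Q n (Suc n))"
      "\<And>n m. n < m \<Longrightarrow> descends m (Q n m) (Q n (Suc m))"
      "\<And>n m. n < m \<Longrightarrow> linked m (Q n m) UNIV (Q n (Suc m))"
      "\<And>n. |\<Union>m. Q n m| <o \<tau>"
    by (simp_all add: B_def)
  \<comment> \<open>A branch leaving level \<open>n\<close> is present from level
    \<open>Suc n\<close> on, whence the strict bound on \<open>n\<close>.\<close>
  define N where "N m = P m \<union> (\<Union>n\<in>{..<m}. Q n m)" for m
  have good_N: "good m p" if "p \<in> N m" for m p
  proof -
    consider "p \<in> P m" | n where "n < m" "p \<in> Q n m"
      using \<open>p \<in> N m\<close> by (auto simp: N_def)
    then show ?thesis
      by cases (rule P(1), simp, rule Q(1))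
  qed
  have linked_N: "linked m (N m) UNIV (N (Suc m))" for m
    unfolding linked_def
  proof (intro ballI)
    fix p x assume p: "p \<in> N m" and "x \<in> fst p \<inter> UNIV"
    then have x: "x \<in> fst p"
      by simp
    have xX: "x \<in> topspace X"
      using openin_subset[OF good_open[OF good_N[OF p]]] x by blast
    show "\<exists>q\<in>N (Suc m). x \<in> fst q \<and> snd q \<in> near m (snd p)"
    proof (cases "p \<in> P m")
      case True
      show ?thesis
      proof (cases "x \<in> H (Suc m)")
        case xH: True
        obtain q where "q \<in> P (Suc m)" "x \<in> fst q" "snd q \<in> near m (snd p)"
          by (rule linkedE[OF P(6) True x xH[unfolded H_def]])
        then show ?thesis
          by (intro bexI[of _ q]) (simp_all add: N_def)
      next
        case False
        then have xH: "x \<in> topspace X - H (Suc m)"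
          using xX by simp
        obtain q where "q \<in> Q m (Suc m)" "x \<in> fst q" "snd q \<in> near m (snd p)"
          by (rule linkedE[OF Q(3) True x xH])
        then show ?thesis
          by (intro bexI[of _ q]) (auto simp: N_def)
      qed
    next
      case False
      then obtain n where n: "n < m" "p \<in> Q n m"
        using p by (auto simp: N_def)
      obtain q where "q \<in> Q n (Suc m)" "x \<in> fst q" "snd q \<in> near m (snd p)"
        by (rule linkedE[OF Q(5)[OF n(1)] n(2) x UNIV_I])
      moreover have "n < Suc m"
        using n(1) by simp
      ultimately show ?thesis
        by (intro bexI[of _ q]) (auto simp: N_def)
    qed
  qed
  have N0: "topspace X \<subseteq> (\<Union>p\<in>N 0. fst p)"
    by (simp add: N_def P(4) P0_def)
  obtain \<phi> where \<phi>: "sv_selection X mtopology \<theta> \<phi>" "lower_semicontinuous X mtopology \<phi>"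
      "\<forall>y\<in>sv_image \<phi> (topspace X). \<exists>m s. (\<forall>i\<ge>m. s i \<in> snd ` N i) \<and> limitin mtopology s y sequentially"
    by (rule selection_of_nodes[OF good_N linked_N N0])
  define S where "S n = snd ` P n" for n
  define L where "L n = (\<Union>j\<in>{..<n}. snd ` (\<Union>m. Q j m))" for n
  have dist_near: "d a b < 1 / 2 ^ n" "a \<in> M" "b \<in> M" if "b \<in> near n a" "0 < n" for a b n
    using that by (simp_all add: near_def)
  \<comment> \<open>Going back through parents, a branch \<open>j \<ge> n\<close> rejoins the core
    at level \<open>j\<close>, so one ends in \<open>P n\<close>. The bound is again an exact
    geometric sum, and \<open>n > 0\<close> avoids the unbounded step out of level
    \<open>0\<close>.\<close>
  have ancestor: "\<exists>p\<in>P n. d (snd p) (snd q) \<le> 2 / 2 ^ n - 2 / 2 ^ m"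
    if n: "0 < n" "n \<le> m" and q: "q \<in> P m \<union> (\<Union>j\<in>{n..<m}. Q j m)" for n m q
    using n(2) q
  proof (induction m arbitrary: q rule: dec_induct)
    case base
    then have "q \<in> P n"
      by simp
    moreover from this have "snd q \<in> M"
      by (rule good_snd[OF P(1)])
    ultimately show ?case
      by (intro bexI[of _ q]) simp_all
  next
    case (step m)
    have "\<exists>r\<in>P m \<union> (\<Union>j\<in>{n..<m}. Q j m). snd q \<in> near m (snd r)"
    proof (cases "q \<in> P (Suc m)")
      case True
      obtain r where "r \<in> P m" "snd q \<in> near m (snd r)"
        using bspec[OF P(5)[of m, unfolded descends_def] True] by (elim bexE)
      then show ?thesis
        by (intro bexI[of _ r]) simp_all
    next
      case False
      then obtain j where j: "n \<le> j" "j < Suc m" "q \<in> Q j (Suc m)"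
        using step.prems by auto
      show ?thesis
      proof (cases "j = m")
        case True
        then have "q \<in> Q m (Suc m)"
          using j(3) by simp
        from bspec[OF Q(2)[of m, unfolded descends_def] this]
        obtain r where "r \<in> P m" "snd q \<in> near m (snd r)"
          by (elim bexE)
        then show ?thesis
          by (intro bexI[of _ r]) simp_all
      next
        case False
        then have jm: "j < m"
          using j(2) by simp
        obtain r where r: "r \<in> Q j m" "snd q \<in> near m (snd r)"
          using bspec[OF Q(4)[OF jm, unfolded descends_def] j(3)] by (elim bexE)
        have "r \<in> P m \<union> (\<Union>j\<in>{n..<m}. Q j m)"
          using j(1) jm r(1) by auto
        with r(2) show ?thesis ..
      qed
    qed
    then obtain r where r: "r \<in> P m \<union> (\<Union>j\<in>{n..<m}. Q j m)" "snd q \<in> near m (snd r)"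
      by (elim bexE)
    have m0: "0 < m"
      using n(1) step.hyps by simp
    obtain p where p: "p \<in> P n" "d (snd p) (snd r) \<le> 2 / 2 ^ n - 2 / 2 ^ m"
      using step.IH[OF r(1)] by (elim bexE)
    have "d (snd p) (snd q) \<le> d (snd p) (snd r) + d (snd r) (snd q)"
      using dist_near(2,3)[OF r(2) m0] good_snd[OF P(1)[OF p(1)]] by (intro triangle)
    also have "\<dots> \<le> 2 / 2 ^ n - 2 / 2 ^ m + 1 / 2 ^ m"
      using p(2) dist_near(1)[OF r(2) m0] by simp
    also have "\<dots> = 2 / 2 ^ n - 2 / 2 ^ Suc m"
      by (simp add: field_simps)
    finally show ?case
      using p(1) by (intro bexI[of _ p])
  qed
  show thesis
  proof (rule that[OF \<phi>(1,2)])
    show "\<forall>n. |S n| <o \<sigma>"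
      unfolding S_def by (intro allI) (rule image_ordLess[OF P(3)])
    show "\<forall>n. |L n| <o \<tau>"
      unfolding L_def
      by (intro allI finite_UN_ordLess[OF \<tau>] finite_lessThan) (rule image_ordLess[OF Q(6)])
    show "\<forall>n>0. sv_image \<phi> (topspace X) \<subseteq> mtopology closure_of (L n \<union> (\<Union>y\<in>S n. mball y (2 / 2 ^ n)))"
    proof (intro allI impI subsetI)
      fix n :: nat and y assume n: "0 < n" and y: "y \<in> sv_image \<phi> (topspace X)"
      obtain m s where s: "\<forall>i\<ge>m. s i \<in> snd ` N i" "limitin mtopology s y sequentially"
        using bspec[OF \<phi>(3) y] by (elim exE conjE)
      let ?Z = "L n \<union> (\<Union>y\<in>S n. mball y (2 / 2 ^ n))"
      have in_Z: "s i \<in> ?Z" if i: "m \<le> i" "n \<le> i" for i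
      proof -
        obtain q where q: "q \<in> N i" "s i = snd q"
          using s(1) i(1) by blast
        show ?thesis
        proof (cases "\<exists>j<n. q \<in> Q j i")
          case True
          then have "s i \<in> L n"
            using q(2) by (auto simp: L_def)
          then show ?thesis ..
        next
          case False
          have "q \<in> P i \<or> (\<exists>j<i. q \<in> Q j i)"
            using q(1) by (auto simp: N_def)
          then have "q \<in> P i \<union> (\<Union>j\<in>{n..<i}. Q j i)"
          proof (elim disjE exE conjE)
            fix j assume j: "j < i" "q \<in> Q j i"
            then have "n \<le> j"
              using False not_less by blast
            then have "j \<in> {n..<i}"
              using j(1) by simp
            then show ?thesis
              using j(2) by (intro UnI2 UN_I)
          qed simp
          from ancestor[OF n i(2) this] obtain p where p: "p \<in> P n" "d (snd p) (snd q) \<le> 2 / 2 ^ n - 2 / 2 ^ i"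
            by (elim bexE)
          have "0 < (2 :: real) / 2 ^ i"
            by simp
          then have "d (snd p) (snd q) < 2 / 2 ^ n"
            using p(2) by linarith
          then have "s i \<in> mball (snd p) (2 / 2 ^ n)"
            using good_snd[OF P(1)[OF p(1)]] good_snd[OF good_N[OF q(1)]] q(2) by simp
          moreover have "snd p \<in> S n"
            using p(1) by (simp add: S_def)
          ultimately show ?thesis
            by (intro UnI2 UN_I)
        qed
      qed
      have yM: "y \<in> M"
        by (rule limitin_mspace[OF s(2)])
      have "\<forall>r>0. \<exists>z\<in>?Z. z \<in> mball y r"
      proof (intro allI impI)
        fix r :: real assume r: "0 < r"
        obtain k where k: "\<forall>i\<ge>k. s i \<in> M \<and> d (s i) y < r"
          using conjunct2[OF s(2)[unfolded limit_metric_sequentially], rule_format, OF r] by (elim exE)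
        have "s (m + n + k) \<in> ?Z"
          by (rule in_Z) simp_all
        moreover have "s (m + n + k) \<in> mball y r"
          using k yM by (simp add: commute)
        ultimately show "\<exists>z\<in>?Z. z \<in> mball y r" ..
      qed
      then show "y \<in> mtopology closure_of ?Z"
        using yM unfolding metric_closure_of by simp
    qed
  qed
qed

text \<open>If \<open>\<tau>\<close> is not sequential, all nodes together number less than \<open>\<tau>\<close>. If it is, the nodes over
  the core are finite in number on each level, which gives generalized total boundedness.\<close>

lemma small_selection:
  fixes \<tau> :: "'t rel"
  assumes t1: "t1_space X" and F: "F \<subseteq> topspace X" "locally_finitely_coverable X \<tau> F"
    and \<tau>: "Cinfinite \<tau>" and X: "compact_lt X \<tau> (topspace X)"
    and small: "\<And>C. closedin X C \<Longrightarrow> C \<subseteq> topspace X - F \<Longrightarrow>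
      \<exists>A :: 't set. |A| <o \<tau> \<and> compact_lt X (cardSuc |A| ) C"
  obtains \<phi> where "sv_selection X mtopology \<theta> \<phi>" "lower_semicontinuous X mtopology \<phi>"
    "compact_lt mtopology \<tau> (mtopology closure_of sv_image \<phi> (topspace X))"
    "\<not> sequential_cardinal \<tau> \<longrightarrow> weight (subtopology mtopology (sv_image \<phi> (topspace X))) <o \<tau>"
proof -
  \<comment> \<open>Branching requires infinite bounds; for uncountable \<open>\<tau>\<close> a
    countably infinite set can be added to any bound.\<close>
  have infinite_bound: "\<exists>A :: 't set. infinite A \<and> |A| <o \<tau> \<and> compact_lt X (cardSuc |A| ) C"
    if unc: "natLeq <o \<tau>" and C: "\<exists>A :: 't set. |A| <o \<tau> \<and> compact_lt X (cardSuc |A| ) C" for C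
  proof -
    obtain A :: "'t set" where A: "|A| <o \<tau>" "compact_lt X (cardSuc |A| ) C"
      using C by (elim exE conjE)
    obtain B :: "'t set" where B: "infinite B" "|B| <o \<tau>" "( |B|, natLeq) \<in> ordIso"
      by (rule uncountable_infinite_set[OF unc])
    have "|A| \<le>o |A \<union> B|"
      by (rule card_of_mono1) simp
    from compact_lt_cardSuc_mono[OF A(2) this] card_of_Un_ordLess[OF \<tau> A(1) B(2)] B(1)
    show ?thesis
      by (intro exI[of _ "A \<union> B"]) simp
  qed
  have pow_less: "\<exists>n>0. 2 / 2 ^ n < \<epsilon>" if \<epsilon>: "0 < \<epsilon>" for \<epsilon> :: real
  proof -
    obtain n where n: "(1 / 2) ^ n < \<epsilon>"
      using real_arch_pow_inv[OF \<epsilon>, of "1 / 2"] by auto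
    then have "2 / 2 ^ Suc n < \<epsilon>"
      by (simp add: power_divide)
    then show ?thesis
      by blast
  qed
  show thesis
  proof (cases "sequential_cardinal \<tau>")
    case True
    have "\<exists>K. K \<subseteq> topspace X \<and> locally_finitely_coverable X natLeq K \<and>
        (\<forall>C. closedin X C \<longrightarrow> C \<subseteq> topspace X - K \<longrightarrow>
          C = {} \<or> (\<exists>A :: 't set. infinite A \<and> |A| <o \<tau> \<and> compact_lt X (cardSuc |A| ) C))"
    proof (cases "natLeq <o \<tau>")
      case unc: True
      obtain K where K: "K \<subseteq> topspace X" "locally_finitely_coverable X natLeq K"
          "\<forall>C. closedin X C \<longrightarrow> C \<subseteq> topspace X - K \<longrightarrow>
            (\<exists>A :: 't set. |A| <o \<tau> \<and> compact_lt X (cardSuc |A| ) C)"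
        by (rule sequential_core[OF regular t1 X \<tau> True unc F small])
      show ?thesis
        using K infinite_bound[OF unc] by (intro exI[of _ K]) simp
    next
      case False
      \<comment> \<open>Here \<open>X\<close> itself is compact and serves as the core, and only the
        empty closed set lies outside it.\<close>
      have "\<tau> \<le>o natLeq"
        by (rule not_ordLess_imp_ordLeq[OF natLeq_Card_order conjunct2[OF \<tau>] False])
      from compact_imp_locally_finitely_coverable[OF compact_lt_mono[OF X this]]
      show ?thesis
        by (intro exI[of _ "topspace X"]) auto
    qed
    then obtain K where K: "K \<subseteq> topspace X" "locally_finitely_coverable X natLeq K"
        "\<And>C. closedin X C \<Longrightarrow> C \<subseteq> topspace X - K \<Longrightarrow>
          C = {} \<or> (\<exists>A :: 't set. infinite A \<and> |A| <o \<tau> \<and> compact_lt X (cardSuc |A| ) C)"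
      by auto
    obtain \<phi> and S L :: "nat \<Rightarrow> 'b set" where \<phi>: "sv_selection X mtopology \<theta> \<phi>"
        "lower_semicontinuous X mtopology \<phi>" and SL: "\<forall>n. |S n| <o natLeq" "\<forall>n. |L n| <o \<tau>"
        "\<forall>n>0. sv_image \<phi> (topspace X) \<subseteq> mtopology closure_of (L n \<union> (\<Union>y\<in>S n. mball y (2 / 2 ^ n)))"
      by (rule selection_near_nodes[OF K(1,2) natLeq_Cinfinite natLeq_ordLeq_cinfinite[OF \<tau>] \<tau> K(3)])
    have "compact_lt mtopology \<tau> (mtopology closure_of sv_image \<phi> (topspace X))"
    proof (rule compact_lt_if_totally_bounded[OF complete closedin_closure_of \<tau>])
      fix \<epsilon> :: real assume "0 < \<epsilon>"
      then obtain n where n: "0 < n" "2 / 2 ^ n < \<epsilon>"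
        using pow_less by blast
      have "mball y (2 / 2 ^ n) \<subseteq> mball y \<epsilon>" for y
        using n(2) by (intro mball_subset_concentric) simp
      then have "mtopology closure_of (L n \<union> (\<Union>y\<in>S n. mball y (2 / 2 ^ n))) \<subseteq>
          mtopology closure_of (L n \<union> (\<Union>y\<in>S n. mball y \<epsilon>))"
        by (intro closure_of_mono) blast
      then have "sv_image \<phi> (topspace X) \<subseteq> mtopology closure_of (L n \<union> (\<Union>y\<in>S n. mball y \<epsilon>))"
        using SL(3) n(1) by blast
      from closure_of_minimal[OF this closedin_closure_of]
      have "mtopology closure_of sv_image \<phi> (topspace X) \<subseteq>
          mtopology closure_of (L n \<union> (\<Union>y\<in>S n. mball y \<epsilon>))" .
      moreover have "finite (S n)"
        using SL(1) by (simp add: finite_iff_ordLess_natLeq)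
      ultimately show "\<exists>S L. finite S \<and> |L :: 'b set| <o \<tau> \<and>
          mtopology closure_of sv_image \<phi> (topspace X) \<subseteq> mtopology closure_of (L \<union> (\<Union>y\<in>S. mball y \<epsilon>))"
        using SL(2) by (intro exI[of _ "S n"] exI[of _ "L n"]) simp
    qed
    with \<phi> show thesis
      using True by (intro that[of \<phi>]) simp_all
  next
    case False
    have unc: "natLeq <o \<tau>"
      by (rule not_sequential_imp_uncountable[OF \<tau> False])
    have bound: "C = {} \<or> (\<exists>A :: 't set. infinite A \<and> |A| <o \<tau> \<and> compact_lt X (cardSuc |A| ) C)"
      if "closedin X C" "C \<subseteq> topspace X - F" for C
      using infinite_bound[OF unc small[OF that]] by simp
    have refl: "\<tau> \<le>o \<tau>"
      using \<tau> by (simp add: card_order_on_well_order_on ordLeq_reflexive)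
    obtain \<phi> and S L :: "nat \<Rightarrow> 'b set" where \<phi>: "sv_selection X mtopology \<theta> \<phi>"
        "lower_semicontinuous X mtopology \<phi>" and SL: "\<forall>n. |S n| <o \<tau>" "\<forall>n. |L n| <o \<tau>"
        "\<forall>n>0. sv_image \<phi> (topspace X) \<subseteq> mtopology closure_of (L n \<union> (\<Union>y\<in>S n. mball y (2 / 2 ^ n)))"
      by (rule selection_near_nodes[OF F \<tau> refl \<tau> bound])
    \<comment> \<open>The radii \<open>2 / 2 ^ n\<close> tend to \<open>0\<close>, so the centres of
      the balls from all levels together with the sets \<open>L n\<close> are dense in the
      image.\<close>
    define T where "T = (\<Union>n. S n \<union> L n)"
    have "|S n \<union> L n| <o \<tau>" for n
      using SL(1,2) by (intro card_of_Un_ordLess[OF \<tau>]) simp_all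
    then have T: "|T| <o \<tau>"
      unfolding T_def by (rule countable_UN_ordLess[OF \<tau> False unc])
    have dense: "sv_image \<phi> (topspace X) \<subseteq> mtopology closure_of T"
    proof
      fix y assume y: "y \<in> sv_image \<phi> (topspace X)"
      have yn: "y \<in> mtopology closure_of (L n \<union> (\<Union>y\<in>S n. mball y (2 / 2 ^ n)))" if "0 < n" for n
        using SL(3) y that by blast
      have yM: "y \<in> M"
        using subsetD[OF closure_of_subset_topspace yn[OF zero_less_one]] by simp
      have "\<forall>r>0. \<exists>z\<in>T. z \<in> mball y r"
      proof (intro allI impI)
        fix r :: real assume r: "0 < r"
        then obtain n where n: "0 < n" "2 / 2 ^ n < r / 2"
          using pow_less[of "r / 2"] by auto
        have "\<exists>z\<in>L n \<union> (\<Union>y\<in>S n. mball y (2 / 2 ^ n)). z \<in> mball y (r / 2)"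
          by (rule CollectD[OF yn[OF n(1), unfolded metric_closure_of], THEN conjunct2, rule_format,
                OF half_gt_zero[OF r]])
        then obtain z where z: "z \<in> L n \<union> (\<Union>y\<in>S n. mball y (2 / 2 ^ n))" "z \<in> mball y (r / 2)"
          by (elim bexE)
        show "\<exists>z\<in>T. z \<in> mball y r"
        proof (cases "z \<in> L n")
          case True
          then show ?thesis
            using z(2) r by (intro bexI[of _ z]) (auto simp: T_def)
        next
          case False
          then obtain u where u: "u \<in> S n" "z \<in> mball u (2 / 2 ^ n)"
            using z(1) by blast
          have "d y u \<le> d y z + d z u"
            using u(2) z(2) by (intro triangle) simp_all
          then have "d y u < r"
            using u(2) z(2) n(2) commute[of z u] by simp
          then show ?thesis
            using u yM by (intro bexI[of _ u]) (auto simp: T_def)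
        qed
      qed
      then show "y \<in> mtopology closure_of T"
        using yM unfolding metric_closure_of by simp
    qed
    have "compact_lt mtopology \<tau> (mtopology closure_of sv_image \<phi> (topspace X))"
      by (rule compact_lt_closed_subset[OF compact_lt_closure_of[OF \<tau> T] closure_of_subset_topspace
            closedin_closure_of closure_of_minimal[OF dense closedin_closure_of]])
    then show thesis
      using \<phi> weight_subtopology_ordLess[OF \<tau> unc T dense] by (intro that[of \<phi>]) simp_all
  qed
qed

end

section \<open>Covers of the whole space, discrete targets and the equivalences\<close>

lemma compact_lt_topspace:
  fixes \<tau> :: "'t rel"
  assumes \<tau>: "Cinfinite \<tau>" and F: "compact_lt X \<tau> F" "F \<subseteq> topspace X"
    and small: "\<And>C. closedin X C \<Longrightarrow> C \<subseteq> topspace X - F \<Longrightarrow> compact_lt X \<tau> C"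
  shows "compact_lt X \<tau> (topspace X)"
  unfolding compact_lt_def
proof (intro allI impI, elim conjE)
  fix \<U> assume \<U>: "\<forall>U\<in>\<U>. openin X U" "topspace X \<subseteq> \<Union>\<U>"
  then have "F \<subseteq> \<Union>\<U>"
    using F(2) by blast
  with F(1) \<U>(1) obtain \<V> where \<V>: "\<V> \<subseteq> \<U>" "F \<subseteq> \<Union>\<V>" "|\<V>| <o \<tau>"
    unfolding compact_lt_def by auto
  define C where "C = topspace X - \<Union>\<V>"
  have "openin X (\<Union>\<V>)"
    using \<V>(1) \<U>(1) by blast
  then have "closedin X C"
    unfolding C_def by blast
  moreover have "C \<subseteq> topspace X - F" "C \<subseteq> \<Union>\<U>"
    using \<V>(2) \<U>(2) by (auto simp: C_def)
  ultimately obtain \<W> where \<W>: "\<W> \<subseteq> \<U>" "C \<subseteq> \<Union>\<W>" "|\<W>| <o \<tau>"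
    using small[of C] \<U>(1) unfolding compact_lt_def by auto
  show "\<exists>\<V>\<subseteq>\<U>. topspace X \<subseteq> \<Union>\<V> \<and> |\<V>| <o \<tau>"
  proof (intro exI conjI)
    show "|\<V> \<union> \<W>| <o \<tau>"
      by (rule card_of_Un_ordLess[OF \<tau> \<V>(3) \<W>(3)])
    show "\<V> \<union> \<W> \<subseteq> \<U>" "topspace X \<subseteq> \<Union>(\<V> \<union> \<W>)"
      using \<V>(1) \<W>(1,2) by (auto simp: C_def)
  qed
qed

text \<open>The preimages of single points of \<open>D\<close> form an open cover of
  \<open>X\<close>; the indices of a small subcover are the required points.\<close>

lemma small_hitting_set:
  fixes D :: "'b set"
  assumes X: "compact_lt X \<tau> (topspace X)" and \<theta>: "lower_semicontinuous X (discrete_topology D) \<theta>"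
  obtains B where "B \<subseteq> D" "|B| <o \<tau>" "\<forall>x\<in>topspace X. \<theta> x \<inter> B \<noteq> {}"
proof -
  have op: "openin X (sv_vimage X \<theta> {y})" if "y \<in> D" for y
    using \<theta> that by (simp add: lower_semicontinuous_def)
  have cover: "topspace X \<subseteq> (\<Union>y\<in>D. sv_vimage X \<theta> {y})"
    using \<theta> by (fastforce simp: lower_semicontinuous_def set_valued_map_def sv_vimage_def)
  obtain B where B: "B \<subseteq> D" "|B| <o \<tau>" "topspace X \<subseteq> (\<Union>y\<in>B. sv_vimage X \<theta> {y})"
    by (rule compact_lt_indexed[OF X op cover])
  have "\<forall>x\<in>topspace X. \<theta> x \<inter> B \<noteq> {}"
    using B(3) by (auto simp: sv_vimage_def)
  with B(1,2) show thesis
    by (rule that)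
qed

theorem theorem2p7:
  fixes X :: "'a topology" and F :: "'a set" and \<tau> :: "'t rel"
  assumes "t1_space X" and "regular_space X"
    and "F \<subseteq> topspace X" and "paracompact_in X F"
    and "Cinfinite \<tau>"
    and "degree_of_compactness (subtopology X F) \<le>o \<tau>"
    and "\<And>C. closedin X C \<Longrightarrow> C \<subseteq> topspace X - F \<Longrightarrow>
            degree_of_compactness (subtopology X C) <o \<tau>"
  shows
    "(degree_of_compactness X \<le>o \<tau> \<longleftrightarrow>
        (\<forall>(Y :: 'b topology) \<theta>. completely_metrizable_space Y \<and>
            lower_semicontinuous X Y \<theta> \<and> closed_valued X Y \<theta> \<longrightarrow>
          (\<exists>\<phi>. sv_selection X Y \<theta> \<phi> \<and> lower_semicontinuous X Y \<phi> \<and>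
            degree_of_compactness
              (subtopology Y (Y closure_of sv_image \<phi> (topspace X))) \<le>o \<tau>)))
   \<and> (degree_of_compactness X \<le>o \<tau> \<longleftrightarrow>
        (\<forall>(Y :: 'b topology) \<theta>. completely_metrizable_space Y \<and>
            lower_semicontinuous X Y \<theta> \<and> closed_valued X Y \<theta> \<longrightarrow>
          (\<exists>g. sv_selection X Y \<theta> g \<and>
            degree_of_compactness
              (subtopology Y (Y closure_of sv_image g (topspace X))) \<le>o \<tau>)))
   \<and> (degree_of_compactness X \<le>o \<tau> \<longleftrightarrow>
        (\<forall>(Y :: 'b topology) \<theta>. completely_metrizable_space Y \<and>
            lower_semicontinuous X Y \<theta> \<and> closed_valued X Y \<theta> \<longrightarrow>
          (\<exists>g. single_valued_selection X \<theta> g \<and>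
            degree_of_compactness
              (subtopology Y (Y closure_of (g ` topspace X))) \<le>o \<tau>)))
   \<and> (degree_of_compactness X \<le>o \<tau> \<longleftrightarrow>
        (\<forall>(D :: 'b set) \<theta>. lower_semicontinuous X (discrete_topology D) \<theta> \<longrightarrow>
          (\<exists>\<phi>. sv_selection X (discrete_topology D) \<theta> \<phi> \<and>
            lower_semicontinuous X (discrete_topology D) \<phi> \<and>
            |sv_image \<phi> (topspace X)| <o \<tau>)))
   \<and> (degree_of_compactness X \<le>o \<tau> \<longleftrightarrow>
        (\<forall>(D :: 'b set) \<theta>. lower_semicontinuous X (discrete_topology D) \<theta> \<longrightarrow>
          (\<exists>g. sv_selection X (discrete_topology D) \<theta> g \<and>
            |sv_image g (topspace X)| <o \<tau>)))
   \<and> (degree_of_compactness X \<le>o \<tau> \<longleftrightarrow>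
        (\<forall>(D :: 'b set) \<theta>. lower_semicontinuous X (discrete_topology D) \<theta> \<longrightarrow>
          (\<exists>g. single_valued_selection X \<theta> g \<and> |g ` topspace X| <o \<tau>)))
   \<and> (degree_of_compactness X \<le>o \<tau> \<longleftrightarrow>
        (\<forall>\<U>. open_cover X \<U> \<longrightarrow>
          (\<exists>\<V>. \<V> \<subseteq> \<U> \<and> open_cover X \<V> \<and> |\<V>| <o \<tau>)))
   \<and> (\<not> sequential_cardinal \<tau> \<longrightarrow>
        (degree_of_compactness X \<le>o \<tau> \<longleftrightarrow>
          (\<forall>(Y :: 'b topology) \<theta>. completely_metrizable_space Y \<and>
              lower_semicontinuous X Y \<theta> \<and> closed_valued X Y \<theta> \<longrightarrow>
            (\<exists>\<phi>. sv_selection X Y \<theta> \<phi> \<and> lower_semicontinuous X Y \<phi> \<and>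
              weight (subtopology Y (sv_image \<phi> (topspace X))) <o \<tau>))))"
proof -
  note F = assms(3) and \<tau> = assms(5)
  have co: "Card_order \<tau>"
    using \<tau> by simp
  have small: "\<exists>A :: 't set. |A| <o \<tau> \<and> compact_lt X (cardSuc |A| ) C"
    if C: "closedin X C" "C \<subseteq> topspace X - F" for C
  proof -
    obtain A :: "'t set" where A: "|A| <o \<tau>" "compact_lt X ( |A| ) C"
      by (rule degree_of_compactness_less_imp[OF assms(7)[OF C] closedin_subset[OF C(1)]])
    \<comment> \<open>The strict bound \<open>|A|\<close> is relaxed to the non-strict one, the form
      that is stable under unions.\<close>
    from compact_lt_mono[OF A(2) cardSuc_ordLeq[OF card_of_Card_order]] A(1) show ?thesis
      by (intro exI[of _ A]) simp
  qed
  have small': "compact_lt X \<tau> C" if C: "closedin X C" "C \<subseteq> topspace X - F" for C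
    using ordLess_imp_ordLeq[OF assms(7)[OF C]]
    by (simp only: degree_of_compactness_le_iff[OF co closedin_subset[OF C(1)]])
  have cF: "compact_lt X \<tau> F"
    using assms(6) by (simp only: degree_of_compactness_le_iff[OF co F])
  have lfF: "locally_finitely_coverable X \<tau> F"
    by (rule paracompact_in_imp_locally_finitely_coverable[OF assms(4) cF])
  have X: "compact_lt X \<tau> (topspace X)"
    by (rule compact_lt_topspace[OF \<tau> cF F small'])
  then have K1: "degree_of_compactness X \<le>o \<tau>"
    using degree_of_compactness_le_iff[OF co subset_refl, of X] by (simp add: subtopology_topspace)
  have metrizable: "\<exists>\<phi>. sv_selection X Y \<theta> \<phi> \<and> lower_semicontinuous X Y \<phi> \<and>
      compact_lt Y \<tau> (Y closure_of sv_image \<phi> (topspace X)) \<and>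
      (\<not> sequential_cardinal \<tau> \<longrightarrow> weight (subtopology Y (sv_image \<phi> (topspace X))) <o \<tau>)"
    if Y: "completely_metrizable_space Y" "lower_semicontinuous X Y \<theta>" "closed_valued X Y \<theta>"
    for Y :: "'b topology" and \<theta>
  proof -
    obtain M d where Md: "Metric_space M d" "Metric_space.mcomplete M d" "Y = Metric_space.mtopology M d"
      using Y(1) unfolding completely_metrizable_space_def by blast
    interpret Metric_space M d
      by (rule Md(1))
    interpret lsc_closed_valued_map M d X \<theta>
      by unfold_locales (use Md(2) assms(2) Y(2,3) in \<open>simp_all add: Md(3)\<close>)
    obtain \<phi> where \<phi>: "sv_selection X mtopology \<theta> \<phi>" "lower_semicontinuous X mtopology \<phi>"
        "compact_lt mtopology \<tau> (mtopology closure_of sv_image \<phi> (topspace X))"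
        "\<not> sequential_cardinal \<tau> \<longrightarrow> weight (subtopology mtopology (sv_image \<phi> (topspace X))) <o \<tau>"
      by (rule small_selection[OF assms(1) F lfF \<tau> X small])
    then show ?thesis
      unfolding Md(3) by (intro exI[of _ \<phi>] conjI)
  qed
  have compact_closure: "degree_of_compactness (subtopology Y (Y closure_of Z)) \<le>o \<tau>"
    if "compact_lt Y \<tau> (Y closure_of Z')" "Z \<subseteq> Z'" for Y :: "'b topology" and Z Z'
    unfolding degree_of_compactness_le_iff[OF co closure_of_subset_topspace]
    by (rule compact_lt_closed_subset[OF that(1) closure_of_subset_topspace closedin_closure_of
          closure_of_mono[OF that(2)]])
  show ?thesis
  \<comment> \<open>\<open>K1\<close> disposes of every implication towards (K1), so the remaining
    goals are the assertions themselves.\<close>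
  proof (intro conjI impI iffI K1)
    show "\<forall>(Y :: 'b topology) \<theta>. completely_metrizable_space Y \<and>
            lower_semicontinuous X Y \<theta> \<and> closed_valued X Y \<theta> \<longrightarrow>
          (\<exists>\<phi>. sv_selection X Y \<theta> \<phi> \<and> lower_semicontinuous X Y \<phi> \<and>
            degree_of_compactness
              (subtopology Y (Y closure_of sv_image \<phi> (topspace X))) \<le>o \<tau>)"
    proof (intro allI impI, elim conjE)
      fix Y :: "'b topology" and \<theta>
      assume Y: "completely_metrizable_space Y" "lower_semicontinuous X Y \<theta>" "closed_valued X Y \<theta>"
      obtain \<phi> where \<phi>: "sv_selection X Y \<theta> \<phi>" "lower_semicontinuous X Y \<phi>"
          "compact_lt Y \<tau> (Y closure_of sv_image \<phi> (topspace X))"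
        using metrizable[OF Y] by (elim exE conjE)
      from \<phi>(1,2) compact_closure[OF \<phi>(3) subset_refl]
      show "\<exists>\<phi>. sv_selection X Y \<theta> \<phi> \<and> lower_semicontinuous X Y \<phi> \<and>
            degree_of_compactness (subtopology Y (Y closure_of sv_image \<phi> (topspace X))) \<le>o \<tau>"
        by (intro exI[of _ \<phi>] conjI)
    qed
    show "\<forall>(Y :: 'b topology) \<theta>. completely_metrizable_space Y \<and>
            lower_semicontinuous X Y \<theta> \<and> closed_valued X Y \<theta> \<longrightarrow>
          (\<exists>g. sv_selection X Y \<theta> g \<and>
            degree_of_compactness
              (subtopology Y (Y closure_of sv_image g (topspace X))) \<le>o \<tau>)"
    proof (intro allI impI, elim conjE)
      fix Y :: "'b topology" and \<theta>
      assume Y: "completely_metrizable_space Y" "lower_semicontinuous X Y \<theta>" "closed_valued X Y \<theta>"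
      obtain \<phi> where \<phi>: "sv_selection X Y \<theta> \<phi>"
          "compact_lt Y \<tau> (Y closure_of sv_image \<phi> (topspace X))"
        using metrizable[OF Y] by (elim exE conjE)
      from \<phi>(1) compact_closure[OF \<phi>(2) subset_refl]
      show "\<exists>g. sv_selection X Y \<theta> g \<and>
            degree_of_compactness (subtopology Y (Y closure_of sv_image g (topspace X))) \<le>o \<tau>"
        by (intro exI[of _ \<phi>] conjI)
    qed
    show "\<forall>(Y :: 'b topology) \<theta>. completely_metrizable_space Y \<and>
            lower_semicontinuous X Y \<theta> \<and> closed_valued X Y \<theta> \<longrightarrow>
          (\<exists>g. single_valued_selection X \<theta> g \<and>
            degree_of_compactness
              (subtopology Y (Y closure_of (g ` topspace X))) \<le>o \<tau>)"
    proof (intro allI impI, elim conjE)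
      fix Y :: "'b topology" and \<theta>
      assume Y: "completely_metrizable_space Y" "lower_semicontinuous X Y \<theta>" "closed_valued X Y \<theta>"
      obtain \<phi> where \<phi>: "sv_selection X Y \<theta> \<phi>"
          "compact_lt Y \<tau> (Y closure_of sv_image \<phi> (topspace X))"
        using metrizable[OF Y] by (elim exE conjE)
      \<comment> \<open>Choosing from \<open>\<phi> x\<close> rather than from
        \<open>\<theta> x\<close> keeps the closure of the image inside a set already known to have
        small covers.\<close>
      define g where "g x = (SOME y. y \<in> \<phi> x)" for x
      have g: "g x \<in> \<phi> x" if x: "x \<in> topspace X" for x
      proof -
        have "\<phi> x \<noteq> {}"
          using \<phi>(1) x by (simp add: sv_selection_def set_valued_map_def)
        then show ?thesis
          by (simp add: g_def some_in_eq)
      qed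
      have "g ` topspace X \<subseteq> sv_image \<phi> (topspace X)"
        unfolding sv_image_def using g by (intro image_subsetI UN_I)
      note compact_closure[OF \<phi>(2) this]
      moreover have "single_valued_selection X \<theta> g"
        unfolding single_valued_selection_def
      proof
        fix x assume x: "x \<in> topspace X"
        then have "\<phi> x \<subseteq> \<theta> x"
          using \<phi>(1) by (simp add: sv_selection_def)
        then show "g x \<in> \<theta> x"
          using g[OF x] by (rule subsetD)
      qed
      ultimately show "\<exists>g. single_valued_selection X \<theta> g \<and>
            degree_of_compactness (subtopology Y (Y closure_of (g ` topspace X))) \<le>o \<tau>"
        by (intro exI[of _ g] conjI)
    qed
    have discrete: "\<exists>\<phi>. sv_selection X (discrete_topology D) \<theta> \<phi> \<and>
            lower_semicontinuous X (discrete_topology D) \<phi> \<and>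
            |sv_image \<phi> (topspace X)| <o \<tau>"
      if \<theta>: "lower_semicontinuous X (discrete_topology D) \<theta>" for D :: "'b set" and \<theta>
    proof -
      obtain B where B: "B \<subseteq> D" "|B| <o \<tau>" "\<forall>x\<in>topspace X. \<theta> x \<inter> B \<noteq> {}"
        by (rule small_hitting_set[OF X \<theta>])
      \<comment> \<open>Restricting to \<open>B\<close> preserves lower semi-continuity because in a
        discrete space \<open>B \<inter> H\<close> is open for every \<open>H\<close> contained in
        \<open>D\<close>.\<close>
      define \<phi> where "\<phi> x = \<theta> x \<inter> B" for x
      have map: "set_valued_map X (discrete_topology D) \<phi>"
        using \<theta> B(1,3) by (auto simp: lower_semicontinuous_def set_valued_map_def \<phi>_def)
      have "openin X (sv_vimage X \<phi> H)" if "H \<subseteq> D" for H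
      proof -
        have "sv_vimage X \<phi> H = sv_vimage X \<theta> (B \<inter> H)"
          by (auto simp: sv_vimage_def \<phi>_def)
        moreover have "openin (discrete_topology D) (B \<inter> H)"
          using that by auto
        ultimately show ?thesis
          using \<theta> by (simp add: lower_semicontinuous_def)
      qed
      then have "lower_semicontinuous X (discrete_topology D) \<phi>"
        using map by (simp add: lower_semicontinuous_def)
      moreover have "sv_selection X (discrete_topology D) \<theta> \<phi>"
        using map by (simp add: sv_selection_def \<phi>_def)
      moreover have "sv_image \<phi> (topspace X) \<subseteq> B"
        by (auto simp: sv_image_def \<phi>_def)
      from ordLeq_ordLess_trans[OF card_of_mono1[OF this] B(2)]
      have "|sv_image \<phi> (topspace X)| <o \<tau>" .
      ultimately show ?thesis
        by (intro exI[of _ \<phi>] conjI)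
    qed
    show "\<forall>(D :: 'b set) \<theta>. lower_semicontinuous X (discrete_topology D) \<theta> \<longrightarrow>
          (\<exists>\<phi>. sv_selection X (discrete_topology D) \<theta> \<phi> \<and>
            lower_semicontinuous X (discrete_topology D) \<phi> \<and>
            |sv_image \<phi> (topspace X)| <o \<tau>)"
      by (intro allI impI discrete)
    show "\<forall>(D :: 'b set) \<theta>. lower_semicontinuous X (discrete_topology D) \<theta> \<longrightarrow>
          (\<exists>g. sv_selection X (discrete_topology D) \<theta> g \<and>
            |sv_image g (topspace X)| <o \<tau>)"
    proof (intro allI impI)
      fix D :: "'b set" and \<theta>
      assume "lower_semicontinuous X (discrete_topology D) \<theta>"
      from discrete[OF this] show "\<exists>g. sv_selection X (discrete_topology D) \<theta> g \<and>
          |sv_image g (topspace X)| <o \<tau>"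
        by (elim exE conjE) (intro exI conjI)
    qed
    show "\<forall>(D :: 'b set) \<theta>. lower_semicontinuous X (discrete_topology D) \<theta> \<longrightarrow>
          (\<exists>g. single_valued_selection X \<theta> g \<and> |g ` topspace X| <o \<tau>)"
    proof (intro allI impI)
      fix D :: "'b set" and \<theta>
      assume \<theta>: "lower_semicontinuous X (discrete_topology D) \<theta>"
      obtain B where B: "B \<subseteq> D" "|B| <o \<tau>" "\<forall>x\<in>topspace X. \<theta> x \<inter> B \<noteq> {}"
        by (rule small_hitting_set[OF X \<theta>])
      define g where "g x = (SOME y. y \<in> \<theta> x \<inter> B)" for x
      have g: "g x \<in> \<theta> x \<inter> B" if "x \<in> topspace X" for x
        unfolding g_def by (rule iffD2[OF some_in_eq bspec[OF B(3) that]])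
      have "g ` topspace X \<subseteq> B"
        by (intro image_subsetI) (rule IntD2[OF g])
      from ordLeq_ordLess_trans[OF card_of_mono1[OF this] B(2)]
      have "|g ` topspace X| <o \<tau>" .
      moreover have "single_valued_selection X \<theta> g"
        using IntD1[OF g] by (simp add: single_valued_selection_def)
      ultimately show "\<exists>g. single_valued_selection X \<theta> g \<and> |g ` topspace X| <o \<tau>"
        by (intro exI[of _ g] conjI)
    qed
    show "\<forall>\<U>. open_cover X \<U> \<longrightarrow>
          (\<exists>\<V>. \<V> \<subseteq> \<U> \<and> open_cover X \<V> \<and> |\<V>| <o \<tau>)"
    proof (intro allI impI)
      fix \<U> assume \<U>: "open_cover X \<U>"
      then have U: "\<forall>U\<in>\<U>. openin X U" "\<Union>\<U> = topspace X"
        by (simp_all add: open_cover_def)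
      obtain \<V> where \<V>: "\<V> \<subseteq> \<U>" "topspace X \<subseteq> \<Union>\<V>" "|\<V>| <o \<tau>"
        using mp[OF spec[OF X[unfolded compact_lt_def]] conjI[OF U(1) equalityD2[OF U(2)]]]
        by (elim exE conjE)
      have "\<Union>\<V> = topspace X"
        using \<V>(2) Union_mono[OF \<V>(1)] U(2) by simp
      moreover have "\<forall>V\<in>\<V>. openin X V"
        using U(1) \<V>(1) by blast
      ultimately have "open_cover X \<V>"
        by (simp add: open_cover_def)
      with \<V>(1,3) show "\<exists>\<V>. \<V> \<subseteq> \<U> \<and> open_cover X \<V> \<and> |\<V>| <o \<tau>"
        by (intro exI[of _ \<V>] conjI)
    qed
    assume ns: "\<not> sequential_cardinal \<tau>"
    show "\<forall>(Y :: 'b topology) \<theta>. completely_metrizable_space Y \<and>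
              lower_semicontinuous X Y \<theta> \<and> closed_valued X Y \<theta> \<longrightarrow>
            (\<exists>\<phi>. sv_selection X Y \<theta> \<phi> \<and> lower_semicontinuous X Y \<phi> \<and>
              weight (subtopology Y (sv_image \<phi> (topspace X))) <o \<tau>)"
    proof (intro allI impI, elim conjE)
      fix Y :: "'b topology" and \<theta>
      assume Y: "completely_metrizable_space Y" "lower_semicontinuous X Y \<theta>" "closed_valued X Y \<theta>"
      obtain \<phi> where \<phi>: "sv_selection X Y \<theta> \<phi>" "lower_semicontinuous X Y \<phi>"
          "\<not> sequential_cardinal \<tau> \<longrightarrow> weight (subtopology Y (sv_image \<phi> (topspace X))) <o \<tau>"
        using metrizable[OF Y] by (elim exE conjE)
      from \<phi>(1,2) mp[OF \<phi>(3) ns]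
      show "\<exists>\<phi>. sv_selection X Y \<theta> \<phi> \<and> lower_semicontinuous X Y \<phi> \<and>
              weight (subtopology Y (sv_image \<phi> (topspace X))) <o \<tau>"
        by (intro exI[of _ \<phi>] conjI)
    qed
  qed
qed

end
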